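(* Suppose we are in one of the Cases I, II, III described in the context, and let $\tau(t,\omega,x)=(\omega\cdot t,u(t,\omega,x))$ be the skew-product semiflow induced on $\Omega\times BU$ by $$\frac{d}{dt}Dz_t=F(\omega\cdot t,z_t),\quad t\ge0,\ \omega\in\Omega.$$ Let $(\omega_0,x_0)\in\Omega\times BU$ have forward orbit $\{\tau(t,\omega_0,x_0):t\ge0\}$ relatively compact for the product metric topology and uniformly stable for $\le_A$ in bounded sets. Let $K$ denote the omega-limit set of $(\omega_0,x_0)$. Then: (i) $K$ is uniformly stable for $\le_A$ in bounded sets. (ii) $(K,\tau,\mathbb{R}^+)$ is uniformly stable.
   Context: $X=C((-\infty,0],\mathbb{R}^m)$ with the compact-open topology, metrized by $\mathsf{d}(x,y)=\sum_{n\ge1}2^{-n}\frac{\|x-y\|_n}{1+\|x-y\|_n}$, $\|x\|_n=\sup_{s\in[-n,0]}\|x(s)\|$, where $\|\cdot\|$ is the maximum norm on $\mathbb{R}^m$. $BU\subset X$ is the Banach space of bounded, uniformly continuous functions with norm $\|x\|_\infty=\sup_{s\le0}\|x(s)\|$, and $B_k=\{x\in BU:\|x\|_\infty\le k\}$. For a continuous function $x$ on $(-\infty,a]$ and $t\le a$, $x_t(s)=x(t+s)$ for $s\le0$. The product metric topology on $\Omega\times X$ uses $\mathsf{d}$ on $X$; relatively compact means having compact closure in $\Omega\times X$. Operator $D\colon BU\to\mathbb{R}^m$: (D1) $D$ is linear and norm-continuous. (D2) For each $k>0$, $D|_{B_k}$ is continuous for the compact-open topology. (D3) $D$ is atomic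 at $0$; without loss of generality $D$ has the form $Dx=x(0)-\int_{-\infty}^0[d\nu(s)]x(s)$ with $\nu=[\nu_{ij}]$ an $m\times m$ matrix of real regular Borel measures of finite total variation with $|\nu_{ij}|(\{0\})=0$. (D4) $D$ is stable: there is a continuous $c\colon[0,\infty)\to[0,\infty)$ with $c(t)\to0$ as $t\to\infty$ such that for each $\varphi\in BU$ with $D\varphi=0$ the solution of $Dx_t=0$ ($t\ge0$), $x_0=\varphi$, satisfies $\|x(t)\|\le c(t)\|\varphi\|_\infty$ for all $t\ge0$. (D5) The measures $\nu_{ij}$ are positive for all $i,j$. $(\Omega,\sigma,\mathbb{R})$ is a minimal continuous flow on a compact metric space, $\omega\cdot t=\sigma(t,\omega)$. Order: inequalities in $\mathbb{R}^m$ and between matrices are componentwise; $x\le y$ in $BU$ means $x(s)\le y(s)$ for all $s\le0$. $A$ is a fixed quasipositive $m\times m$ real matrix (there is $\lambda>0$ with $A+\lambda I\ge0$), and $r>0$ is fixed. For $x,y\in BU$: $x\le_{A,r}y$ iff $x\le y$ and $y(t)-x(t)\ge e^{A(t-s)}(y(s)-x(s))$ for $-r\le s\le t\le0$; $x\le_{A,\infty}y$ iff $x\le y$ and $y(t)-x(t)\ge e^{A(t-s)}(y(s)-x(s))$ for $-\infty<s\le t\le0$. The symbol $\le_A$ denotes one of these relations, as specified in each case. (A1) All eigenvalues of $A$ have strictly negative real part. Function $F\colon\Omega\times BU\to\mathbb{R}^m$: (F1) $F$ is continuous on $\Omega\times BU$ and locally Lipschitz in $x$ for $\|\cdot\|_\infty$.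 (F2) For each $k>0$, $F(\Omega\times B_k)$ is bounded. (F3) For each $k>0$, $F\colon\Omega\times B_k\to\mathbb{R}^m$ is continuous when $B_k$ carries the compact-open topology. (F4) If $x,y\in BU$ with $x\le_A y$, then $F(\omega,y)-F(\omega,x)\ge A(Dy-Dx)$ for each $\omega\in\Omega$. For $(\omega,x)\in\Omega\times BU$, $z(t,\omega,x)$ is the unique (locally defined) solution with $z(s,\omega,x)=x(s)$ for $s\le0$, and $u(t,\omega,x)(s)=z(t+s,\omega,x)$ for $s\le0$. Cases: Case I: $\nu\equiv0$ (so $Dx=x(0)$ and the equations are $z'(t)=F(\omega\cdot t,z_t)$), (F1)–(F4) hold, and $\le_A$ is $\le_{A,r}$. Case II: $\nu\equiv0$, (F1)–(F4) and (A1) hold, and $\le_A$ is $\le_{A,\infty}$. Case III: (D1)–(D5), (F1)–(F4) and (A1) hold, and $\le_A$ is $\le_{A,\infty}$. Omega-limit set: $\mathcal{O}(\omega_0,x_0)=\{(\omega,x)\in\Omega\times BU:\exists\,t_n\uparrow\infty$ with $\omega_0\cdot t_n\to\omega$ and $\mathsf{d}(u(t_n,\omega_0,x_0),x)\to0\}$. Stability notions: • A compact positively $\tau$-invariant set $K\subset\Omega\times BU$ (compact for the product metric topology): $(K,\tau,\mathbb{R}^+)$ is uniformly stable if for any $\varepsilon>0$ there is $\delta>0$ such that if $(\omega,x),(\omega,y)\in K$ and $\mathsf{d}(x,y)<\delta$, then $\mathsf{d}(u(t,\omega,x),u(t,\omega,y))\le\varepsilon$ for all $t\ge0$. • A forward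 orbit $\{\tau(t,\omega_0,x_0):t\ge0\}$ is uniformly stable for $\le_A$ in $B_k$ if for every $\varepsilon>0$ there is $\delta>0$ such that if $s\ge0$ and $\mathsf{d}(u(s,\omega_0,x_0),x)\le\delta$ for certain $x\in B_k$ with $x\le_A u(s,\omega_0,x_0)$ or $u(s,\omega_0,x_0)\le_A x$, then $\mathsf{d}(u(t+s,\omega_0,x_0),u(t,\omega_0\cdot s,x))\le\varepsilon$ for each $t\ge0$. It is uniformly stable for $\le_A$ in bounded sets if this holds for each $k>0$. • A positively $\tau$-invariant set $K\subset\Omega\times BU$ is uniformly stable for $\le_A$ in $B_k$ if for any $\varepsilon>0$ there is $\delta>0$ such that if $(\omega,x)\in K$, $(\omega,y)\in\Omega\times B_k$ satisfy $\mathsf{d}(x,y)<\delta$ and $x\le_A y$ or $y\le_A x$, then $\mathsf{d}(u(t,\omega,x),u(t,\omega,y))\le\varepsilon$ for all $t\ge0$. It is uniformly stable for $\le_A$ in bounded sets if this holds for each $k>0$. *)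

theory Defs
  imports "HOL-Analysis.Analysis"
begin

section \<open>Spaces of histories\<close>

text \<open>A function on the half-line is a total function that equals \<^term>\<open>undefined\<close> on positive
  arguments (\<^const>\<open>extensional\<close>), so that equality of such functions is equality on the
  half-line. The maximum norm on \<^typ>\<open>real^'m\<close> is \<^const>\<open>infnorm\<close>, and the library order on
  \<^typ>\<open>real^'m\<close> is componentwise.\<close>

type_synonym 'm hist = "real \<Rightarrow> real^'m"

definition CX :: "('m::finite) hist set" where
  "CX = {x \<in> extensional {..0}. continuous_on {..0} x}"

definition BU :: "('m::finite) hist set" where
  "BU = {x \<in> extensional {..0}. uniformly_continuous_on {..0} x \<and> bounded (x ` {..0})}"

definition seminorm_on :: "nat \<Rightarrow> ('m::finite) hist \<Rightarrow> real" where
  "seminorm_on n x = (SUP s\<in>{- real n..0}. infnorm (x s))"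

definition supnorm :: "('m::finite) hist \<Rightarrow> real" where
  "supnorm x = (SUP s\<in>{..0}. infnorm (x s))"

text \<open>Both distances are set to 0 outside their spaces because \<^const>\<open>Metric_space\<close> asks for
  nonnegativity and symmetry everywhere. The sum over \<^term>\<open>n\<close> is shifted to start at 1.\<close>

definition co_dist :: "('m::finite) hist \<Rightarrow> 'm hist \<Rightarrow> real" where
  "co_dist x y = (if x \<in> CX \<and> y \<in> CX
     then (\<Sum>n. (1/2) ^ Suc n * (seminorm_on (Suc n) (\<lambda>s. x s - y s)
                 / (1 + seminorm_on (Suc n) (\<lambda>s. x s - y s))))
     else 0)"

definition BU_dist :: "('m::finite) hist \<Rightarrow> 'm hist \<Rightarrow> real" where
  "BU_dist x y = (if x \<in> BU \<and> y \<in> BU then supnorm (\<lambda>s. x s - y s) else 0)"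

definition co_top :: "('m::finite) hist topology" where
  "co_top = Metric_space.mtopology CX co_dist"

definition BU_top :: "('m::finite) hist topology" where
  "BU_top = Metric_space.mtopology BU BU_dist"

definition BB :: "real \<Rightarrow> ('m::finite) hist set" where
  "BB k = {x \<in> BU. supnorm x \<le> k}"

definition seg :: "(real \<Rightarrow> real^'m) \<Rightarrow> real \<Rightarrow> ('m::finite) hist" where
  "seg z t = restrict (\<lambda>s. z (t + s)) {..0}"

lemma BU_subset_CX: "BU \<subseteq> CX"
  by (auto simp: BU_def CX_def uniformly_continuous_imp_continuous)

lemma CX_bdd_above:
  assumes "x \<in> CX" "y \<in> CX"
  shows "bdd_above ((\<lambda>s. infnorm (x s - y s)) ` {- real n..0})"
proof -
  have "continuous_on {- real n..0} x" "continuous_on {- real n..0} y"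
    using assms by (auto simp: CX_def intro: continuous_on_subset)
  then have "compact ((\<lambda>s. infnorm (x s - y s)) ` {- real n..0})"
    by (intro compact_continuous_image continuous_intros) auto
  then show ?thesis by (simp add: compact_imp_bounded bounded_imp_bdd_above)
qed

lemma BU_bdd_above:
  assumes "x \<in> BU" "y \<in> BU"
  shows "bdd_above ((\<lambda>s. infnorm (x s - y s)) ` {..0})"
proof -
  from assms obtain a b where "\<And>s. s \<le> 0 \<Longrightarrow> norm (x s) \<le> a" "\<And>s. s \<le> 0 \<Longrightarrow> norm (y s) \<le> b"
    by (auto simp: BU_def bounded_iff)
  then have "infnorm (x s - y s) \<le> a + b" if "s \<le> 0" for s
    using that infnorm_le_norm[of "x s - y s"] norm_triangle_ineq4[of "x s" "y s"]
    by (smt (verit))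
  then show ?thesis by (intro bdd_aboveI2[where M = "a + b"]) auto
qed

lemma infnorm_SUP_metric:
  fixes x y z :: "real \<Rightarrow> real^'m"
  assumes "S \<noteq> {}"
    and xy: "bdd_above ((\<lambda>s. infnorm (x s - y s)) ` S)"
    and yz: "bdd_above ((\<lambda>s. infnorm (y s - z s)) ` S)"
  shows SUP_nonneg: "0 \<le> (SUP s\<in>S. infnorm (x s - y s))"
    and SUP_zero: "(SUP s\<in>S. infnorm (x s - y s)) = 0 \<longleftrightarrow> (\<forall>s\<in>S. x s = y s)"
    and SUP_triangle: "(SUP s\<in>S. infnorm (x s - z s))
           \<le> (SUP s\<in>S. infnorm (x s - y s)) + (SUP s\<in>S. infnorm (y s - z s))"
proof -
  obtain s0 where s0: "s0 \<in> S" using assms by auto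
  have up: "s \<in> S \<Longrightarrow> infnorm (x s - y s) \<le> (SUP s\<in>S. infnorm (x s - y s))"
    and up': "s \<in> S \<Longrightarrow> infnorm (y s - z s) \<le> (SUP s\<in>S. infnorm (y s - z s))" for s
    using cSUP_upper xy yz by fast+
  show nn: "0 \<le> (SUP s\<in>S. infnorm (x s - y s))"
    using up[OF s0] infnorm_pos_le[of "x s0 - y s0"] by linarith
  show "(SUP s\<in>S. infnorm (x s - y s)) = 0 \<longleftrightarrow> (\<forall>s\<in>S. x s = y s)"
  proof
    assume *: "(SUP s\<in>S. infnorm (x s - y s)) = 0"
    have "infnorm (x s - y s) = 0" if "s \<in> S" for s
      using up[OF that] * infnorm_pos_le[of "x s - y s"] by linarith
    then show "\<forall>s\<in>S. x s = y s" by (simp add: infnorm_eq_0)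
  next
    assume "\<forall>s\<in>S. x s = y s"
    then have "(SUP s\<in>S. infnorm (x s - y s)) = (SUP s\<in>S. (0::real))"
      by (intro SUP_cong) (auto simp: infnorm_0)
    then show "(SUP s\<in>S. infnorm (x s - y s)) = 0" using \<open>S \<noteq> {}\<close> by simp
  qed
  show "(SUP s\<in>S. infnorm (x s - z s))
      \<le> (SUP s\<in>S. infnorm (x s - y s)) + (SUP s\<in>S. infnorm (y s - z s))"
  proof (rule cSUP_least[OF \<open>S \<noteq> {}\<close>])
    fix s assume "s \<in> S"
    then show "infnorm (x s - z s)
      \<le> (SUP s\<in>S. infnorm (x s - y s)) + (SUP s\<in>S. infnorm (y s - z s))"
      using up[of s] up'[of s] infnorm_triangle[of "x s - y s" "y s - z s"] by simp
  qed
qed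

lemma Metric_space_BU: "Metric_space BU (BU_dist :: ('m::finite) hist \<Rightarrow> _)"
proof
  fix x y :: "'m hist"
  show "0 \<le> BU_dist x y"
    using SUP_nonneg[OF _ BU_bdd_above BU_bdd_above, of x y y]
    by (auto simp: BU_dist_def supnorm_def)
  show "BU_dist x y = BU_dist y x"
    by (simp add: BU_dist_def supnorm_def infnorm_sub conj_commute)
next
  fix x y :: "'m hist" assume *: "x \<in> BU" "y \<in> BU"
  have "x = y \<longleftrightarrow> (\<forall>s\<in>{..0}. x s = y s)"
    using * by (auto simp: BU_def intro: extensionalityI)
  then show "BU_dist x y = 0 \<longleftrightarrow> x = y"
    using SUP_zero[OF _ BU_bdd_above BU_bdd_above, of x y y] *
    by (simp add: BU_dist_def supnorm_def)
next
  fix x y z :: "'m hist" assume "x \<in> BU" "y \<in> BU" "z \<in> BU"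
  then show "BU_dist x z \<le> BU_dist x y + BU_dist y z"
    using SUP_triangle[OF _ BU_bdd_above BU_bdd_above, of x y z]
    by (simp add: BU_dist_def supnorm_def)
qed

lemma frac_bound: "0 \<le> a \<Longrightarrow> 0 \<le> a / (1 + a) \<and> a / (1 + a) \<le> (1::real)"
  by (simp add: divide_simps)

lemma frac_triangle:
  assumes "0 \<le> (a::real)" "0 \<le> b" "0 \<le> c" "c \<le> a + b"
  shows "c / (1 + c) \<le> a / (1 + a) + b / (1 + b)"
proof -
  have "c / (1 + c) \<le> (a + b) / (1 + (a + b))"
    using assms by (simp add: divide_simps) (simp add: algebra_simps)
  also have "\<dots> = a / (1 + (a + b)) + b / (1 + (a + b))"
    by (simp add: add_divide_distrib)
  also have "\<dots> \<le> a / (1 + a) + b / (1 + b)"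
    using assms by (intro add_mono divide_left_mono) auto
  finally show ?thesis .
qed

lemma Metric_space_CX: "Metric_space CX (co_dist :: ('m::finite) hist \<Rightarrow> _)"
proof -
  define p where "p n x y = seminorm_on (Suc n) (\<lambda>s. x s - y s :: real^'m)" for n x y
  define q where "q n x y = (1/2) ^ Suc n * (p n x y / (1 + p n x y))" for n x y
  have d: "co_dist x y = (if x \<in> CX \<and> y \<in> CX then (\<Sum>n. q n x y) else 0)" for x y
    by (simp add: co_dist_def q_def p_def)
  have p0: "0 \<le> p n x y" if "x \<in> CX" "y \<in> CX" for n x y
    using SUP_nonneg[OF _ CX_bdd_above CX_bdd_above, of "Suc n" x y y] that
    by (simp add: p_def seminorm_on_def del: of_nat_Suc)
  have q0: "0 \<le> q n x y" if "x \<in> CX" "y \<in> CX" for n x y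
    unfolding q_def using frac_bound[OF p0[OF that]] by (intro mult_nonneg_nonneg) auto
  have sm: "summable (\<lambda>n. q n x y)" if "x \<in> CX" "y \<in> CX" for x y
  proof (rule summable_comparison_test')
    show "summable (\<lambda>n. (1/2::real) ^ Suc n)"
      by (simp add: summable_geometric summable_mult)
    show "norm (q n x y) \<le> (1/2) ^ Suc n" for n
    proof -
      have "q n x y \<le> (1/2) ^ Suc n * 1"
        unfolding q_def using frac_bound[OF p0[OF that]] by (intro mult_left_mono) auto
      then show ?thesis using q0[OF that, of n] by simp
    qed
  qed
  show ?thesis
  proof
    fix x y :: "'m hist"
    show "0 \<le> co_dist x y" using q0 sm by (simp add: d suminf_nonneg)
    show "co_dist x y = co_dist y x"
      by (simp add: co_dist_def seminorm_on_def infnorm_sub conj_commute)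
  next
    fix x y :: "'m hist" assume *: "x \<in> CX" "y \<in> CX"
    have "co_dist x y = 0 \<longleftrightarrow> (\<forall>n. q n x y = 0)"
      using * q0 sm by (simp add: d suminf_eq_zero_iff)
    also have "\<dots> \<longleftrightarrow> (\<forall>n. p n x y = 0)"
    proof -
      have "q n x y = 0 \<longleftrightarrow> p n x y = 0" for n
        using p0[OF *, of n] by (auto simp: q_def)
      then show ?thesis by simp
    qed
    also have "\<dots> \<longleftrightarrow> (\<forall>n. \<forall>s\<in>{- real (Suc n)..0}. x s = y s)"
      using SUP_zero[OF _ CX_bdd_above CX_bdd_above, of _ x y y] *
      by (simp add: p_def seminorm_on_def del: of_nat_Suc)
    also have "\<dots> \<longleftrightarrow> (\<forall>s\<in>{..0}. x s = y s)"
    proof safe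
      fix s :: real assume all: "\<forall>n. \<forall>s\<in>{- real (Suc n)..0}. x s = y s" and "s \<le> 0"
      obtain n where "- s \<le> real n" using real_arch_simple by blast
      then have "s \<in> {- real (Suc n)..0}" using \<open>s \<le> 0\<close> by simp
      then show "x s = y s" using all by blast
    qed auto
    also have "\<dots> \<longleftrightarrow> x = y"
      using * by (auto simp: CX_def intro: extensionalityI)
    finally show "co_dist x y = 0 \<longleftrightarrow> x = y" .
  next
    fix x y z :: "'m hist" assume *: "x \<in> CX" "y \<in> CX" "z \<in> CX"
    have "q n x z \<le> q n x y + q n y z" for n
    proof -
      have "p n x z \<le> p n x y + p n y z"
        using SUP_triangle[OF _ CX_bdd_above CX_bdd_above, of "Suc n" x y z] *
        by (simp add: p_def seminorm_on_def del: of_nat_Suc)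
      then have "p n x z / (1 + p n x z) \<le> p n x y / (1 + p n x y) + p n y z / (1 + p n y z)"
        using p0 * by (intro frac_triangle) auto
      then show ?thesis
        unfolding q_def distrib_left[symmetric] by (intro mult_left_mono) auto
    qed
    then have "(\<Sum>n. q n x z) \<le> (\<Sum>n. q n x y + q n y z)"
      using sm * by (intro suminf_le summable_add) auto
    then show "co_dist x z \<le> co_dist x y + co_dist y z"
      using sm * by (simp add: d suminf_add)
  qed
qed


section \<open>Minimal flows\<close>

definition continuous_flow :: "(real \<Rightarrow> 'w::metric_space \<Rightarrow> 'w) \<Rightarrow> bool" where
  "continuous_flow \<sigma> \<longleftrightarrow> continuous_on UNIV (\<lambda>(t, \<omega>). \<sigma> t \<omega>)
     \<and> (\<forall>\<omega>. \<sigma> 0 \<omega> = \<omega>) \<and> (\<forall>s t \<omega>. \<sigma> (s + t) \<omega> = \<sigma> t (\<sigma> s \<omega>))"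

definition minimal_flow :: "(real \<Rightarrow> 'w::metric_space \<Rightarrow> 'w) \<Rightarrow> bool" where
  "minimal_flow \<sigma> \<longleftrightarrow> continuous_flow \<sigma>
     \<and> (\<forall>M. closed M \<and> M \<noteq> {} \<and> (\<forall>t. \<sigma> t ` M = M) \<longrightarrow> M = UNIV)"


section \<open>Matrices and the exponential orders\<close>

text \<open>The library product \<open>*\<close> on \<^typ>\<open>real^'m^'m\<close> is componentwise, so the matrix exponential
  is written out with powers for \<^const>\<open>matrix_matrix_mult\<close>.\<close>

definition mexp :: "real^'m^'m \<Rightarrow> real^'m^('m::finite)" where
  "mexp A = (\<Sum>n. (1 / fact n) *\<^sub>R (((**) A ^^ n) (mat 1)))"

definition quasipositive :: "real^'m^('m::finite) \<Rightarrow> bool" where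
  "quasipositive A \<longleftrightarrow> (\<exists>l>0. \<forall>i j. 0 \<le> (A + l *\<^sub>R mat 1) $ i $ j)"

definition eigenvalues_neg :: "real^'m^('m::finite) \<Rightarrow> bool" where
  "eigenvalues_neg A \<longleftrightarrow> (\<forall>\<mu> (v::complex^'m).
     v \<noteq> 0 \<and> (\<chi> i j. complex_of_real (A $ i $ j)) *v v = \<mu> *s v \<longrightarrow> Re \<mu> < 0)"

definition le_fin :: "real^'m^'m \<Rightarrow> real \<Rightarrow> ('m::finite) hist \<Rightarrow> 'm hist \<Rightarrow> bool" where
  "le_fin A r x y \<longleftrightarrow> (\<forall>s\<le>0. x s \<le> y s)
     \<and> (\<forall>s t. - r \<le> s \<and> s \<le> t \<and> t \<le> 0 \<longrightarrow>
          mexp ((t - s) *\<^sub>R A) *v (y s - x s) \<le> y t - x t)"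

definition le_inf :: "real^'m^'m \<Rightarrow> ('m::finite) hist \<Rightarrow> 'm hist \<Rightarrow> bool" where
  "le_inf A x y \<longleftrightarrow> (\<forall>s\<le>0. x s \<le> y s)
     \<and> (\<forall>s t. s \<le> t \<and> t \<le> 0 \<longrightarrow>
          mexp ((t - s) *\<^sub>R A) *v (y s - x s) \<le> y t - x t)"


section \<open>Hypotheses on the operator\<close>

definition cond_D1 :: "(('m::finite) hist \<Rightarrow> real^'m) \<Rightarrow> bool" where
  "cond_D1 D \<longleftrightarrow>
     (\<forall>x\<in>BU. \<forall>y\<in>BU. D (\<lambda>s\<in>{..0}. x s + y s) = D x + D y)
     \<and> (\<forall>a. \<forall>x\<in>BU. D (\<lambda>s\<in>{..0}. a *\<^sub>R x s) = a *\<^sub>R D x)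
     \<and> continuous_map BU_top euclidean D"

definition cond_D2 :: "(('m::finite) hist \<Rightarrow> real^'m) \<Rightarrow> bool" where
  "cond_D2 D \<longleftrightarrow> (\<forall>k>0. continuous_map (subtopology co_top (BB k)) euclidean D)"

text \<open>The representation of \<^term>\<open>D\<close> by measures. In every case considered the \<open>\<nu> i j\<close> are
  either zero or assumed positive, so they are taken as library measures, which are
  nonnegative; finite total variation is \<^const>\<open>finite_measure\<close>, and finite Borel measures on the
  half-line are regular.\<close>

definition cond_D3_D5 ::
    "('m \<Rightarrow> 'm \<Rightarrow> real measure) \<Rightarrow> (('m::finite) hist \<Rightarrow> real^'m) \<Rightarrow> bool" where
  "cond_D3_D5 \<nu> D \<longleftrightarrow>
     (\<forall>i j. sets (\<nu> i j) = sets (restrict_space borel {..0}) \<and> finite_measure (\<nu> i j)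
            \<and> measure (\<nu> i j) {0} = 0)
     \<and> (\<forall>x\<in>BU. D x = x 0 - (\<chi> i. \<Sum>j\<in>UNIV. integral\<^sup>L (\<nu> i j) (\<lambda>s. x s $ j)))"

definition zero_nu :: "('m \<Rightarrow> 'm \<Rightarrow> real measure) \<Rightarrow> bool" where
  "zero_nu \<nu> \<longleftrightarrow> (\<forall>i j. \<forall>E\<in>sets (\<nu> i j). emeasure (\<nu> i j) E = 0)"

definition cond_D4 :: "(('m::finite) hist \<Rightarrow> real^'m) \<Rightarrow> bool" where
  "cond_D4 D \<longleftrightarrow> (\<exists>c :: real \<Rightarrow> real.
     continuous_on {0..} c \<and> (\<forall>t\<ge>0. 0 \<le> c t) \<and> (c \<longlongrightarrow> 0) at_top
     \<and> (\<forall>\<phi>\<in>BU. \<forall>x. D \<phi> = 0 \<and> continuous_on UNIV x \<and> seg x 0 = \<phi> \<and> (\<forall>t\<ge>0. D (seg x t) = 0)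
          \<longrightarrow> (\<forall>t\<ge>0. infnorm (x t) \<le> c t * supnorm \<phi>)))"


section \<open>Hypotheses on the vector field\<close>

definition cond_F1 :: "('w::metric_space \<Rightarrow> ('m::finite) hist \<Rightarrow> real^'m) \<Rightarrow> bool" where
  "cond_F1 F \<longleftrightarrow>
     continuous_map (prod_topology euclidean BU_top) euclidean (\<lambda>(\<omega>, x). F \<omega> x)
     \<and> (\<forall>\<omega>0. \<forall>x0\<in>BU. \<exists>\<rho>>0. \<exists>L. \<forall>\<omega> x y.
          dist \<omega> \<omega>0 < \<rho> \<and> x \<in> BU \<and> y \<in> BU \<and> BU_dist x x0 < \<rho> \<and> BU_dist y x0 < \<rho>
          \<longrightarrow> infnorm (F \<omega> x - F \<omega> y) \<le> L * BU_dist x y)"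

definition cond_F2 :: "('w \<Rightarrow> ('m::finite) hist \<Rightarrow> real^'m) \<Rightarrow> bool" where
  "cond_F2 F \<longleftrightarrow> (\<forall>k>0. bounded ((\<lambda>(\<omega>, x). F \<omega> x) ` (UNIV \<times> BB k)))"

definition cond_F3 :: "('w::metric_space \<Rightarrow> ('m::finite) hist \<Rightarrow> real^'m) \<Rightarrow> bool" where
  "cond_F3 F \<longleftrightarrow> (\<forall>k>0.
     continuous_map (prod_topology euclidean (subtopology co_top (BB k))) euclidean
       (\<lambda>(\<omega>, x). F \<omega> x))"

definition cond_F4 :: "(('m::finite) hist \<Rightarrow> 'm hist \<Rightarrow> bool) \<Rightarrow> real^'m^'m \<Rightarrow>
    ('m hist \<Rightarrow> real^'m) \<Rightarrow> ('w \<Rightarrow> 'm hist \<Rightarrow> real^'m) \<Rightarrow> bool" where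
  "cond_F4 le A D F \<longleftrightarrow> (\<forall>\<omega>. \<forall>x\<in>BU. \<forall>y\<in>BU. le x y \<longrightarrow> A *v (D y - D x) \<le> F \<omega> y - F \<omega> x)"

definition case_I :: "real^'m^'m \<Rightarrow> real \<Rightarrow> ('m \<Rightarrow> 'm \<Rightarrow> real measure) \<Rightarrow>
    (('m::finite) hist \<Rightarrow> real^'m) \<Rightarrow> ('w::metric_space \<Rightarrow> 'm hist \<Rightarrow> real^'m) \<Rightarrow>
    ('m hist \<Rightarrow> 'm hist \<Rightarrow> bool) \<Rightarrow> bool" where
  "case_I A r \<nu> D F le \<longleftrightarrow> le = le_fin A r \<and> cond_D3_D5 \<nu> D \<and> zero_nu \<nu>
     \<and> cond_F1 F \<and> cond_F2 F \<and> cond_F3 F \<and> cond_F4 le A D F"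

definition case_II :: "real^'m^'m \<Rightarrow> ('m \<Rightarrow> 'm \<Rightarrow> real measure) \<Rightarrow>
    (('m::finite) hist \<Rightarrow> real^'m) \<Rightarrow> ('w::metric_space \<Rightarrow> 'm hist \<Rightarrow> real^'m) \<Rightarrow>
    ('m hist \<Rightarrow> 'm hist \<Rightarrow> bool) \<Rightarrow> bool" where
  "case_II A \<nu> D F le \<longleftrightarrow> le = le_inf A \<and> cond_D3_D5 \<nu> D \<and> zero_nu \<nu> \<and> eigenvalues_neg A
     \<and> cond_F1 F \<and> cond_F2 F \<and> cond_F3 F \<and> cond_F4 le A D F"

definition case_III :: "real^'m^'m \<Rightarrow> ('m \<Rightarrow> 'm \<Rightarrow> real measure) \<Rightarrow>
    (('m::finite) hist \<Rightarrow> real^'m) \<Rightarrow> ('w::metric_space \<Rightarrow> 'm hist \<Rightarrow> real^'m) \<Rightarrow>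
    ('m hist \<Rightarrow> 'm hist \<Rightarrow> bool) \<Rightarrow> bool" where
  "case_III A \<nu> D F le \<longleftrightarrow> le = le_inf A
     \<and> cond_D1 D \<and> cond_D2 D \<and> cond_D3_D5 \<nu> D \<and> cond_D4 D \<and> eigenvalues_neg A
     \<and> cond_F1 F \<and> cond_F2 F \<and> cond_F3 F \<and> cond_F4 le A D F"


section \<open>The skew-product semiflow\<close>

text \<open>\<open>is_solution \<dots> T \<omega> x z\<close>: \<open>z\<close> solves the equation on \<open>[0,T]\<close> (one-sided derivatives at the
  end points) with initial history \<open>x\<close>. For \<open>T = 0\<close> only the initial condition remains.\<close>

definition is_solution :: "(('m::finite) hist \<Rightarrow> real^'m) \<Rightarrow> ('w \<Rightarrow> 'm hist \<Rightarrow> real^'m) \<Rightarrow>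
    (real \<Rightarrow> 'w \<Rightarrow> 'w) \<Rightarrow> real \<Rightarrow> 'w \<Rightarrow> 'm hist \<Rightarrow> (real \<Rightarrow> real^'m) \<Rightarrow> bool" where
  "is_solution D F \<sigma> T \<omega> x z \<longleftrightarrow> continuous_on {..T} z \<and> seg z 0 = x
     \<and> (\<forall>t\<in>{0..T}. ((\<lambda>t. D (seg z t)) has_vector_derivative F (\<sigma> t \<omega>) (seg z t))
                     (at t within {0..T}))"

text \<open>\<open>sol_exists \<dots> t \<omega> x\<close> says that \<open>(t,\<omega>,x)\<close> is in the domain of the local semiflow, and
  \<open>sol_u\<close> is its history component, meaningful only on that domain.\<close>

definition sol_exists :: "(('m::finite) hist \<Rightarrow> real^'m) \<Rightarrow> ('w \<Rightarrow> 'm hist \<Rightarrow> real^'m) \<Rightarrow>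
    (real \<Rightarrow> 'w \<Rightarrow> 'w) \<Rightarrow> real \<Rightarrow> 'w \<Rightarrow> 'm hist \<Rightarrow> bool" where
  "sol_exists D F \<sigma> t \<omega> x \<longleftrightarrow> 0 \<le> t \<and> (\<exists>z. is_solution D F \<sigma> t \<omega> x z)"

definition sol_u :: "(('m::finite) hist \<Rightarrow> real^'m) \<Rightarrow> ('w \<Rightarrow> 'm hist \<Rightarrow> real^'m) \<Rightarrow>
    (real \<Rightarrow> 'w \<Rightarrow> 'w) \<Rightarrow> real \<Rightarrow> 'w \<Rightarrow> 'm hist \<Rightarrow> 'm hist" where
  "sol_u D F \<sigma> t \<omega> x = (THE y. \<exists>z. is_solution D F \<sigma> t \<omega> x z \<and> y = seg z t)"

definition forward_orbit :: "(('m::finite) hist \<Rightarrow> real^'m) \<Rightarrow> ('w \<Rightarrow> 'm hist \<Rightarrow> real^'m) \<Rightarrow>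
    (real \<Rightarrow> 'w \<Rightarrow> 'w) \<Rightarrow> 'w \<Rightarrow> 'm hist \<Rightarrow> ('w \<times> 'm hist) set" where
  "forward_orbit D F \<sigma> \<omega> x = {(\<sigma> t \<omega>, sol_u D F \<sigma> t \<omega> x) |t. 0 \<le> t}"

definition pmt :: "('w::metric_space \<times> ('m::finite) hist) topology" where
  "pmt = prod_topology euclidean co_top"

definition relatively_compact :: "('w::metric_space \<times> ('m::finite) hist) set \<Rightarrow> bool" where
  "relatively_compact S \<longleftrightarrow> compactin pmt (pmt closure_of S)"

definition omega_limit :: "(('m::finite) hist \<Rightarrow> real^'m) \<Rightarrow>
    ('w::metric_space \<Rightarrow> 'm hist \<Rightarrow> real^'m) \<Rightarrow>
    (real \<Rightarrow> 'w \<Rightarrow> 'w) \<Rightarrow> 'w \<Rightarrow> 'm hist \<Rightarrow> ('w \<times> 'm hist) set" where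
  "omega_limit D F \<sigma> \<omega>0 x0 = {(\<omega>, x). x \<in> BU \<and> (\<exists>t :: nat \<Rightarrow> real.
     incseq t \<and> filterlim t at_top sequentially \<and> (\<forall>n. sol_exists D F \<sigma> (t n) \<omega>0 x0)
     \<and> (\<lambda>n. \<sigma> (t n) \<omega>0) \<longlonglongrightarrow> \<omega>
     \<and> (\<lambda>n. co_dist (sol_u D F \<sigma> (t n) \<omega>0 x0) x) \<longlonglongrightarrow> 0)}"

definition pos_invariant :: "(('m::finite) hist \<Rightarrow> real^'m) \<Rightarrow> ('w \<Rightarrow> 'm hist \<Rightarrow> real^'m) \<Rightarrow>
    (real \<Rightarrow> 'w \<Rightarrow> 'w) \<Rightarrow> ('w \<times> 'm hist) set \<Rightarrow> bool" where
  "pos_invariant D F \<sigma> K \<longleftrightarrow> K \<subseteq> UNIV \<times> BU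
     \<and> (\<forall>(\<omega>, x)\<in>K. \<forall>t\<ge>0. sol_exists D F \<sigma> t \<omega> x \<and> (\<sigma> t \<omega>, sol_u D F \<sigma> t \<omega> x) \<in> K)"


section \<open>Stability notions\<close>

text \<open>An estimate on \<open>u(t,\<omega>,x)\<close> for all \<open>t \<ge> 0\<close> includes that the solution exists on the whole
  half-line. The sets to which the stability notions apply are required to be positively invariant
  (and compact, in the case of uniform stability).\<close>

definition uniformly_stable :: "(('m::finite) hist \<Rightarrow> real^'m) \<Rightarrow>
    ('w::metric_space \<Rightarrow> 'm hist \<Rightarrow> real^'m) \<Rightarrow>
    (real \<Rightarrow> 'w \<Rightarrow> 'w) \<Rightarrow> ('w \<times> 'm hist) set \<Rightarrow> bool" where
  "uniformly_stable D F \<sigma> K \<longleftrightarrow> compactin pmt K \<and> pos_invariant D F \<sigma> K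
     \<and> (\<forall>\<epsilon>>0. \<exists>\<delta>>0. \<forall>\<omega> x y. (\<omega>, x) \<in> K \<and> (\<omega>, y) \<in> K \<and> co_dist x y < \<delta> \<longrightarrow>
          (\<forall>t\<ge>0. co_dist (sol_u D F \<sigma> t \<omega> x) (sol_u D F \<sigma> t \<omega> y) \<le> \<epsilon>))"

definition orbit_stable_le_in :: "(('m::finite) hist \<Rightarrow> 'm hist \<Rightarrow> bool) \<Rightarrow> ('m hist \<Rightarrow> real^'m) \<Rightarrow>
    ('w::metric_space \<Rightarrow> 'm hist \<Rightarrow> real^'m) \<Rightarrow>
    (real \<Rightarrow> 'w \<Rightarrow> 'w) \<Rightarrow> 'w \<Rightarrow> 'm hist \<Rightarrow> 'm hist set \<Rightarrow> bool" where
  "orbit_stable_le_in le D F \<sigma> \<omega>0 x0 B \<longleftrightarrow>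
     (\<forall>\<epsilon>>0. \<exists>\<delta>>0. \<forall>s\<ge>0. \<forall>x\<in>B.
        co_dist (sol_u D F \<sigma> s \<omega>0 x0) x \<le> \<delta>
        \<and> (le x (sol_u D F \<sigma> s \<omega>0 x0) \<or> le (sol_u D F \<sigma> s \<omega>0 x0) x) \<longrightarrow>
        (\<forall>t\<ge>0. sol_exists D F \<sigma> t (\<sigma> s \<omega>0) x
           \<and> co_dist (sol_u D F \<sigma> (t + s) \<omega>0 x0) (sol_u D F \<sigma> t (\<sigma> s \<omega>0) x) \<le> \<epsilon>))"

definition orbit_stable_le_bounded :: "(('m::finite) hist \<Rightarrow> 'm hist \<Rightarrow> bool) \<Rightarrow>
    ('m hist \<Rightarrow> real^'m) \<Rightarrow> ('w::metric_space \<Rightarrow> 'm hist \<Rightarrow> real^'m) \<Rightarrow>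
    (real \<Rightarrow> 'w \<Rightarrow> 'w) \<Rightarrow> 'w \<Rightarrow> 'm hist \<Rightarrow> bool" where
  "orbit_stable_le_bounded le D F \<sigma> \<omega>0 x0 \<longleftrightarrow>
     (\<forall>k>0. orbit_stable_le_in le D F \<sigma> \<omega>0 x0 (BB k))"

definition set_stable_le_in :: "(('m::finite) hist \<Rightarrow> 'm hist \<Rightarrow> bool) \<Rightarrow> ('m hist \<Rightarrow> real^'m) \<Rightarrow>
    ('w::metric_space \<Rightarrow> 'm hist \<Rightarrow> real^'m) \<Rightarrow>
    (real \<Rightarrow> 'w \<Rightarrow> 'w) \<Rightarrow> ('w \<times> 'm hist) set \<Rightarrow> 'm hist set \<Rightarrow> bool" where
  "set_stable_le_in le D F \<sigma> K B \<longleftrightarrow> pos_invariant D F \<sigma> K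
     \<and> (\<forall>\<epsilon>>0. \<exists>\<delta>>0. \<forall>\<omega> x y. (\<omega>, x) \<in> K \<and> y \<in> B \<and> co_dist x y < \<delta> \<and> (le x y \<or> le y x) \<longrightarrow>
          (\<forall>t\<ge>0. sol_exists D F \<sigma> t \<omega> y
             \<and> co_dist (sol_u D F \<sigma> t \<omega> x) (sol_u D F \<sigma> t \<omega> y) \<le> \<epsilon>))"

definition set_stable_le_bounded :: "(('m::finite) hist \<Rightarrow> 'm hist \<Rightarrow> bool) \<Rightarrow>
    ('m hist \<Rightarrow> real^'m) \<Rightarrow> ('w::metric_space \<Rightarrow> 'm hist \<Rightarrow> real^'m) \<Rightarrow>
    (real \<Rightarrow> 'w \<Rightarrow> 'w) \<Rightarrow> ('w \<times> 'm hist) set \<Rightarrow> bool" where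
  "set_stable_le_bounded le D F \<sigma> K \<longleftrightarrow> (\<forall>k>0. set_stable_le_in le D F \<sigma> K (BB k))"

end

theory Submission
  imports Defs "HOL-Complex_Analysis.Great_Picard"
begin

text \<open>
  The operator \<open>D\<close> is inverted by a contraction: there are weights \<open>w > 0\<close> and \<open>q < 1\<close> such that the
  matrix of total masses of \<open>\<nu>\<close> maps \<open>w\<close> below \<open>q w\<close>. Otherwise some \<open>exp (l t) v\<close> with \<open>l \<ge> 0\<close>,
  \<open>v \<ge> 0\<close>, \<open>v \<noteq> 0\<close> would solve \<open>D x\<^sub>t = 0\<close>, against (D4). In the norm weighted by \<open>w\<close> one has
  \<open>|x 0| \<le> |D x| + q sup |x|\<close>, which gives uniqueness, equicontinuity of families of solutions (hence
  limits of solutions by Arzela--Ascoli), and a common Lipschitz constant on the omega-limit set \<open>K\<close>.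

  For (i), a perturbation \<open>y\<close> of \<open>x\<close> in \<open>K\<close>, comparable with \<open>x\<close>, is the limit of the perturbations
  \<open>u(t\<^sub>n) + (y - x)\<close> of the orbit, with the same order relation and the same distance; the stability
  estimate for the orbit passes to the limit.

  For (ii), nearby points \<open>x\<close>, \<open>y\<close> of \<open>K\<close> differ on compact intervals by a function with small Lipschitz
  constant, since \<open>D x\<^sub>t\<close> has derivative \<open>F (\<omega> t, x\<^sub>t)\<close> for all \<open>t \<le> 0\<close>. Hence \<open>a = (x + y) / 2 + \<zeta>\<close>,
  with a suitable small \<open>\<zeta>\<close>, is an upper bound of both for the exponential order, and (i) is applied
  to the pairs \<open>x, a\<close> and \<open>y, a\<close>.
\<close>

section \<open>Quasipositive matrices\<close>

text \<open>The equation controls the derivative of \<open>D x\<^sub>t\<close>, not of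
  \<open>x\<close>, and inverting \<open>D\<close> in the plain maximum norm can fail: a stable
  operator may have row sums of masses above 1. Stability bounds only the spectral radius of the
  mass matrix, and the weights adapt the norm to it. Positivity of the measures makes this a Perron
  type argument: the roots to be excluded are real with nonnegative vectors, so they are met when
  \<open>l\<close> is lowered continuously from a large value, where the Laplace transform of the
  measures is small because they have no mass at 0. The same dichotomy for the matrices A - l I
  turns the eigenvalue condition into a positive vector that \<open>A\<close> maps to a negative
  one.

  A second obstacle is that \<open>D\<close>, and the order with infinite memory, see the whole
  past, while the distance sees little of it. Points of \<open>K\<close> solve the equation on their
  entire past, which gives a global Lipschitz bound for differences; smallness on compact intervals
  follows by iteration, discarding tails of the measures. In the order, the far past is absorbed by
  a weight that is large there and decays towards the present more slowly than the system given by
  \<open>A\<close>.\<close>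

definition offdiag_nonneg :: "real^'m^'m::finite \<Rightarrow> bool" where
  "offdiag_nonneg B \<longleftrightarrow> (\<forall>i j. i \<noteq> j \<longrightarrow> 0 \<le> B $ i $ j)"

text \<open>The shift \<open>l\<close> touches only the diagonal. The condition that remains is
  stable under subtracting multiples of the identity, which the family
  \<open>A - l *\<^sub>R mat 1\<close> requires.\<close>

lemma quasipositive_offdiag:
  fixes A :: "real^'m^'m::finite"
  assumes "quasipositive A"
  shows "offdiag_nonneg A"
  using assms
  unfolding quasipositive_def offdiag_nonneg_def
proof (elim exE conjE, intro allI impI)
  fix l :: real and i j :: 'm assume "\<forall>i j. 0 \<le> (A + l *\<^sub>R mat 1) $ i $ j" "i \<noteq> j"
  then have "0 \<le> (A + l *\<^sub>R mat 1) $ i $ j" by blast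
  with \<open>i \<noteq> j\<close> show "0 \<le> A $ i $ j" by (simp add: mat_def)
qed

lemma matrix_vector_nth: "(B *v x) $ i = (\<Sum>j\<in>UNIV. B $ i $ j * x $ j)"
  by (simp add: matrix_vector_mult_def)

text \<open>Kamke's condition for linear systems: the diagonal entry has no sign, so monotonicity is
  available only in a coordinate where the two vectors touch.\<close>

lemma offdiag_mult_mono:
  fixes B :: "real^'m^'m::finite"
  assumes "offdiag_nonneg B" "x \<le> y" "x $ i = y $ i"
  shows "(B *v x) $ i \<le> (B *v y) $ i"
  unfolding matrix_vector_nth
proof (rule sum_mono)
  fix j
  show "B $ i $ j * x $ j \<le> B $ i $ j * y $ j"
    using assms by (cases "j = i") (auto simp: offdiag_nonneg_def less_eq_vec_def intro!: mult_left_mono)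
qed

text \<open>Minimum principle for M-matrices. If \<open>u / e\<close> had a negative minimum
  \<open>c\<close>, attained at \<open>i\<close>, then \<open>c *s e\<close> would touch
  \<open>u\<close> from below there, and \<open>offdiag_mult_mono\<close> would give
  \<open>(B *v u) $ i \<ge> c * (B *v e) $ i > 0\<close>.\<close>

lemma nonneg_of_mult_nonpos:
  fixes B :: "real^'m^'m::finite"
  assumes B: "offdiag_nonneg B" and e: "\<And>i. 0 < e $ i" and Be: "\<And>i. (B *v e) $ i < 0"
    and u: "\<And>i. (B *v u) $ i \<le> 0"
  shows "0 \<le> u"
proof (rule ccontr)
  assume "\<not> 0 \<le> u"
  then obtain i0 where i0: "u $ i0 < 0" by (auto simp: less_eq_vec_def not_le)
  obtain i where i: "\<And>j. u $ i / e $ i \<le> u $ j / e $ j"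
    using ex_min_if_finite[of "range (\<lambda>j. u $ j / e $ j)"] by (auto simp: not_less)
  define c where "c = u $ i / e $ i"
  have c: "c < 0"
    using i[of i0] i0 e[of i0] unfolding c_def by (smt (verit) divide_less_0_iff)
  have "(B *v (c *s e)) $ i \<le> (B *v u) $ i"
  proof (rule offdiag_mult_mono[OF B])
    show "c *s e \<le> u"
      unfolding less_eq_vec_def
    proof
      fix j show "(c *s e) $ j \<le> u $ j"
        using i[of j] e[of j] by (simp add: c_def pos_le_divide_eq)
    qed
    show "(c *s e) $ i = u $ i" using e[of i] by (simp add: c_def)
  qed
  moreover have "(B *v (c *s e)) $ i = c * (B *v e) $ i"
    by (simp add: vector_scalar_commute)
  ultimately show False using u[of i] mult_neg_neg[OF c Be[of i]] by linarith
qed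

text \<open>The minimum principle for \<open>x - y\<close> and \<open>y - x\<close> gives
  injectivity, hence surjectivity in finite dimension; applied once more, it gives the sign of the
  preimage of \<open>- 1\<close>.\<close>

lemma ex_mult_eq_minus_one:
  fixes B :: "real^'m^'m::finite"
  assumes B: "offdiag_nonneg B" and e: "\<And>i. 0 < e $ i" and Be: "\<And>i. (B *v e) $ i < 0"
  obtains u where "B *v u = - 1" "0 \<le> u"
proof -
  have "inj ((*v) B)"
  proof (rule injI)
    fix x y assume eq: "B *v x = B *v y"
    then have "B *v (x - y) = 0" "B *v (y - x) = 0" by (auto simp: matrix_vector_mult_diff_distrib)
    then have "0 \<le> x - y \<and> 0 \<le> y - x"
      by (intro conjI; intro nonneg_of_mult_nonpos[OF B e Be]; simp)
    then show "x = y" by (auto simp: less_eq_vec_def vec_eq_iff intro: antisym)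
  qed
  then have "surj ((*v) B)"
    by (intro linear_injective_imp_surjective) auto
  then obtain u where u: "B *v u = - 1" by (metis surjD)
  then have "0 \<le> u" by (intro nonneg_of_mult_nonpos[OF B e Be]) auto
  then show thesis using u that by blast
qed

text \<open>The infimum \<open>l0\<close> of the parameters admitting a strict subsolution either is 0 and attained,
  or yields a kernel vector: solutions of \<open>B l u = - 1\<close> must blow up as \<open>l\<close> decreases to \<open>l0\<close>, and
  after normalization they converge to one.\<close>

lemma strict_subsolution_or_kernel:
  fixes B :: "real \<Rightarrow> real^'m^'m::finite"
  assumes cont: "continuous_on {0..} B" and off: "\<And>l. 0 \<le> l \<Longrightarrow> offdiag_nonneg (B l)"
    and l1: "0 \<le> l1" "\<And>i. 0 < e1 $ i" "\<And>i. (B l1 *v e1) $ i < 0"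
  shows "(\<exists>e. (\<forall>i. 0 < e $ i) \<and> (\<forall>i. (B 0 *v e) $ i < 0))
    \<or> (\<exists>l\<ge>0. \<exists>v. 0 \<le> v \<and> v \<noteq> 0 \<and> B l *v v = 0)"
proof -
  define good where "good l \<longleftrightarrow> 0 \<le> l \<and> (\<exists>e. (\<forall>i. 0 < e $ i) \<and> (\<forall>i. (B l *v e) $ i < 0))" for l
  define L where "L = Collect good"
  have good1: "l1 \<in> L" using l1 by (auto simp: L_def good_def)
  have bdd: "bdd_below L" by (intro bdd_belowI[of _ 0]) (auto simp: L_def good_def)
  define l0 where "l0 = Inf L"
  have l0: "0 \<le> l0" unfolding l0_def using good1
    by (intro cInf_greatest) (auto simp: L_def good_def)
  have tendB: "((\<lambda>l. (B l *v v) $ i) \<longlongrightarrow> (B l' *v v) $ i) (at l' within {0..})" if "0 \<le> l'" for l' v i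
    using cont that unfolding continuous_on_def matrix_vector_nth
    by (auto intro!: tendsto_intros)
  \<comment> \<open>Finitely many strict inequalities survive a small decrease of the parameter, so
    the infimum can be attained only at the end point 0.\<close>
  have open_good: "good l0 \<Longrightarrow> l0 = 0"
  proof (rule ccontr)
    assume g: "good l0" and "l0 \<noteq> 0"
    then have "0 < l0" using l0 by simp
    obtain e where e: "\<And>i. 0 < e $ i" "\<And>i. (B l0 *v e) $ i < 0" using g by (auto simp: good_def)
    have "\<forall>\<^sub>F l in at l0 within {0..}. \<forall>i. (B l *v e) $ i < 0"
      using order_tendstoD(2)[OF tendB[OF l0] e(2)] by (simp add: eventually_all_finite)
    then obtain d where d: "0 < d" "\<And>l. l \<in> {0..} \<Longrightarrow> l \<noteq> l0 \<Longrightarrow> dist l l0 < d \<Longrightarrow> \<forall>i. (B l *v e) $ i < 0"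
      by (auto simp: eventually_at)
    define l where "l = max 0 (l0 - d / 2)"
    have "l < l0" "0 \<le> l" "dist l l0 < d" using d \<open>0 < l0\<close> by (auto simp: l_def dist_real_def)
    then have "l \<in> L" using d(2)[of l] e(1) by (auto simp: L_def good_def)
    then have "l0 \<le> l" unfolding l0_def by (intro cInf_lower bdd)
    with \<open>l < l0\<close> show False by simp
  qed
  have "\<exists>l\<in>L. l < l0 + 1 / Suc n" for n
    using cInf_lessD[of L "l0 + 1 / Suc n"] good1 by (auto simp: l0_def)
  then obtain l where l: "\<And>n. l n \<in> L" "\<And>n. l n < l0 + 1 / Suc n" by metis
  have ll0: "l0 \<le> l n" for n unfolding l0_def by (intro cInf_lower bdd l)
  have llim: "l \<longlonglongrightarrow> l0"
  proof (rule tendsto_sandwich[of "\<lambda>_. l0" l _ "\<lambda>n. l0 + 1 / Suc n"])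
    show "(\<lambda>n. l0 + 1 / Suc n) \<longlonglongrightarrow> l0"
      using tendsto_add[OF tendsto_const LIMSEQ_inverse_real_of_nat, of l0] by (simp add: inverse_eq_divide)
    show "\<forall>\<^sub>F n in sequentially. l n \<le> l0 + 1 / Suc n"
      using l(2) by (intro always_eventually allI less_imp_le)
  qed (use ll0 in \<open>auto intro: always_eventually\<close>)
  have l_nn: "0 \<le> l n" for n using l0 ll0[of n] by linarith
  have "\<exists>u. B (l n) *v u = - 1 \<and> 0 \<le> u" for n
  proof -
    obtain e where "\<forall>i. 0 < e $ i" "\<forall>i. (B (l n) *v e) $ i < 0"
      using l(1)[of n] by (auto simp: L_def good_def)
    then show ?thesis using ex_mult_eq_minus_one[OF off[OF l_nn], of e] by metis
  qed
  then obtain u where u: "\<And>n. B (l n) *v u n = - 1" "\<And>n. 0 \<le> u n" by metis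
  have Blim: "(\<lambda>n. B (l (r n)) *v x n) \<longlonglongrightarrow> B l0 *v y"
    if "x \<longlonglongrightarrow> y" "filterlim r at_top sequentially" for r :: "nat \<Rightarrow> nat" and x :: "nat \<Rightarrow> real^'m" and y
  proof -
    have *: "(\<lambda>n. B (l (r n))) \<longlonglongrightarrow> B l0"
    proof (rule continuous_on_tendsto_compose[OF cont])
      show "(\<lambda>n. l (r n)) \<longlonglongrightarrow> l0"
        using filterlim_compose[OF llim that(2)] .
    qed (use l0 l_nn in auto)
    then have "(\<lambda>n. (B (l (r n)) *v x n) $ i) \<longlonglongrightarrow> (B l0 *v y) $ i" for i
      unfolding matrix_vector_nth using that(1) by (intro tendsto_intros)
    then show ?thesis by (rule vec_tendstoI)
  qed
  show ?thesis
  proof (cases "bounded (range u)")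
    case True
    then have "compact (closure (range u))" by simp
    then obtain y r where r: "strict_mono (r :: nat \<Rightarrow> nat)" "(u \<circ> r) \<longlonglongrightarrow> y"
      using closure_subset[of "range u"] unfolding compact_def by (metis range_subsetD)
    have "(\<lambda>n. B (l (r n)) *v (u \<circ> r) n) \<longlonglongrightarrow> B l0 *v y" by (rule Blim[OF r(2) filterlim_subseq[OF r(1)]])
    moreover have "(\<lambda>n. B (l (r n)) *v (u \<circ> r) n) \<longlonglongrightarrow> - 1" by (simp add: u)
    ultimately have By: "B l0 *v y = - 1" using LIMSEQ_unique by blast
    have y: "0 \<le> y $ i" for i
    proof (rule LIMSEQ_le_const)
      show "(\<lambda>n. u (r n) $ i) \<longlonglongrightarrow> y $ i" using tendsto_vec_nth[OF r(2)] by (simp add: o_def)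
      show "\<exists>N. \<forall>n\<ge>N. 0 \<le> u (r n) $ i" using u(2) by (auto simp: less_eq_vec_def)
    qed
    define c where "c = (\<Sum>i\<in>UNIV. \<Sum>j\<in>UNIV. \<bar>B l0 $ i $ j\<bar>)"
    have c: "(B l0 *v 1) $ i \<le> c" for i
    proof -
      have "(B l0 *v 1) $ i \<le> (\<Sum>j\<in>UNIV. \<bar>B l0 $ i $ j\<bar>)"
        unfolding matrix_vector_nth by (intro sum_mono) auto
      also have "\<dots> \<le> c" unfolding c_def
        by (rule member_le_sum[of i UNIV "\<lambda>i. \<Sum>j\<in>UNIV. \<bar>B l0 $ i $ j\<bar>"]) (auto simp: sum_nonneg)
      finally show ?thesis .
    qed
    have c0: "0 \<le> c" by (simp add: c_def sum_nonneg)
    \<comment> \<open>The limit \<open>y\<close> is only nonnegative. Adding a small constant makes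
      it positive, and the increment \<open>(B l0 *v 1) $ i / (c + 1)\<close> stays below 1, which
      keeps the image negative.\<close>
    define e where "e = y + (1 / (c + 1)) *s 1"
    have "(B l0 *v e) $ i < 0" for i
    proof -
      have "(B l0 *v e) $ i = - 1 + (B l0 *v 1) $ i / (c + 1)"
        by (simp add: e_def matrix_vector_right_distrib vector_scalar_commute By)
      also have "\<dots> < 0" using c[of i] c0 by (simp add: field_simps)
      finally show ?thesis .
    qed
    moreover have "0 < e $ i" for i using y[of i] c0 by (simp add: e_def add_nonneg_pos)
    ultimately have ex: "\<exists>e. (\<forall>i. 0 < e $ i) \<and> (\<forall>i. (B l0 *v e) $ i < 0)" by blast
    then have "good l0" using l0 by (simp add: good_def)
    then show ?thesis using ex open_good by simp
  next
    case False
    \<comment> \<open>The indices need not increase with \<open>k\<close>;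
      \<open>k \<le> n k\<close> is enough for \<open>l (n k)\<close> to tend to
      \<open>l0\<close>.\<close>
    have "\<exists>n\<ge>k. real k < norm (u n)" for k
    proof (rule ccontr)
      assume "\<not> (\<exists>n\<ge>k. real k < norm (u n))"
      then have "range u \<subseteq> u ` {..<k} \<union> cball 0 (real k)" by (force simp: not_le not_less)
      moreover have "bounded (u ` {..<k} \<union> cball 0 (real k))" by (simp add: finite_imp_bounded)
      ultimately show False using False bounded_subset by blast
    qed
    then obtain n where n: "\<And>k. k \<le> n k" "\<And>k. real k < norm (u (n k))" by metis
    have nlim: "filterlim n at_top sequentially"
      by (rule filterlim_at_top_mono[OF filterlim_ident]) (use n(1) in auto)
    define x where "x k = (1 / norm (u (n k))) *s u (n k)" for k
    have pos: "0 < norm (u (n k))" for k using n(2)[of k] by (smt (verit) of_nat_0_le_iff)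
    have nx: "norm (x k) = 1" for k using pos[of k] by (simp add: x_def scalar_mult_eq_scaleR)
    obtain v s where s: "v \<in> sphere 0 1" "strict_mono (s :: nat \<Rightarrow> nat)" "(x \<circ> s) \<longlonglongrightarrow> v"
      using compact_sphere[of "0::real^'m" 1] nx unfolding compact_def by (metis dist_0_norm mem_sphere)
    have 1: "(\<lambda>k. B (l ((n \<circ> s) k)) *v (x \<circ> s) k) \<longlonglongrightarrow> B l0 *v v"
      by (rule Blim[OF s(3)]) (simp add: o_def filterlim_compose[OF nlim filterlim_subseq[OF s(2)]])
    have "filterlim (\<lambda>k. norm (u (n (s k)))) at_top sequentially"
    proof (rule filterlim_at_top_mono)
      show "filterlim (\<lambda>k. real (s k)) at_top sequentially"
        by (rule filterlim_compose[OF filterlim_real_sequentially filterlim_subseq[OF s(2)]])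
    qed (use n(2) less_imp_le in \<open>blast intro: always_eventually\<close>)
    then have "(\<lambda>k. inverse (norm (u (n (s k)))) *\<^sub>R (- 1 :: real^'m)) \<longlonglongrightarrow> 0 *\<^sub>R (- 1)"
      by (intro tendsto_intros tendsto_inverse_0_at_top)
    then have 2: "(\<lambda>k. B (l ((n \<circ> s) k)) *v (x \<circ> s) k) \<longlonglongrightarrow> 0"
      by (simp add: x_def vector_scalar_commute u inverse_eq_divide scalar_mult_eq_scaleR[symmetric])
    have "B l0 *v v = 0" using LIMSEQ_unique[OF 1 2] .
    moreover have "v \<noteq> 0" using s(1) by auto
    moreover have "0 \<le> v"
      unfolding less_eq_vec_def
    proof
      fix i
      have "0 \<le> x (s k) $ i" for k using u(2) by (simp add: x_def less_eq_vec_def)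
      then show "0 $ i \<le> v $ i"
        using tendsto_vec_nth[OF s(3), of i] by (auto intro!: LIMSEQ_le_const simp: o_def)
    qed
    ultimately show ?thesis using l0 by blast
  qed
qed

section \<open>The matrix exponential\<close>

lemma matrix_power_entry_bound:
  fixes A :: "real^'m^'m::finite" and a :: real
  assumes "\<And>i j. \<bar>A $ i $ j\<bar> \<le> a"
  shows "\<bar>(((**) A ^^ n) (mat 1)) $ i $ j\<bar> \<le> (CARD('m) * a) ^ n"
proof (induction n arbitrary: i)
  case 0 show ?case by (simp add: mat_def)
next
  case (Suc n)
  have a: "0 \<le> a" using assms[of i i] by linarith
  have "\<bar>(((**) A ^^ Suc n) (mat 1)) $ i $ j\<bar>
      \<le> (\<Sum>k\<in>UNIV. \<bar>A $ i $ k * (((**) A ^^ n) (mat 1)) $ k $ j\<bar>)"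
    by (simp add: matrix_matrix_mult_def)
  also have "\<dots> \<le> (\<Sum>k\<in>(UNIV::'m set). a * (CARD('m) * a) ^ n)"
    using a by (intro sum_mono) (auto simp: abs_mult intro!: mult_mono assms Suc)
  finally show ?case by (simp add: mult.assoc)
qed

lemma matrix_power_scaleR: "((**) (t *\<^sub>R A) ^^ n) (mat 1) = t ^ n *\<^sub>R ((**) A ^^ n) (mat 1)"
  for A :: "real^'m^'m::finite"
proof (induction n)
  case (Suc n)
  have "((**) (t *\<^sub>R A) ^^ Suc n) (mat 1) = (t *\<^sub>R A) ** (t ^ n *\<^sub>R ((**) A ^^ n) (mat 1))"
    by (simp add: Suc)
  also have "\<dots> = t ^ Suc n *\<^sub>R (A ** ((**) A ^^ n) (mat 1))"
    by (simp add: matrix_scalar_ac scalar_matrix_assoc[symmetric])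
  finally show ?case by simp
qed simp

lemma summable_vec_nth:
  fixes f :: "nat \<Rightarrow> 'a::real_normed_vector^'m::finite"
  assumes "\<And>i. summable (\<lambda>n. f n $ i)"
  shows "summable f"
proof -
  have "f sums (\<chi> i. \<Sum>n. f n $ i)"
    unfolding sums_def by (rule vec_tendstoI) (use assms[THEN summable_LIMSEQ] in simp)
  then show ?thesis by (rule sums_summable)
qed

lemma summable_mexp_entry:
  fixes A :: "real^'m^'m::finite"
  shows "summable (\<lambda>n. ((((**) A ^^ n) (mat 1)) $ i $ j / fact n) * t ^ n)"
proof -
  define a where "a = (\<Sum>i\<in>UNIV. \<Sum>j\<in>UNIV. \<bar>A $ i $ j\<bar>)"
  have a: "\<bar>A $ i $ j\<bar> \<le> a" for i j
  proof -
    have "\<bar>A $ i $ j\<bar> \<le> (\<Sum>j\<in>UNIV. \<bar>A $ i $ j\<bar>)" by (rule member_le_sum) auto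
    also have "\<dots> \<le> a" unfolding a_def
      by (rule member_le_sum[of i UNIV "\<lambda>i. \<Sum>j\<in>UNIV. \<bar>A $ i $ j\<bar>"]) (auto simp: sum_nonneg)
    finally show ?thesis .
  qed
  show ?thesis
  proof (rule summable_comparison_test')
    show "summable (\<lambda>n. inverse (fact n) * (CARD('m) * a * \<bar>t\<bar>) ^ n)" by (rule summable_exp)
    show "norm ((((**) A ^^ n) (mat 1)) $ i $ j / fact n * t ^ n)
        \<le> inverse (fact n) * (CARD('m) * a * \<bar>t\<bar>) ^ n" for n
      using mult_right_mono[OF matrix_power_entry_bound[OF a, of n i j], of "\<bar>t\<bar> ^ n / fact n"]
      by (simp add: abs_mult power_abs power_mult_distrib field_simps)
  qed
qed

text \<open>Each entry is a scalar power series in \<open>t\<close>, so term-by-term differentiation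
  of real power series becomes applicable.\<close>

lemma mexp_entry:
  fixes A :: "real^'m^'m::finite"
  shows "mexp (t *\<^sub>R A) $ i $ j = (\<Sum>n. (((**) A ^^ n) (mat 1)) $ i $ j / fact n * t ^ n)"
proof -
  define f where "f n = (1 / fact n) *\<^sub>R (((**) (t *\<^sub>R A) ^^ n) (mat 1))" for n
  have f: "f n $ i $ j = (((**) A ^^ n) (mat 1)) $ i $ j / fact n * t ^ n" for n i j
    by (simp add: f_def matrix_power_scaleR)
  have "summable f"
    by (intro summable_vec_nth) (simp only: f, rule summable_mexp_entry)
  then have "f sums mexp (t *\<^sub>R A)" unfolding mexp_def f_def by (rule summable_sums)
  then have "(\<lambda>n. f n $ i $ j) sums (mexp (t *\<^sub>R A) $ i $ j)"
    unfolding sums_def using tendsto_vec_nth[OF tendsto_vec_nth, of "\<lambda>n. sum f {..<n}" _ _ i j] by simp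
  then show ?thesis by (simp add: f sums_unique)
qed

lemma mexp_zero: "mexp (0 *\<^sub>R A) = mat 1"
  for A :: "real^'m^'m::finite"
proof -
  have "(\<lambda>n. (((**) A ^^ n) (mat 1)) $ i $ j / fact n * 0 ^ n) sums ((mat 1 :: real^'m^'m) $ i $ j)" for i j
    using powser_sums_zero[of "\<lambda>n. (((**) A ^^ n) (mat 1)) $ i $ j / fact n"] by simp
  then have "mexp (0 *\<^sub>R A) $ i $ j = (mat 1 :: real^'m^'m) $ i $ j" for i j
    by (subst mexp_entry) (rule sums_unique[symmetric])
  then show ?thesis by (subst vec_eq_iff, subst vec_eq_iff) blast
qed

text \<open>\<open>diffs\<close> turns the coefficients A^n / n! into A (A^n / n!), whose entry is a
  finite sum along row \<open>i\<close>; this sum commutes with the series.\<close>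

lemma has_real_derivative_mexp_entry:
  fixes A :: "real^'m^'m::finite"
  shows "((\<lambda>t. mexp (t *\<^sub>R A) $ i $ j) has_real_derivative (A ** mexp (t *\<^sub>R A)) $ i $ j) (at t)"
proof -
  let ?c = "\<lambda>i n. (((**) A ^^ n) (mat 1)) $ i $ j / fact n"
  have d: "diffs (?c i) n * t ^ n = (\<Sum>k\<in>UNIV. A $ i $ k * (?c k n * t ^ n))" for n
  proof -
    have "diffs (?c i) n = (((**) A ^^ Suc n) (mat 1)) $ i $ j / fact n"
      unfolding diffs_def fact_Suc times_divide_eq_right
      by (rule nonzero_mult_divide_mult_cancel_left) simp
    also have "\<dots> = (\<Sum>k\<in>UNIV. A $ i $ k * ?c k n)"
      by (simp add: matrix_matrix_mult_def sum_divide_distrib)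
    finally show ?thesis unfolding mult.assoc[symmetric] sum_distrib_right[symmetric] by (rule arg_cong)
  qed
  have "(\<Sum>n. diffs (?c i) n * t ^ n) = (\<Sum>k\<in>UNIV. \<Sum>n. A $ i $ k * (?c k n * t ^ n))"
    unfolding d by (rule suminf_sum) (intro summable_mult summable_mexp_entry)
  also have "\<dots> = (\<Sum>k\<in>UNIV. A $ i $ k * (\<Sum>n. ?c k n * t ^ n))"
    by (intro sum.cong refl suminf_mult summable_mexp_entry)
  also have "\<dots> = (A ** mexp (t *\<^sub>R A)) $ i $ j"
    unfolding mexp_entry[symmetric] by (simp add: matrix_matrix_mult_def)
  finally show ?thesis
    using termdiffs_strong_converges_everywhere[OF summable_mexp_entry, of A i j t]
    unfolding mexp_entry by (rule subst)
qed

lemma has_real_derivative_mexp_mult: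
  fixes A :: "real^'m^'m::finite"
  shows "((\<lambda>t. (mexp ((t - s) *\<^sub>R A) *v v) $ i) has_real_derivative
    (A *v (mexp ((t - s) *\<^sub>R A) *v v)) $ i) (at t)"
proof -
  have "((\<lambda>t. mexp ((t - s) *\<^sub>R A) $ i $ j) has_real_derivative (A ** mexp ((t - s) *\<^sub>R A)) $ i $ j) (at t)" for j
    using DERIV_shift[of "\<lambda>t. mexp (t *\<^sub>R A) $ i $ j" _ t "-s"] has_real_derivative_mexp_entry[of A i j "t - s"]
    by simp
  then show ?thesis
    unfolding matrix_vector_mul_assoc matrix_vector_nth
    by (intro DERIV_sum DERIV_cmult_right)
qed

text \<open>Real induction: the supremum \<open>u\<close> of the times up to which \<open>d\<close>
  is nonnegative is again such a time, by closedness. Just after \<open>u\<close>, positive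
  coordinates stay positive by continuity and vanishing ones are handled by \<open>step\<close>, so
  \<open>u\<close> is not below \<open>t\<close>.\<close>

lemma continuous_nonneg_induct:
  fixes d :: "real \<Rightarrow> real^'m::finite"
  assumes "s \<le> t" "0 \<le> d s" "continuous_on {s..t} d"
    and step: "\<And>x i. s \<le> x \<Longrightarrow> x < t \<Longrightarrow> 0 \<le> d x \<Longrightarrow> d x $ i = 0 \<Longrightarrow> \<forall>\<^sub>F h in at_right 0. 0 \<le> d (x + h) $ i"
  shows "0 \<le> d t"
proof -
  define E where "E = {x\<in>{s..t}. \<forall>y\<in>{s..x}. 0 \<le> d y}"
  have s: "s \<in> E" using assms by (auto simp: E_def)
  have bdd: "bdd_above E" by (rule bdd_aboveI[of _ t]) (auto simp: E_def)
  define u where "u = Sup E"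
  have u: "s \<le> u" "u \<le> t"
    unfolding u_def by (intro cSup_upper s bdd, intro cSup_least) (use s in \<open>auto simp: E_def\<close>)
  have before: "0 \<le> d y" if y: "s \<le> y" "y < u" for y
  proof -
    have "E \<noteq> {}" using s by blast
    from less_cSup_iff[OF this bdd, of y] obtain x where "x \<in> E" "y < x"
      using y(2) u_def by blast
    then show ?thesis using that by (auto simp: E_def)
  qed
  have du: "0 \<le> d u"
  proof (cases "u = s")
    case False
    then have su: "s < u" using u by simp
    have "0 \<le> d u $ i" for i
    proof -
      have "closed ({s..t} \<inter> (\<lambda>x. d x $ i) -` {0..})"
        by (intro continuous_closed_preimage continuous_intros assms)
      moreover have "{s..<u} \<subseteq> {s..t} \<inter> (\<lambda>x. d x $ i) -` {0..}"
        using before u by (force simp: less_eq_vec_def)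
      ultimately have "closure {s..<u} \<subseteq> {s..t} \<inter> (\<lambda>x. d x $ i) -` {0..}" by (rule closure_minimal[rotated])
      moreover have "u \<in> closure {s..<u}" using su by simp
      ultimately have "u \<in> {s..t} \<inter> (\<lambda>x. d x $ i) -` {0..}" by blast
      then show ?thesis by simp
    qed
    then show ?thesis by (simp add: less_eq_vec_def)
  qed (use assms in simp)
  show ?thesis
  proof (cases "u = t")
    case False
    then have ut: "u < t" using u by simp
    have "\<forall>\<^sub>F h in at_right 0. 0 \<le> d (u + h) $ i" for i
    proof (cases "d u $ i = 0")
      case False
      then have pos: "0 < d u $ i" using du by (simp add: less_eq_vec_def less_le)
      have "continuous_on {u..t} d" by (rule continuous_on_subset[OF assms(3)]) (use u in auto)
      then have "(d \<longlongrightarrow> d u) (at_right u)"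
        using ut by (auto simp: continuous_on_def at_within_Icc_at_right[symmetric])
      then have "((\<lambda>h. d (u + h)) \<longlongrightarrow> d u) (at_right 0)"
        by (subst (asm) filterlim_at_right_to_0) (simp add: add.commute)
      from order_tendstoD(1)[OF tendsto_vec_nth[OF this] pos]
      show ?thesis by eventually_elim simp
    qed (use step u ut du in simp)
    then have "\<forall>\<^sub>F h in at_right 0. 0 \<le> d (u + h)"
      by (simp add: less_eq_vec_def eventually_all_finite)
    then obtain b where b: "0 < b" "\<And>h. 0 < h \<Longrightarrow> h < b \<Longrightarrow> 0 \<le> d (u + h)"
      by (auto simp: eventually_at_right_field)
    define x where "x = min t (u + b / 2)"
    have "0 \<le> d y" if "s \<le> y" "y \<le> x" for y
      using before[of y] du b(2)[of "y - u"] that b(1) by (cases "y < u"; cases "y = u") (auto simp: x_def)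
    then have "x \<in> E" using u b ut by (auto simp: E_def x_def)
    then have "x \<le> u" unfolding u_def by (rule cSup_upper) (rule bdd)
    then show ?thesis using ut b by (auto simp: x_def)
  qed (use du in simp)
qed

text \<open>The function \<open>d x = q x - mexp ((x - s) *\<^sub>R A) *v q s\<close> cannot leave the nonnegative cone
  through a face \<open>d x $ i = 0\<close>, as its slope there exceeds \<open>(A *v d x) $ i \<ge> 0\<close>.\<close>

lemma mexp_mult_le_of_slope:
  fixes A :: "real^'m^'m::finite"
  assumes A: "offdiag_nonneg A" and st: "s \<le> t" and cont: "continuous_on {s..t} q"
    and slope: "\<And>x i. s \<le> x \<Longrightarrow> x < t \<Longrightarrow>
      \<exists>m > (A *v q x) $ i. \<forall>\<^sub>F h in at_right 0. q x $ i + h * m \<le> q (x + h) $ i"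
  shows "mexp ((t - s) *\<^sub>R A) *v q s \<le> q t"
proof -
  define y where "y x = mexp ((x - s) *\<^sub>R A) *v q s" for x
  have y: "((\<lambda>x. y x $ i) has_real_derivative (A *v y x) $ i) (at x)" for x i
    unfolding y_def by (rule has_real_derivative_mexp_mult)
  have "0 \<le> q t - y t"
  proof (rule continuous_nonneg_induct[OF st, of "\<lambda>x. q x - y x"])
    show "0 \<le> q s - y s" using mexp_zero[of A] by (simp add: y_def)
    have "isCont (\<lambda>x. \<chi> i. y x $ i) x" for x
      unfolding continuous_at by (intro tendsto_vec_lambda isContD DERIV_isCont[OF y])
    then have "continuous_on {s..t} y" by (simp add: continuous_at_imp_continuous_on)
    then show "continuous_on {s..t} (\<lambda>x. q x - y x)" by (intro continuous_on_diff cont)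
    fix x i assume x: "s \<le> x" "x < t" and d: "0 \<le> q x - y x" "(q x - y x) $ i = 0"
    obtain m where m: "(A *v q x) $ i < m" "\<forall>\<^sub>F h in at_right 0. q x $ i + h * m \<le> q (x + h) $ i"
      using slope[OF x] by blast
    have "(A *v y x) $ i \<le> (A *v q x) $ i"
      using d by (intro offdiag_mult_mono[OF A]) auto
    then have lt: "(A *v y x) $ i < m" using m by simp
    have "((\<lambda>h. (y (x + h) $ i - y x $ i) / h) \<longlongrightarrow> (A *v y x) $ i) (at_right 0)"
      using y[of i x] unfolding DERIV_def by (rule filterlim_mono) (auto simp: at_within_le_at)
    from order_tendstoD(2)[OF this lt] m(2) eventually_at_right_less[of "0::real"]
    show "\<forall>\<^sub>F h in at_right 0. 0 \<le> (q (x + h) - y (x + h)) $ i"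
    proof eventually_elim
      case (elim h)
      then have "y (x + h) $ i - y x $ i < h * m" by (simp add: field_simps)
      then show ?case using elim d by simp
    qed
  qed
  then show ?thesis by (simp add: y_def)
qed

section \<open>Spaces of histories\<close>

lemma seg_apply [simp]: "s \<le> 0 \<Longrightarrow> seg v t s = v (t + s)"
  by (simp add: seg_def)

lemma seg_seg: "s \<le> 0 \<Longrightarrow> seg (seg v t) s = seg v (t + s)"
  by (auto simp: seg_def fun_eq_iff add.assoc)

lemma seg_cong: "(\<And>s. s \<le> t \<Longrightarrow> v s = w s) \<Longrightarrow> seg v t = seg w t"
  by (auto simp: seg_def fun_eq_iff)

lemma seg_zero: "x \<in> BU \<Longrightarrow> seg x 0 = x"
  by (auto simp: seg_def BU_def extensional_def fun_eq_iff)

text \<open>A version of membership in \<open>BU\<close> for total functions with arbitrary values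
  beyond \<open>T\<close>. Elements of \<open>BU\<close> are \<open>undefined\<close> on positive
  arguments, so their pointwise sums and differences need not stay in \<open>BU\<close>, whereas
  \<open>ucb\<close> is closed under them.\<close>

definition ucb :: "real \<Rightarrow> (real \<Rightarrow> real^'m::finite) \<Rightarrow> bool" where
  "ucb T v \<longleftrightarrow> uniformly_continuous_on {..T} v \<and> bounded (v ` {..T})"

lemma uniformly_continuous_on_subset:
  fixes f :: "'a::metric_space \<Rightarrow> 'b::metric_space"
  shows "uniformly_continuous_on S f \<Longrightarrow> T \<subseteq> S \<Longrightarrow> uniformly_continuous_on T f"
  unfolding uniformly_continuous_on_def by (meson subsetD)

lemma seg_in_BU_iff: "seg v t \<in> BU \<longleftrightarrow> ucb t v"
proof -
  have 1: "uniformly_continuous_on {..0} (seg v t) \<longleftrightarrow> uniformly_continuous_on {..t} v"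
  proof
    assume "uniformly_continuous_on {..0} (seg v t)"
    then have *: "\<exists>d>0. \<forall>x\<le>0. \<forall>y\<le>0. dist y x < d \<longrightarrow> dist (v (t + y)) (v (t + x)) < e" if "0 < e" for e
      using that unfolding uniformly_continuous_on_def Ball_def by (simp add: imp_conjL)
    show "uniformly_continuous_on {..t} v" unfolding uniformly_continuous_on_def
    proof (intro allI impI)
      fix e :: real assume "0 < e"
      then obtain d where d: "d > 0" "\<forall>x\<le>0. \<forall>y\<le>0. dist y x < d \<longrightarrow> dist (v (t + y)) (v (t + x)) < e"
        using * by blast
      have "dist (v y) (v x) < e" if "x \<le> t" "y \<le> t" "dist y x < d" for x y
        using d(2)[rule_format, of "x - t" "y - t"] that by (simp add: dist_real_def)
      then show "\<exists>d>0. \<forall>x\<in>{..t}. \<forall>x'\<in>{..t}. dist x' x < d \<longrightarrow> dist (v x') (v x) < e"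
        using d(1) by auto
    qed
  next
    assume *: "uniformly_continuous_on {..t} v"
    show "uniformly_continuous_on {..0} (seg v t)" unfolding uniformly_continuous_on_def
    proof (intro allI impI)
      fix e :: real assume "0 < e"
      then obtain d where d: "d > 0" "\<forall>x\<in>{..t}. \<forall>y\<in>{..t}. dist y x < d \<longrightarrow> dist (v y) (v x) < e"
        using * unfolding uniformly_continuous_on_def by blast
      have "dist (seg v t y) (seg v t x) < e" if "x \<le> 0" "y \<le> 0" "dist y x < d" for x y
        using d(2)[rule_format, of "t + x" "t + y"] that by (simp add: dist_real_def)
      then show "\<exists>d>0. \<forall>x\<in>{..0}. \<forall>x'\<in>{..0}. dist x' x < d \<longrightarrow> dist (seg v t x') (seg v t x) < e"
        using d(1) by auto
    qed
  qed
  have "seg v t ` {..0} = v ` (\<lambda>s. t + s) ` {..0}" unfolding image_image by (rule image_cong) simp_all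
  also have "(\<lambda>s. t + s) ` {..0} = {..t}" by (auto intro!: image_eqI[where x = "_ - t"])
  finally show ?thesis using 1 by (auto simp: BU_def ucb_def) (auto simp: seg_def)
qed

lemma ucb_mono: "ucb T v \<Longrightarrow> t \<le> T \<Longrightarrow> ucb t v"
  unfolding ucb_def
  by (meson atMost_subset_iff bounded_subset image_mono uniformly_continuous_on_subset)

lemma uniformly_continuous_on_atMost_extend:
  fixes v :: "real \<Rightarrow> 'a::metric_space"
  assumes "uniformly_continuous_on {..a} v" "continuous_on {..T} v"
  shows "uniformly_continuous_on {..T} v"
  unfolding uniformly_continuous_on_def
proof (intro allI impI)
  fix e :: real assume e: "0 < e"
  \<comment> \<open>The overlap \<open>{a - 1..a}\<close>, together with a cap of 1 on the distance,
    puts every pair of points into one of the two pieces.\<close>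
  have "uniformly_continuous_on {a - 1..T} v"
    by (intro compact_uniformly_continuous continuous_on_subset[OF assms(2)]) auto
  then obtain d1 where d1: "d1 > 0" "\<forall>x\<in>{a - 1..T}. \<forall>y\<in>{a - 1..T}. dist y x < d1 \<longrightarrow> dist (v y) (v x) < e"
    using e unfolding uniformly_continuous_on_def by blast
  obtain d2 where d2: "d2 > 0" "\<forall>x\<in>{..a}. \<forall>y\<in>{..a}. dist y x < d2 \<longrightarrow> dist (v y) (v x) < e"
    using e assms(1) unfolding uniformly_continuous_on_def by blast
  have "dist (v y) (v x) < e" if "x \<le> T" "y \<le> T" "dist y x < min 1 (min d1 d2)" for x y
  proof (cases "x \<le> a \<and> y \<le> a")
    case False
    then have "x \<in> {a - 1..T} \<and> y \<in> {a - 1..T}" using that by (auto simp: dist_real_def)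
    then show ?thesis using d1 that by auto
  qed (use d2 that in auto)
  then show "\<exists>d>0. \<forall>x\<in>{..T}. \<forall>x'\<in>{..T}. dist x' x < d \<longrightarrow> dist (v x') (v x) < e"
    using d1(1) d2(1) by (intro exI[of _ "min 1 (min d1 d2)"]) auto
qed

lemma ucb_extend:
  assumes "ucb a v" "continuous_on {..T} v"
  shows "ucb T v"
proof -
  have "{..T} \<subseteq> {..a} \<union> {a..T}" by auto
  then have "v ` {..T} \<subseteq> v ` {..a} \<union> v ` {a..T}" by blast
  moreover have "bounded (v ` {..a} \<union> v ` {a..T})"
    using assms by (auto simp: ucb_def intro!: compact_imp_bounded compact_continuous_image
        continuous_on_subset[OF assms(2)])
  ultimately show ?thesis
    using assms uniformly_continuous_on_atMost_extend[of a v T] bounded_subset unfolding ucb_def by blast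
qed

lemma ucb_add: "ucb T v \<Longrightarrow> ucb T z \<Longrightarrow> ucb T (\<lambda>s. v s + z s)"
  by (simp add: ucb_def uniformly_continuous_on_add bounded_plus_comp)

lemma ucb_diff: "ucb T v \<Longrightarrow> ucb T z \<Longrightarrow> ucb T (\<lambda>s. v s - z s)"
  by (simp add: ucb_def uniformly_continuous_on_diff bounded_minus_comp)

lemma ucb_scaleR: "ucb T v \<Longrightarrow> ucb T (\<lambda>s. c *\<^sub>R v s)"
  unfolding ucb_def
  by (auto intro: bounded_linear.uniformly_continuous_on[OF bounded_linear_scaleR_right] bounded_scaleR_comp)

lemma BU_in_CX: "x \<in> BU \<Longrightarrow> x \<in> CX"
  using BU_subset_CX by blast

lemma infnorm_le_iff: "infnorm (v::real^'m::finite) \<le> c \<longleftrightarrow> (\<forall>i. \<bar>v $ i\<bar> \<le> c)"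
proof
  assume "\<forall>i. \<bar>v $ i\<bar> \<le> c"
  then show "infnorm v \<le> c" unfolding infnorm_cart by (intro cSup_least) auto
qed (use component_le_infnorm_cart order_trans in blast)

lemma BU_bdd_above_infnorm:
  assumes "x \<in> BU"
  shows "bdd_above ((\<lambda>s. infnorm (x s)) ` {..0})"
proof -
  obtain b where "\<And>s. s \<le> 0 \<Longrightarrow> norm (x s) \<le> b" using assms by (auto simp: BU_def bounded_iff)
  then show ?thesis
    by (intro bdd_aboveI2[where M = b]) (auto intro: order_trans[OF infnorm_le_norm])
qed

lemma BB_iff: "x \<in> BB k \<longleftrightarrow> x \<in> BU \<and> (\<forall>s\<le>0. infnorm (x s) \<le> k)"
proof (cases "x \<in> BU")
  case True
  then show ?thesis
    unfolding BB_def supnorm_def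
    by (subst mem_Collect_eq, subst cSUP_le_iff) (auto simp: BU_bdd_above_infnorm)
qed (simp add: BB_def)

lemma supnorm_le: "(\<And>s. s \<le> 0 \<Longrightarrow> infnorm (x s) \<le> c) \<Longrightarrow> supnorm x \<le> c"
  unfolding supnorm_def by (rule cSUP_least) auto

lemma BU_dist_le:
  assumes "x \<in> BU" "y \<in> BU" "\<And>s. s \<le> 0 \<Longrightarrow> infnorm (x s - y s) \<le> c"
  shows "BU_dist x y \<le> c"
  using assms by (simp add: BU_dist_def supnorm_le)

lemma BU_obtain_BB:
  assumes "x \<in> BU"
  obtains k where "k > 0" "x \<in> BB k"
proof
  show "x \<in> BB (max 1 (supnorm x))" using assms by (simp add: BB_def)
qed simp

subsection \<open>The compact-open metric\<close>

lemmas co_dist_nonneg = Metric_space.nonneg[OF Metric_space_CX]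
  and co_dist_commute = Metric_space.commute[OF Metric_space_CX]
  and co_dist_triangle = Metric_space.triangle[OF Metric_space_CX]

lemma co_dist_summand:
  assumes "x \<in> CX" "y \<in> CX"
  defines "p \<equiv> \<lambda>n. seminorm_on (Suc n) (\<lambda>s. x s - y s)"
  shows "0 \<le> p n" "s \<in> {- real (Suc n)..0} \<Longrightarrow> infnorm (x s - y s) \<le> p n"
    "(\<And>s. s \<in> {- real (Suc n)..0} \<Longrightarrow> infnorm (x s - y s) \<le> c) \<Longrightarrow> p n \<le> c"
    "summable (\<lambda>n. (1/2) ^ Suc n * (p n / (1 + p n)))"
    "(1/2) ^ Suc n * (p n / (1 + p n)) \<le> co_dist x y"
proof -
  show p0: "0 \<le> p n" for n
    using SUP_nonneg[OF _ CX_bdd_above CX_bdd_above, of "Suc n" x y y] assms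
    by (simp add: p_def seminorm_on_def del: of_nat_Suc)
  show "s \<in> {- real (Suc n)..0} \<Longrightarrow> infnorm (x s - y s) \<le> p n"
    unfolding p_def seminorm_on_def by (rule cSUP_upper[OF _ CX_bdd_above[OF assms(1,2)]])
  show "(\<And>s. s \<in> {- real (Suc n)..0} \<Longrightarrow> infnorm (x s - y s) \<le> c) \<Longrightarrow> p n \<le> c"
    unfolding p_def seminorm_on_def by (rule cSUP_least) auto
  have q: "0 \<le> (1/2) ^ Suc n * (p n / (1 + p n))" "(1/2) ^ Suc n * (p n / (1 + p n)) \<le> (1/2) ^ Suc n" for n
    using frac_bound[OF p0, of n] mult_left_mono[of "p n / (1 + p n)" 1 "(1/2) ^ Suc n"]
    by (simp_all only: mult_1_right zero_le_power zero_le_divide_1_iff zero_le_numeral mult_nonneg_nonneg)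
  show sm: "summable (\<lambda>n. (1/2) ^ Suc n * (p n / (1 + p n)))"
  proof (rule summable_comparison_test')
    show "summable (\<lambda>n. (1/2::real) ^ Suc n)" by (simp add: summable_geometric summable_mult)
    show "norm ((1/2) ^ Suc n * (p n / (1 + p n))) \<le> (1/2) ^ Suc n" for n
      using q[of n] by (metis abs_of_nonneg real_norm_def)
  qed
  have "(\<Sum>i\<in>{n}. (1/2) ^ Suc i * (p i / (1 + p i))) \<le> (\<Sum>n. (1/2) ^ Suc n * (p n / (1 + p n)))"
    by (rule sum_le_suminf[OF sm]) (use q in auto)
  then show "(1/2) ^ Suc n * (p n / (1 + p n)) \<le> co_dist x y"
    using assms by (simp add: co_dist_def)
qed

lemma co_dist_small:
  assumes "0 < \<eta>"
  obtains \<delta> where "0 < \<delta>" "\<And>x y s. x \<in> CX \<Longrightarrow> y \<in> CX \<Longrightarrow> co_dist x y < \<delta> \<Longrightarrow>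
    s \<in> {- real n..0} \<Longrightarrow> infnorm (x s - y s) \<le> \<eta>"
proof
  \<comment> \<open>The threshold is the value of summand \<open>n\<close> when its seminorm equals
    \<open>\<eta>\<close>. A single summand bounds the distance from below, and
    \<open>t / (1 + t)\<close> is increasing.\<close>
  show "0 < (1/2) ^ Suc n * (\<eta> / (1 + \<eta>))" using assms by simp
  fix x y :: "'m::finite hist" and s
  assume xy: "x \<in> CX" "y \<in> CX" and d: "co_dist x y < (1/2) ^ Suc n * (\<eta> / (1 + \<eta>))"
    and s: "s \<in> {- real n..0}"
  define p where "p = seminorm_on (Suc n) (\<lambda>s. x s - y s)"
  have p: "0 \<le> p" "infnorm (x s - y s) \<le> p" "(1/2) ^ Suc n * (p / (1 + p)) \<le> co_dist x y"
    unfolding p_def using s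
    by (intro co_dist_summand(1,2)[OF xy] co_dist_summand(5)[OF xy]; simp)+
  have "(1/2) ^ Suc n * (p / (1 + p)) < (1/2) ^ Suc n * (\<eta> / (1 + \<eta>))" using p(3) d by linarith
  then have "p / (1 + p) < \<eta> / (1 + \<eta>)" by (rule mult_left_less_imp_less) simp
  then have "p < \<eta>" using p(1) assms by (simp add: field_simps)
  then show "infnorm (x s - y s) \<le> \<eta>" using p(2) by linarith
qed

text \<open>The summands below index \<open>n\<close> are at most \<open>\<eta>\<close> times their
  weights, and all weights sum to 1; the weights from \<open>n\<close> on sum to exactly
  \<open>(1/2) ^ n\<close>.\<close>

lemma co_dist_le:
  assumes xy: "x \<in> CX" "y \<in> CX" and "0 \<le> \<eta>" and small: "\<And>s. s \<in> {- real n..0} \<Longrightarrow> infnorm (x s - y s) \<le> \<eta>"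
  shows "co_dist x y \<le> \<eta> + (1/2) ^ n"
proof -
  define p where "p k = seminorm_on (Suc k) (\<lambda>s. x s - y s)" for k
  note p = co_dist_summand[OF xy, folded p_def]
  have geo: "(\<lambda>k. (1/2::real) ^ Suc k) sums 1" by (rule power_half_series)
  have 2: "(\<lambda>k. if k < n then 0 else (1/2::real) ^ Suc k) sums ((1/2) ^ n)"
  proof -
    have "(\<lambda>k. (1/2::real) ^ n * (1/2) ^ Suc k) sums ((1/2) ^ n * 1)" by (intro sums_mult geo)
    then have "(\<lambda>k. if k + n < n then 0 else (1/2::real) ^ Suc (k + n)) sums ((1/2) ^ n)"
      by (simp add: power_add mult.commute)
    then show ?thesis by (subst (asm) sums_iff_shift) simp
  qed
  have "(\<Sum>k. (1/2) ^ Suc k * (p k / (1 + p k))) \<le> \<eta> * 1 + (1/2) ^ n"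
  proof (rule sums_le[OF _ summable_sums[OF p(4)]])
    show "(\<lambda>k. \<eta> * (1/2::real) ^ Suc k + (if k < n then 0 else (1/2::real) ^ Suc k)) sums (\<eta> * 1 + (1/2) ^ n)"
      by (intro sums_add sums_mult geo 2)
    fix k
    show "(1/2) ^ Suc k * (p k / (1 + p k)) \<le> \<eta> * (1/2) ^ Suc k + (if k < n then 0 else (1/2) ^ Suc k)"
    proof (cases "k < n")
      case True
      then have "p k \<le> \<eta>" using small by (intro p(3)) auto
      moreover have "p k / (1 + p k) \<le> p k / 1" using p(1)[of k] by (intro divide_left_mono) auto
      ultimately have "p k / (1 + p k) \<le> \<eta>" by simp
      then have "(1/2) ^ Suc k * (p k / (1 + p k)) \<le> (1/2) ^ Suc k * \<eta>" by (intro mult_left_mono) auto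
      then show ?thesis using True by (simp add: mult.commute)
    next
      case False
      have "(1/2) ^ Suc k * (p k / (1 + p k)) \<le> (1/2) ^ Suc k * 1"
        using frac_bound[OF p(1), of k] by (intro mult_left_mono) auto
      then show ?thesis using False \<open>0 \<le> \<eta>\<close> by (simp add: add_increasing)
    qed
  qed
  then show ?thesis using xy by (simp add: co_dist_def p_def)
qed

text \<open>Translation invariance of the distance: a perturbation moved to another base point keeps
  its size, as \<open>K_set_stable\<close> requires.\<close>

lemma co_dist_cong:
  assumes "x \<in> CX" "y \<in> CX" "x' \<in> CX" "y' \<in> CX" "\<And>s. s \<le> 0 \<Longrightarrow> x s - y s = x' s - y' s"
  shows "co_dist x y = co_dist x' y'"
proof -
  have "seminorm_on n (\<lambda>s. x s - y s) = seminorm_on n (\<lambda>s. x' s - y' s)" for n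
    unfolding seminorm_on_def by (rule SUP_cong) (use assms in auto)
  then show ?thesis using assms by (simp add: co_dist_def)
qed

lemma norm_le_card_infnorm: "norm (v::real^'m::finite) \<le> CARD('m) * infnorm v"
proof -
  have "norm v \<le> (\<Sum>i\<in>UNIV. \<bar>v $ i\<bar>)" by (rule norm_le_l1_cart)
  also have "\<dots> \<le> (\<Sum>i\<in>(UNIV::'m set). infnorm v)" by (intro sum_mono component_le_infnorm_cart)
  finally show ?thesis by simp
qed

text \<open>The second argument may vary with \<open>n\<close> because \<open>K_close_F\<close>
  compares two sequences with each other before it identifies a limit.\<close>

lemma co_dist_tendsto_zero_iff:
  fixes x y :: "nat \<Rightarrow> 'm::finite hist"
  assumes x: "\<And>n. x n \<in> CX" and y: "\<And>n. y n \<in> CX"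
  shows "(\<lambda>n. co_dist (x n) (y n)) \<longlonglongrightarrow> 0 \<longleftrightarrow>
    (\<forall>R e. 0 < e \<longrightarrow> (\<forall>\<^sub>F n in sequentially. \<forall>s\<in>{- R..0}. norm (x n s - y n s) < e))"
proof
  assume lim: "(\<lambda>n. co_dist (x n) (y n)) \<longlonglongrightarrow> 0"
  show "\<forall>R e. 0 < e \<longrightarrow> (\<forall>\<^sub>F n in sequentially. \<forall>s\<in>{- R..0}. norm (x n s - y n s) < e)"
  proof (intro allI impI)
    fix R e :: real assume e: "0 < e"
    obtain N where N: "R \<le> real N" using real_arch_simple by blast
    define \<eta> where "\<eta> = e / (2 * CARD('m))"
    have \<eta>: "0 < \<eta>" "CARD('m) * \<eta> < e" using e by (auto simp: \<eta>_def)
    obtain \<delta> where \<delta>: "0 < \<delta>" "\<And>x y s. x \<in> CX \<Longrightarrow> y \<in> CX \<Longrightarrow> co_dist x y < \<delta> \<Longrightarrow>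
        s \<in> {- real N..0} \<Longrightarrow> infnorm (x s - y s :: real^'m) \<le> \<eta>"
      using co_dist_small[OF \<eta>(1), of N] by metis
    from order_tendstoD(2)[OF lim \<delta>(1)]
    show "\<forall>\<^sub>F n in sequentially. \<forall>s\<in>{- R..0}. norm (x n s - y n s) < e"
    proof eventually_elim
      case (elim n)
      show ?case
      proof
        fix s assume "s \<in> {- R..0}"
        then have "infnorm (x n s - y n s) \<le> \<eta>" using N by (intro \<delta>(2)[OF x y elim]) auto
        then have "CARD('m) * infnorm (x n s - y n s) \<le> CARD('m) * \<eta>" by (intro mult_left_mono) auto
        then show "norm (x n s - y n s) < e" using norm_le_card_infnorm[of "x n s - y n s"] \<eta>(2) by linarith
      qed
    qed
  qed
next
  assume *: "\<forall>R e. 0 < e \<longrightarrow> (\<forall>\<^sub>F n in sequentially. \<forall>s\<in>{- R..0}. norm (x n s - y n s) < e)"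
  show "(\<lambda>n. co_dist (x n) (y n)) \<longlonglongrightarrow> 0"
  proof (rule tendstoI)
    fix e :: real assume e: "0 < e"
    obtain N where N: "(1/2::real) ^ N < e / 2" using real_arch_pow_inv[of "e / 2" "1/2"] e by auto
    have "\<forall>\<^sub>F n in sequentially. \<forall>s\<in>{- real N..0}. norm (x n s - y n s) < e / 2"
      using *[rule_format, of "e / 2" "real N"] e by simp
    then show "\<forall>\<^sub>F n in sequentially. dist (co_dist (x n) (y n)) 0 < e"
    proof eventually_elim
      case (elim n)
      have "co_dist (x n) (y n) \<le> e / 2 + (1/2) ^ N"
      proof (rule co_dist_le[OF x y])
        show "infnorm (x n s - y n s) \<le> e / 2" if "s \<in> {- real N..0}" for s
          using elim[rule_format, OF that] infnorm_le_norm[of "x n s - y n s"] by linarith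
      qed (use e in simp)
      moreover have "0 \<le> co_dist (x n) (y n)" by (rule co_dist_nonneg)
      ultimately show ?case using N by simp
    qed
  qed
qed

section \<open>The operator D\<close>

lemma D_measures:
  assumes "cond_D3_D5 \<nu> D"
  shows "sets (\<nu> i j) = sets (restrict_space borel {..0})" "finite_measure (\<nu> i j)"
    "measure (\<nu> i j) {0} = 0" "space (\<nu> i j) = {..0}"
    "continuous_on {..0} f \<Longrightarrow> f \<in> borel_measurable (\<nu> i j)"
    "\<lbrakk>continuous_on {..0} f; \<And>s. s \<le> 0 \<Longrightarrow> \<bar>f s\<bar> \<le> b\<rbrakk> \<Longrightarrow> integrable (\<nu> i j) (f :: real \<Rightarrow> real)"
proof -
  show sets: "sets (\<nu> i j) = sets (restrict_space borel {..0})" and fin: "finite_measure (\<nu> i j)"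
    and "measure (\<nu> i j) {0} = 0"
    using assms by (simp_all add: cond_D3_D5_def)
  show sp: "space (\<nu> i j) = {..0}" using sets_eq_imp_space_eq[OF sets] by (simp add: space_restrict_space)
  show meas: "f \<in> borel_measurable (\<nu> i j)" if "continuous_on {..0} f" for f :: "real \<Rightarrow> 'z::topological_space"
    using borel_measurable_continuous_on_restrict[OF that] measurable_cong_sets[OF sets refl] by blast
  show "integrable (\<nu> i j) f" if "continuous_on {..0} f" "\<And>s. s \<le> 0 \<Longrightarrow> \<bar>f s\<bar> \<le> b" for f :: "real \<Rightarrow> real"
    by (rule finite_measure.integrable_const_bound[OF fin, of _ b])
      (use that sp meas in \<open>auto intro!: AE_I2\<close>)
qed

lemma BU_component:
  assumes "x \<in> BU"
  shows "continuous_on {..0} (\<lambda>s. x s $ j)" "\<exists>b. \<forall>s\<le>0. \<bar>x s $ j\<bar> \<le> b"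
proof -
  have "continuous_on {..0} x" using assms by (simp add: BU_def uniformly_continuous_imp_continuous)
  then show "continuous_on {..0} (\<lambda>s. x s $ j)" by (intro continuous_intros)
  obtain b where "\<forall>s\<le>0. norm (x s) \<le> b" using assms by (auto simp: BU_def bounded_iff)
  then show "\<exists>b. \<forall>s\<le>0. \<bar>x s $ j\<bar> \<le> b" using component_le_norm_cart order_trans by blast
qed

lemma BU_integrable: "cond_D3_D5 \<nu> D \<Longrightarrow> x \<in> BU \<Longrightarrow> integrable (\<nu> i j) (\<lambda>s. x s $ j)"
  using BU_component[of x j] D_measures(6) by metis

lemma D_nth:
  assumes "cond_D3_D5 \<nu> D" "x \<in> BU"
  shows "D x $ i = x 0 $ i - (\<Sum>j\<in>UNIV. integral\<^sup>L (\<nu> i j) (\<lambda>s. x s $ j))"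
  using assms by (auto simp: cond_D3_D5_def)

lemma D_weights_zero_nu:
  assumes "cond_D3_D5 \<nu> D" "zero_nu \<nu>"
  shows "measure (\<nu> i j) (space (\<nu> i j)) = 0"
  using assms by (simp add: zero_nu_def measure_def)

lemma ucb_exp:
  fixes v :: "real^'m::finite"
  assumes "0 \<le> l"
  shows "ucb T (\<lambda>t. exp (l * t) *\<^sub>R v)"
proof -
  have "(exp (l * T) * l * norm v)-lipschitz_on {..T} (\<lambda>t. exp (l * t) *\<^sub>R v)"
  proof (rule bounded_derivative_imp_lipschitz)
    fix t assume "t \<in> {..T}"
    show "((\<lambda>t. exp (l * t) *\<^sub>R v) has_derivative (\<lambda>h. (h * (exp (l * t) * l)) *\<^sub>R v)) (at t within {..T})"
      by (auto intro!: derivative_eq_intros simp: algebra_simps)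
    have "exp (l * t) \<le> exp (l * T)" using \<open>t \<in> {..T}\<close> assms by (simp add: mult_left_mono)
    then have *: "exp (l * t) * l * norm v \<le> exp (l * T) * l * norm v" using assms by (intro mult_right_mono) auto
    show "onorm (\<lambda>h. (h * (exp (l * t) * l)) *\<^sub>R v) \<le> exp (l * T) * l * norm v"
    proof (rule onorm_le)
      show "norm ((h * (exp (l * t) * l)) *\<^sub>R v) \<le> exp (l * T) * l * norm v * norm h" for h
        using mult_right_mono[OF *, of "\<bar>h\<bar>"] assms by (simp add: abs_mult mult_ac)
    qed
  qed (use assms in auto)
  then have "uniformly_continuous_on {..T} (\<lambda>t. exp (l * t) *\<^sub>R v)"
    by (rule lipschitz_on_uniformly_continuous)
  moreover have "norm (exp (l * t) *\<^sub>R v) \<le> exp (l * T) * norm v" if "t \<le> T" for t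
    using assms that by (auto intro!: mult_right_mono mult_left_mono)
  ultimately show ?thesis unfolding ucb_def bounded_iff by auto
qed

text \<open>The hypothesis on \<open>v\<close> is the characteristic equation of the homogeneous
  problem at the real exponent \<open>l\<close>: the Laplace transform of \<open>\<nu>\<close> at
  \<open>l\<close> fixes \<open>v\<close>.\<close>

lemma D4_no_growing_exponential:
  fixes v :: "real^'m::finite"
  assumes D: "cond_D3_D5 \<nu> D" and "cond_D4 D" and l: "0 \<le> l"
    and v: "\<And>i. (\<Sum>j\<in>UNIV. (LINT s|\<nu> i j. exp (l * s)) * v $ j) = v $ i"
  shows "v = 0"
proof -
  define x where "x t = exp (l * t) *\<^sub>R v" for t
  have BU: "seg x t \<in> BU" for t using ucb_exp[OF l] by (simp add: seg_in_BU_iff x_def[abs_def])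
  have D0: "D (seg x t) = 0" for t
  proof (subst vec_eq_iff, intro allI)
    fix i
    have "(LINT s|\<nu> i j. seg x t s $ j) = exp (l * t) * ((LINT s|\<nu> i j. exp (l * s)) * v $ j)" for j
    proof -
      have "(LINT s|\<nu> i j. seg x t s $ j) = (LINT s|\<nu> i j. exp (l * t) * (exp (l * s) * v $ j))"
        by (rule Bochner_Integration.integral_cong)
          (auto simp: D_measures[OF D] x_def exp_add distrib_left)
      then show ?thesis by simp
    qed
    then show "D (seg x t) $ i = 0 $ i"
      unfolding D_nth[OF D BU] by (simp add: sum_distrib_left[symmetric] v) (simp add: x_def)
  qed
  obtain c where c: "(c \<longlongrightarrow> 0) at_top" "\<And>t. 0 \<le> t \<Longrightarrow> infnorm (x t) \<le> c t * supnorm (seg x 0)"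
  proof -
    have "continuous_on UNIV x" unfolding x_def by (intro continuous_intros)
    then show thesis using assms(2) BU[of 0] D0 that unfolding cond_D4_def by metis
  qed
  have "infnorm v \<le> 0 * supnorm (seg x 0)"
  proof (rule tendsto_lowerbound)
    show "((\<lambda>t. c t * supnorm (seg x 0)) \<longlongrightarrow> 0 * supnorm (seg x 0)) at_top"
      by (intro tendsto_intros c)
    have "infnorm v \<le> c t * supnorm (seg x 0)" if "0 \<le> t" for t
    proof -
      have "1 * infnorm v \<le> exp (l * t) * infnorm v"
        using l that by (intro mult_right_mono) (auto simp: infnorm_pos_le)
      also have "\<dots> = infnorm (x t)" by (simp add: x_def infnorm_mul)
      finally show ?thesis using c(2)[OF that] by simp
    qed
    then show "\<forall>\<^sub>F t in at_top. infnorm v \<le> c t * supnorm (seg x 0)"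
      by (rule eventually_mono[OF eventually_ge_at_top[of 0]])
  qed simp
  then show ?thesis using infnorm_pos_lt[of v] by auto
qed

lemma D_weights_D4:
  fixes \<nu> :: "'m::finite \<Rightarrow> 'm \<Rightarrow> real measure"
  assumes D: "cond_D3_D5 \<nu> D" and D4: "cond_D4 D"
  obtains w q where "\<And>i. 0 < w $ i" "0 \<le> q" "q < 1"
    "\<And>i. (\<Sum>j\<in>UNIV. measure (\<nu> i j) (space (\<nu> i j)) * w $ j) \<le> q * w $ i"
proof -
  note m = D_measures[OF D]
  \<comment> \<open>The Laplace transform of \<open>\<nu>\<close>; its value at 0 is the matrix of
    total masses.\<close>
  define H :: "real \<Rightarrow> real^'m^'m" where "H l = (\<chi> i j. LINT s|\<nu> i j. exp (l * s))" for l
  have H_nn: "0 \<le> H l $ i $ j" for l i j unfolding H_def by (simp add: Bochner_Integration.integral_nonneg)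
  have dom: "(\<lambda>n. H (l n) $ i $ j) \<longlonglongrightarrow> (LINT s|\<nu> i j. f s)"
    if "\<And>n. 0 \<le> l n" "f \<in> borel_measurable (\<nu> i j)" "\<And>s. s \<le> 0 \<Longrightarrow> (\<lambda>n. exp (l n * s)) \<longlonglongrightarrow> f s"
    for l :: "nat \<Rightarrow> real" and f i j
    unfolding H_def vec_lambda_beta
  proof (rule integral_dominated_convergence[where w = "\<lambda>_. 1"])
    show "integrable (\<nu> i j) (\<lambda>_. 1::real)" by (rule m(6)[where b = 1]) auto
    show "(\<lambda>s. exp (l n * s)) \<in> borel_measurable (\<nu> i j)" for n by (intro m(5) continuous_intros)
  qed (use that m(4) in \<open>auto intro!: AE_I2 mult_nonneg_nonpos\<close>)
  have cont: "continuous_on {0..} (\<lambda>l. H l - mat 1)"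
    unfolding continuous_on_sequentially
  proof (intro allI ballI impI, elim conjE)
    fix l :: "nat \<Rightarrow> real" and a assume l: "\<forall>n. l n \<in> {0..}" "l \<longlonglongrightarrow> a"
    have "(\<lambda>n. H (l n) $ i $ j) \<longlonglongrightarrow> H a $ i $ j" for i j
    proof -
      have "(\<lambda>n. H (l n) $ i $ j) \<longlonglongrightarrow> (LINT s|\<nu> i j. exp (a * s))"
        using l by (intro dom m(5) continuous_intros tendsto_intros) auto
      then show ?thesis by (simp add: H_def)
    qed
    then have "(\<lambda>n. H (l n)) \<longlonglongrightarrow> H a" by (intro vec_tendstoI)
    then show "((\<lambda>l. H l - mat 1) \<circ> l) \<longlonglongrightarrow> H a - mat 1" by (auto simp: o_def intro!: tendsto_intros)
  qed
  have "(\<lambda>n. H (real n) $ i $ j) \<longlonglongrightarrow> 0" for i j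
  proof -
    \<comment> \<open>The integrands tend to the indicator of \<open>{0}\<close>, not to 0; its
      integral vanishes because \<open>\<nu>\<close> has no mass at 0. So for large \<open>n\<close>
      the constant vector is a strict subsolution.\<close>
    have "(\<lambda>n. H (real n) $ i $ j) \<longlonglongrightarrow> (LINT s|\<nu> i j. indicator {0} s)"
    proof (rule dom)
      have "{0} \<in> sets (\<nu> i j)" unfolding m(1) sets_restrict_space by (auto intro!: image_eqI[of _ _ "{0}"])
      then show "(indicator {0} :: real \<Rightarrow> real) \<in> borel_measurable (\<nu> i j)" by simp
      show "(\<lambda>n. exp (real n * s)) \<longlonglongrightarrow> indicator {0} s" if "s \<le> 0" for s
      proof (cases "s = 0")
        case False
        then have "(\<lambda>n. exp s ^ n) \<longlonglongrightarrow> 0" using that by (intro LIMSEQ_realpow_zero) auto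
        then show ?thesis using False by (simp add: exp_of_nat_mult)
      qed simp
    qed simp
    then show ?thesis using m(3,4)[of i j] by simp
  qed
  then have "(\<lambda>n. ((H (real n) - mat 1) *v 1) $ i) \<longlonglongrightarrow> (\<Sum>j\<in>UNIV. (0 - mat 1 $ i $ j) * 1)" for i
    unfolding matrix_vector_nth vector_minus_component one_index
    by (intro tendsto_sum tendsto_mult tendsto_diff tendsto_const)
  moreover have "(\<Sum>j\<in>UNIV. (0 - (mat 1 :: real^'m^'m) $ i $ j) * 1) < 0" for i
    by (simp add: mat_def sum_negf)
  ultimately have "\<forall>\<^sub>F n in sequentially. ((H (real n) - mat 1) *v 1) $ i < 0" for i
    using order_tendstoD(2) by blast
  then have "\<forall>\<^sub>F n in sequentially. \<forall>i. ((H (real n) - mat 1) *v 1) $ i < 0"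
    by (simp add: eventually_all_finite)
  then obtain n where n: "\<And>i. ((H (real n) - mat 1) *v 1) $ i < 0"
    by (auto simp: eventually_sequentially)
  have off: "offdiag_nonneg (H l - mat 1)" for l
    using H_nn by (auto simp: offdiag_nonneg_def mat_def)
  have "\<not> (\<exists>l\<ge>0. \<exists>v. 0 \<le> v \<and> v \<noteq> 0 \<and> (H l - mat 1) *v v = 0)"
  proof (safe, rule ccontr)
    fix l v assume l: "0 \<le> l" and "(H l - mat 1) *v v = 0" "v \<noteq> 0"
    then have "H l *v v = v" by (simp add: matrix_vector_mult_diff_rdistrib)
    then have "(\<Sum>j\<in>UNIV. (LINT s|\<nu> i j. exp (l * s)) * v $ j) = v $ i" for i
      using matrix_vector_nth[of "H l" v i] by (simp add: H_def)
    then show False using D4_no_growing_exponential[OF D D4 l] \<open>v \<noteq> 0\<close> by blast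
  qed
  then obtain e where e: "\<And>i. 0 < e $ i" "\<And>i. ((H 0 - mat 1) *v e) $ i < 0"
    using strict_subsolution_or_kernel[OF cont off _ _ n] by auto
  \<comment> \<open>There are finitely many strict inequalities
    \<open>(H 0 *v e) $ i < e $ i\<close>, so one factor below 1 serves all coordinates.\<close>
  define q where "q = Max (range (\<lambda>i. (H 0 *v e) $ i / e $ i))"
  have lt: "(H 0 *v e) $ i < e $ i" for i using e(2)[of i] by (simp add: matrix_vector_mult_diff_rdistrib)
  have nn: "0 \<le> (H 0 *v e) $ i" for i
    unfolding matrix_vector_nth by (intro sum_nonneg mult_nonneg_nonneg H_nn less_imp_le e)
  have q: "(H 0 *v e) $ i / e $ i \<le> q" for i unfolding q_def by (rule Max_ge) auto
  show thesis
  proof (rule that[of e q])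
    show "0 \<le> q" using q[of undefined] nn[of undefined] e(1)[of undefined]
      by (smt (verit) divide_nonneg_pos)
    show "q < 1" unfolding q_def using lt e(1) by (subst Max_less_iff) auto
    show "(\<Sum>j\<in>UNIV. measure (\<nu> i j) (space (\<nu> i j)) * e $ j) \<le> q * e $ i" for i
      using q[of i] e(1)[of i] unfolding matrix_vector_nth
      by (simp add: H_def pos_divide_le_eq)
  qed (rule e)
qed

section \<open>Weighted norms and contraction estimates\<close>

text \<open>With \<open>c\<close> the supremum of \<open>g\<close>, \<open>step\<close> gives
  \<open>c \<le> b + q * c\<close>; finiteness of the supremum allows solving for \<open>c\<close>.
  Uniqueness, equicontinuity and the Lipschitz bound on \<open>K\<close> are all obtained this
  way.\<close>

lemma contraction_bound:
  fixes g :: "'a \<Rightarrow> real"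
  assumes "\<And>x. x \<in> S \<Longrightarrow> 0 \<le> g x" "bdd_above (g ` S)" "q < 1"
    and step: "\<And>c. 0 \<le> c \<Longrightarrow> \<forall>x\<in>S. g x \<le> c \<Longrightarrow> \<forall>x\<in>S. g x \<le> b + q * c"
    and x: "x \<in> S"
  shows "g x \<le> b / (1 - q)"
proof -
  define c where "c = Sup (g ` S)"
  have le: "\<forall>x\<in>S. g x \<le> c" unfolding c_def using assms(2) by (auto intro: cSUP_upper)
  then have "0 \<le> c" using assms(1)[OF x] x by force
  have "c \<le> b + q * c" unfolding c_def
    by (rule cSUP_least) (use step[OF \<open>0 \<le> c\<close> le] x in \<open>auto simp: c_def\<close>)
  then have "c \<le> b / (1 - q)" using assms(3) by (simp add: field_simps)
  then show ?thesis using le x by force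
qed

text \<open>The maximum norm weighted by \<open>w\<close>. A nonnegative matrix that maps
  \<open>w\<close> below \<open>q\<close> times \<open>w\<close> has operator norm at most
  \<open>q\<close> in it.\<close>

definition wnorm :: "real^'m \<Rightarrow> real^'m::finite \<Rightarrow> real" where
  "wnorm w v = Max (range (\<lambda>i. \<bar>v $ i\<bar> / w $ i))"

lemma wnorm_le_iff:
  assumes "\<And>i. 0 < w $ i"
  shows "wnorm w v \<le> c \<longleftrightarrow> (\<forall>i. \<bar>v $ i\<bar> \<le> c * w $ i)"
  unfolding wnorm_def using assms by (subst Max_le_iff) (auto simp: pos_divide_le_eq)

lemma wnorm_nth_le:
  assumes "\<And>i. 0 < w $ i"
  shows "\<bar>v $ i\<bar> \<le> wnorm w v * w $ i"
  using wnorm_le_iff[OF assms, of v "wnorm w v"] by simp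

lemma wnorm_nonneg:
  assumes "\<And>i. 0 < w $ i"
  shows "0 \<le> wnorm w v"
proof -
  have "0 \<le> wnorm w v * w $ i" for i using wnorm_nth_le[OF assms, of v i] by linarith
  then show ?thesis using assms by (metis less_le_not_le linorder_le_cases mult_less_0_iff not_less)
qed

lemma wnorm_triangle:
  assumes w: "\<And>i. 0 < w $ i"
  shows "wnorm w (x + y) \<le> wnorm w x + wnorm w y"
  unfolding wnorm_le_iff[OF w]
proof
  fix i
  show "\<bar>(x + y) $ i\<bar> \<le> (wnorm w x + wnorm w y) * w $ i"
    using wnorm_nth_le[OF w, of x i] wnorm_nth_le[OF w, of y i]
    by (simp add: distrib_right abs_triangle_ineq[THEN order_trans])
qed

lemma wnorm_equiv:
  assumes w: "\<And>i. 0 < w $ i"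
  obtains a b where "0 < a" "0 < b" "\<And>v. wnorm w v \<le> a * norm v" "\<And>v. norm v \<le> b * wnorm w v"
proof
  define m where "m = Min (range (($) w))"
  have m: "m \<le> w $ i" for i unfolding m_def by (rule Min_le) auto
  have m0: "0 < m" unfolding m_def using w by (subst Min_gr_iff) auto
  show "0 < 1 / m" using m0 by simp
  show "wnorm w v \<le> 1 / m * norm v" for v
    unfolding wnorm_le_iff[OF w]
  proof
    fix i
    have "\<bar>v $ i\<bar> * m \<le> norm v * w $ i"
      using component_le_norm_cart[of v i] m[of i] m0 by (intro mult_mono) auto
    then show "\<bar>v $ i\<bar> \<le> 1 / m * norm v * w $ i" using m0 by (simp add: field_simps)
  qed
  show "0 < sum (($) w) UNIV" by (rule sum_pos) (use w in auto)
  show "norm v \<le> sum (($) w) UNIV * wnorm w v" for v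
  proof -
    have "norm v \<le> (\<Sum>i\<in>UNIV. \<bar>v $ i\<bar>)" by (rule norm_le_l1_cart)
    also have "\<dots> \<le> (\<Sum>i\<in>UNIV. wnorm w v * w $ i)" by (intro sum_mono wnorm_nth_le w)
    finally show ?thesis by (simp add: sum_distrib_left mult.commute)
  qed
qed

lemma vector_derivative_lipschitz:
  fixes f :: "real \<Rightarrow> 'a::real_normed_vector"
  assumes "\<And>t. t \<in> {S..T} \<Longrightarrow> (f has_vector_derivative f' t) (at t within {S..T})"
    and "\<And>t. t \<in> {S..T} \<Longrightarrow> norm (f' t) \<le> M" and "s \<in> {S..T}" "t \<in> {S..T}"
  shows "norm (f t - f s) \<le> M * \<bar>t - s\<bar>"
proof -
  have "norm (f t - f s) \<le> M * norm (t - s)"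
  proof (rule differentiable_bound)
    fix x assume x: "x \<in> {S..T}"
    show "(f has_derivative (\<lambda>h. h *\<^sub>R f' x)) (at x within {S..T})"
      using assms(1)[OF x] by (simp add: has_vector_derivative_def)
    show "onorm (\<lambda>h. h *\<^sub>R f' x) \<le> M"
      by (rule onorm_le) (use assms(2)[OF x] in \<open>simp add: mult.commute[of M] mult_left_mono\<close>)
  qed (use assms in auto)
  then show ?thesis by simp
qed

section \<open>Estimates for the operator D\<close>

locale delay_operator =
  fixes \<nu> :: "'m::finite \<Rightarrow> 'm \<Rightarrow> real measure" and D :: "'m hist \<Rightarrow> real^'m"
    and w :: "real^'m" and q :: real
  assumes D: "cond_D3_D5 \<nu> D" and w: "\<And>i. 0 < w $ i" and q: "0 \<le> q" "q < 1"
    and mass: "\<And>i. (\<Sum>j\<in>UNIV. measure (\<nu> i j) (space (\<nu> i j)) * w $ j) \<le> q * w $ i"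
begin

text \<open>The difference at 0 is \<open>D x - D y\<close> plus an integral of
  \<open>x s - y s\<close> against \<open>\<nu>\<close>. The bound \<open>c\<close> contributes
  \<open>q * c\<close> through the total masses; the excess \<open>C\<close> is paid only on
  \<open>{..<- R}\<close>, where \<open>\<nu>\<close> has little mass.\<close>

lemma D_diff_bound_tail:
  assumes x: "x \<in> BU" and y: "y \<in> BU" and c: "0 \<le> c" "0 \<le> C" and R: "0 \<le> R"
    and far: "\<And>s. s \<le> 0 \<Longrightarrow> wnorm w (x s - y s) \<le> c + C"
    and near: "\<And>s. - R \<le> s \<Longrightarrow> s \<le> 0 \<Longrightarrow> wnorm w (x s - y s) \<le> c"
    and tail: "\<And>i. C * (\<Sum>j\<in>UNIV. measure (\<nu> i j) {..<- R} * w $ j) \<le> d * w $ i"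
  shows "wnorm w (x 0 - y 0) \<le> wnorm w (D x - D y) + q * c + d"
  unfolding wnorm_le_iff[OF w]
proof
  fix i
  have ind: "integrable (\<nu> i j) (indicator {..<- R} :: real \<Rightarrow> real)"
    "{..<- R} \<in> sets (\<nu> i j)" "{..<- R} \<inter> space (\<nu> i j) = {..<- R}" for j
  proof -
    show "{..<- R} \<inter> space (\<nu> i j) = {..<- R}" using R D_measures(4)[OF D] by auto
    show "{..<- R} \<in> sets (\<nu> i j)" unfolding D_measures(1)[OF D] sets_restrict_space
      using R by (auto intro!: image_eqI[of _ _ "{..<- R}"])
    then show "integrable (\<nu> i j) (indicator {..<- R} :: real \<Rightarrow> real)"
      using finite_measure.emeasure_finite[OF D_measures(2)[OF D]]
      by (simp add: integrable_indicator_iff \<open>{..<- R} \<inter> space (\<nu> i j) = {..<- R}\<close> top.not_eq_extremum)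
  qed
  have one: "integrable (\<nu> i j) (\<lambda>_. k :: real)" for j k by (rule D_measures(6)[OF D, where b = "\<bar>k\<bar>"]) auto
  have p: "integrable (\<nu> i j) (\<lambda>s. x s $ j - y s $ j)" for j
    using BU_integrable[OF D x] BU_integrable[OF D y] by simp
  have "\<bar>LINT s|\<nu> i j. x s $ j - y s $ j\<bar>
      \<le> c * (measure (\<nu> i j) (space (\<nu> i j)) * w $ j) + C * (measure (\<nu> i j) {..<- R} * w $ j)" for j
  proof -
    have "\<bar>LINT s|\<nu> i j. x s $ j - y s $ j\<bar> \<le> (LINT s|\<nu> i j. \<bar>x s $ j - y s $ j\<bar>)"
      using integral_norm_bound[of "\<nu> i j" "\<lambda>s. x s $ j - y s $ j"] by simp
    also have "\<dots> \<le> (LINT s|\<nu> i j. c * w $ j + (C * w $ j) * indicator {..<- R} s)"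
    proof (rule Bochner_Integration.integral_mono)
      fix s assume "s \<in> space (\<nu> i j)"
      then have s: "s \<le> 0" using D_measures(4)[OF D] by simp
      have "\<bar>x s $ j - y s $ j\<bar> \<le> wnorm w (x s - y s) * w $ j" using wnorm_nth_le[OF w, of "x s - y s" j] by simp
      also have "\<dots> \<le> (c + C * indicator {..<- R} s) * w $ j"
        using far[OF s] near[of s] s w[of j] by (intro mult_right_mono) (auto simp: indicator_def)
      finally show "\<bar>x s $ j - y s $ j\<bar> \<le> c * w $ j + (C * w $ j) * indicator {..<- R} s"
        by (simp add: algebra_simps)
    qed (intro Bochner_Integration.integrable_add integrable_abs integrable_mult_right p one ind)+
    also have "\<dots> = (LINT s|\<nu> i j. (c * w $ j) * 1) + (LINT s|\<nu> i j. (C * w $ j) * indicator {..<- R} s)"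
      using one ind by (subst Bochner_Integration.integral_add[symmetric]) auto
    also have "\<dots> = c * (measure (\<nu> i j) (space (\<nu> i j)) * w $ j) + C * (measure (\<nu> i j) {..<- R} * w $ j)"
      using ind(3)[of j] by (simp add: mult_ac)
    finally show ?thesis .
  qed
  then have "\<bar>\<Sum>j\<in>UNIV. LINT s|\<nu> i j. x s $ j - y s $ j\<bar>
      \<le> (\<Sum>j\<in>UNIV. c * (measure (\<nu> i j) (space (\<nu> i j)) * w $ j) + C * (measure (\<nu> i j) {..<- R} * w $ j))"
    by (intro order_trans[OF sum_abs] sum_mono)
  also have "\<dots> \<le> c * (q * w $ i) + d * w $ i"
    unfolding sum.distrib sum_distrib_left[symmetric]
    by (intro add_mono mult_left_mono mass tail c)
  finally have "\<bar>\<Sum>j\<in>UNIV. LINT s|\<nu> i j. x s $ j - y s $ j\<bar> \<le> q * c * w $ i + d * w $ i"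
    by (simp add: mult_ac)
  moreover have "(x 0 - y 0) $ i = (D x - D y) $ i + (\<Sum>j\<in>UNIV. LINT s|\<nu> i j. x s $ j - y s $ j)"
    using BU_integrable[OF D x] BU_integrable[OF D y] by (simp add: D_nth[OF D] x y sum_subtractf)
  ultimately show "\<bar>(x 0 - y 0) $ i\<bar> \<le> (wnorm w (D x - D y) + q * c + d) * w $ i"
    using wnorm_nth_le[OF w, of "D x - D y" i] by (simp add: distrib_right)
qed

lemma D_diff_bound:
  assumes "x \<in> BU" "y \<in> BU" "0 \<le> c" "\<And>s. s \<le> 0 \<Longrightarrow> wnorm w (x s - y s) \<le> c"
  shows "wnorm w (x 0 - y 0) \<le> wnorm w (D x - D y) + q * c"
  using D_diff_bound_tail[of x y c 0 0 0] assms by simp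

lemma D_tail:
  assumes "0 < \<epsilon>"
  obtains R where "0 \<le> R" "\<And>i. (\<Sum>j\<in>UNIV. measure (\<nu> i j) {..<- R} * w $ j) \<le> \<epsilon> * w $ i"
proof -
  have "(\<lambda>n. measure (\<nu> i j) {..<- real n}) \<longlonglongrightarrow> measure (\<nu> i j) (\<Inter>n. {..<- real n})" for i j
  proof (rule finite_measure.finite_Lim_measure_decseq[OF D_measures(2)[OF D]])
    show "range (\<lambda>n. {..<- real n}) \<subseteq> sets (\<nu> i j)" unfolding D_measures(1)[OF D] sets_restrict_space
      by (auto intro!: image_eqI[of _ _ "{..<- real _}"])
  qed (auto simp: decseq_def)
  moreover have "(\<Inter>n. {..<- real n}) = {}"
  proof -
    have "\<exists>n. \<not> x < - real n" for x
      using real_arch_simple[of "- x"] by (metis le_minus_iff minus_le_iff not_less)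
    then show ?thesis by auto
  qed
  ultimately have "(\<lambda>n. \<Sum>j\<in>UNIV. measure (\<nu> i j) {..<- real n} * w $ j) \<longlonglongrightarrow> (\<Sum>j\<in>UNIV. 0 * w $ j)" for i
    by (intro tendsto_intros) simp
  then have "\<forall>\<^sub>F n in sequentially. (\<Sum>j\<in>UNIV. measure (\<nu> i j) {..<- real n} * w $ j) < \<epsilon> * w $ i" for i
    using order_tendstoD(2)[of _ 0 sequentially "\<epsilon> * w $ i"] assms w[of i] by simp
  then have "\<forall>\<^sub>F n in sequentially. \<forall>i. (\<Sum>j\<in>UNIV. measure (\<nu> i j) {..<- real n} * w $ j) < \<epsilon> * w $ i"
    by (simp add: eventually_all_finite)
  then obtain n where "\<forall>i. (\<Sum>j\<in>UNIV. measure (\<nu> i j) {..<- real n} * w $ j) < \<epsilon> * w $ i"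
    by (auto simp: eventually_sequentially)
  then show thesis using that[of "real n"] less_imp_le by auto
qed

text \<open>Dominated convergence: the measures are finite and the histories share the bound
  \<open>k\<close>, so pointwise convergence suffices.\<close>

lemma D_tendsto:
  assumes "\<And>n. x n \<in> BB k" "y \<in> BU" "\<And>s. s \<le> 0 \<Longrightarrow> (\<lambda>n. x n s) \<longlonglongrightarrow> y s"
  shows "(\<lambda>n. D (x n)) \<longlonglongrightarrow> D y"
proof (rule vec_tendstoI)
  fix i
  have x: "x n \<in> BU" for n using assms by (simp add: BB_iff)
  have "(\<lambda>n. LINT s|\<nu> i j. x n s $ j) \<longlonglongrightarrow> (LINT s|\<nu> i j. y s $ j)" for j
  proof (rule integral_dominated_convergence[where w = "\<lambda>_. k"])
    show "(\<lambda>s. y s $ j) \<in> borel_measurable (\<nu> i j)" "(\<lambda>s. x n s $ j) \<in> borel_measurable (\<nu> i j)" for n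
      by (intro D_measures(5)[OF D] BU_component assms x)+
    show "integrable (\<nu> i j) (\<lambda>_. k)" by (rule D_measures(6)[OF D, where b = "\<bar>k\<bar>"]) auto
    show "AE s in \<nu> i j. (\<lambda>n. x n s $ j) \<longlonglongrightarrow> y s $ j"
      using assms(3) D_measures(4)[OF D] by (auto intro!: AE_I2 tendsto_vec_nth)
    show "AE s in \<nu> i j. norm (x n s $ j) \<le> k" for n
      using assms(1) D_measures(4)[OF D] by (auto intro!: AE_I2 simp: BB_iff infnorm_le_iff)
  qed
  then show "(\<lambda>n. D (x n) $ i) \<longlonglongrightarrow> D y $ i"
    unfolding D_nth[OF D x] D_nth[OF D assms(2)]
    using assms(3)[of 0] by (intro tendsto_intros) auto
qed

end

section \<open>Upper bounds for the exponential orders\<close>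

text \<open>In coordinate \<open>i\<close>, \<open>\<phi> x *\<^sub>R e + p x\<close> has slope at
  least \<open>\<phi>' x * e $ i - L x\<close>, up to an arbitrarily small error, and its image
  under \<open>A\<close> is at most \<open>\<phi> x * (A *v e) $ i + M * L x\<close>. Condition
  \<open>dom\<close> says that the first exceeds the second. \<open>L\<close> varies with time
  because \<open>p\<close> will be small only in the recent past.\<close>

lemma mexp_mult_le_of_dominating:
  fixes A :: "real^'m^'m::finite" and p :: "real \<Rightarrow> real^'m"
  assumes A: "offdiag_nonneg A" and st: "s \<le> t" and cont: "continuous_on {s..t} p"
    and e: "\<And>i. 0 < e $ i" and M: "\<And>i. (\<Sum>j\<in>UNIV. \<bar>A $ i $ j\<bar>) \<le> M"
    and \<phi>: "\<And>x. (\<phi> has_real_derivative \<phi>' x) (at x)"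
    and p: "\<And>x j. s \<le> x \<Longrightarrow> x < t \<Longrightarrow> \<bar>p x $ j\<bar> \<le> L x"
    and lip: "\<And>x j. s \<le> x \<Longrightarrow> x < t \<Longrightarrow> \<forall>\<^sub>F h in at_right 0. \<bar>p (x + h) $ j - p x $ j\<bar> \<le> L x * h"
    and dom: "\<And>x i. s \<le> x \<Longrightarrow> x < t \<Longrightarrow> (1 + M) * L x < \<phi>' x * e $ i - \<phi> x * (A *v e) $ i"
  shows "mexp ((t - s) *\<^sub>R A) *v (\<phi> s *\<^sub>R e + p s) \<le> \<phi> t *\<^sub>R e + p t"
proof (rule mexp_mult_le_of_slope[OF A st])
  have "continuous_on {s..t} \<phi>"
    using DERIV_isCont[OF \<phi>] by (simp add: continuous_at_imp_continuous_on)
  then show "continuous_on {s..t} (\<lambda>t. \<phi> t *\<^sub>R e + p t)" by (intro continuous_intros cont)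
  fix x i assume x: "s \<le> x" "x < t"
  have Lx: "0 \<le> L x" using p[OF x, of i] by linarith
  have "\<bar>(A *v p x) $ i\<bar> \<le> (\<Sum>j\<in>UNIV. \<bar>A $ i $ j\<bar> * L x)"
    unfolding matrix_vector_nth using p[OF x]
    by (intro order_trans[OF sum_abs] sum_mono) (auto simp: abs_mult intro: mult_left_mono)
  also have "\<dots> \<le> M * L x" unfolding sum_distrib_right[symmetric] by (intro mult_right_mono M Lx)
  finally have Ap: "(A *v p x) $ i \<le> M * L x" by simp
  have Aq: "(A *v (\<phi> x *\<^sub>R e + p x)) $ i = \<phi> x * (A *v e) $ i + (A *v p x) $ i"
    by (simp add: matrix_vector_right_distrib matrix_vector_mult_scaleR)
  \<comment> \<open>\<open>g\<close> is the margin in \<open>dom\<close>. Half of it is spent on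
    replacing the derivative of \<open>\<phi>\<close> by difference quotients, the other half keeps
    the inequality strict.\<close>
  define g where "g = \<phi>' x * e $ i - \<phi> x * (A *v e) $ i - (1 + M) * L x"
  define \<kappa> where "\<kappa> = g / 2 / e $ i"
  have g: "0 < g" using dom[OF x, of i] by (simp add: g_def)
  have \<kappa>: "0 < \<kappa>" "\<kappa> * e $ i = g / 2" using g e[of i] by (auto simp: \<kappa>_def)
  define m where "m = (\<phi>' x - \<kappa>) * e $ i - L x"
  show "\<exists>m > (A *v (\<phi> x *\<^sub>R e + p x)) $ i.
      \<forall>\<^sub>F h in at_right 0. (\<phi> x *\<^sub>R e + p x) $ i + h * m \<le> (\<phi> (x + h) *\<^sub>R e + p (x + h)) $ i"
  proof (intro exI conjI)
    show "(A *v (\<phi> x *\<^sub>R e + p x)) $ i < m"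
      using Ap g \<kappa>(2) unfolding Aq m_def g_def by (simp add: algebra_simps)
    have "((\<lambda>h. (\<phi> (x + h) - \<phi> x) / h) \<longlongrightarrow> \<phi>' x) (at_right 0)"
      using \<phi>[of x] unfolding DERIV_def by (rule filterlim_mono) (auto simp: at_within_le_at)
    from order_tendstoD(1)[OF this, of "\<phi>' x - \<kappa>"] \<kappa>(1)
    have "\<forall>\<^sub>F h in at_right 0. \<phi>' x - \<kappa> < (\<phi> (x + h) - \<phi> x) / h" by simp
    from this lip[OF x, of i] eventually_at_right_less[of "0::real"]
    show "\<forall>\<^sub>F h in at_right 0. (\<phi> x *\<^sub>R e + p x) $ i + h * m \<le> (\<phi> (x + h) *\<^sub>R e + p (x + h)) $ i"
    proof eventually_elim
      case (elim h)
      then have "(\<phi>' x - \<kappa>) * h \<le> \<phi> (x + h) - \<phi> x" by (simp add: pos_less_divide_eq)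
      then have "(\<phi>' x - \<kappa>) * h * e $ i \<le> (\<phi> (x + h) - \<phi> x) * e $ i"
        using e[of i] by (intro mult_right_mono) auto
      then show ?case using elim(2) by (simp add: m_def algebra_simps)
    qed
  qed
qed

lemma matrix_row_sum_bound:
  fixes A :: "real^'m^'m::finite"
  obtains M where "0 \<le> M" "\<And>i. (\<Sum>j\<in>UNIV. \<bar>A $ i $ j\<bar>) \<le> M"
proof
  show "0 \<le> (\<Sum>i\<in>UNIV. \<Sum>j\<in>UNIV. \<bar>A $ i $ j\<bar>)" by (simp add: sum_nonneg)
  show "(\<Sum>j\<in>UNIV. \<bar>A $ i $ j\<bar>) \<le> (\<Sum>i\<in>UNIV. \<Sum>j\<in>UNIV. \<bar>A $ i $ j\<bar>)" for i
    by (rule member_le_sum[of i UNIV "\<lambda>i. \<Sum>j\<in>UNIV. \<bar>A $ i $ j\<bar>"]) (auto simp: sum_nonneg)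
qed

text \<open>Apply the dichotomy to \<open>A - l *\<^sub>R mat 1\<close>. Beyond the row sums of
  \<open>A\<close> the constant vector is a strict subsolution, and a kernel vector would be a real
  eigenvector for some eigenvalue \<open>l \<ge> 0\<close>.\<close>

lemma eigenvalues_neg_subsolution:
  fixes A :: "real^'m^'m::finite"
  assumes A: "offdiag_nonneg A" and ev: "eigenvalues_neg A"
  obtains e where "\<And>i. 0 < e $ i" "\<And>i. (A *v e) $ i < 0"
proof -
  obtain M where M: "0 \<le> M" "\<And>i. (\<Sum>j\<in>UNIV. \<bar>A $ i $ j\<bar>) \<le> M" using matrix_row_sum_bound[of A] by metis
  have mult: "((A - l *\<^sub>R mat 1) *v v) $ i = (A *v v) $ i - l * v $ i" for l v i
    by (simp add: matrix_vector_mult_diff_rdistrib scaleR_matrix_vector_assoc[symmetric])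
  have "(\<exists>e. (\<forall>i. 0 < e $ i) \<and> (\<forall>i. ((A - 0 *\<^sub>R mat 1) *v e) $ i < 0))
    \<or> (\<exists>l\<ge>0. \<exists>v. 0 \<le> v \<and> v \<noteq> 0 \<and> (A - l *\<^sub>R mat 1) *v v = 0)"
  proof (rule strict_subsolution_or_kernel)
    show "continuous_on {0..} (\<lambda>l. A - l *\<^sub>R mat 1)" by (intro continuous_intros)
    show "offdiag_nonneg (A - l *\<^sub>R mat 1)" for l using A by (simp add: offdiag_nonneg_def mat_def)
    show "((A - (M + 1) *\<^sub>R mat 1) *v 1) $ i < 0" for i
    proof -
      have "(A *v 1) $ i \<le> (\<Sum>j\<in>UNIV. \<bar>A $ i $ j\<bar>)" unfolding matrix_vector_nth by (intro sum_mono) auto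
      then show ?thesis using M(2)[of i] by (simp add: mult)
    qed
  qed (use M in auto)
  moreover have "\<not> (\<exists>l\<ge>0. \<exists>v. 0 \<le> v \<and> v \<noteq> 0 \<and> (A - l *\<^sub>R mat 1) *v v = 0)"
  proof (intro notI, elim exE conjE)
    fix l :: real and v assume l: "0 \<le> l" and v: "v \<noteq> 0" "(A - l *\<^sub>R mat 1) *v v = 0"
    define c :: "complex^'m" where "c = (\<chi> i. complex_of_real (v $ i))"
    have "(A *v v) $ i = l * v $ i" for i using mult[of l v i] v(2) by simp
    then have "complex_of_real (\<Sum>j\<in>UNIV. A $ i $ j * v $ j) = complex_of_real (l * v $ i)" for i
      unfolding matrix_vector_nth by simp
    then have "(\<chi> i j. complex_of_real (A $ i $ j)) *v c = complex_of_real l *s c"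
      by (simp add: vec_eq_iff c_def matrix_vector_mult_def)
    moreover have "c \<noteq> 0" using v(1) by (simp add: vec_eq_iff c_def)
    ultimately have "Re (complex_of_real l) < 0" using ev unfolding eigenvalues_neg_def by blast
    then show False using l by simp
  qed
  ultimately show thesis using that by auto
qed

text \<open>With \<open>p = (x - y) / 2\<close>, a \<open>\<zeta>\<close> as in \<open>small_bound\<close> makes \<open>(x + y) / 2 + \<zeta>\<close> an upper bound of
  \<open>x\<close> and \<open>y\<close>, close to them on \<open>[-n, 0]\<close>. The bound \<open>k\<close> must not depend on how close, since the
  \<open>\<delta>\<close> of the stability notions depends on the ball \<open>B\<^sub>k\<close>.\<close>

definition locally_small :: "real \<Rightarrow> real \<Rightarrow> real \<Rightarrow> ('m::finite) hist \<Rightarrow> bool" where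
  "locally_small B N \<eta> p \<longleftrightarrow> ucb 0 p
     \<and> (\<forall>s\<le>0. norm (p s) \<le> B \<and> (\<forall>h. 0 \<le> h \<longrightarrow> norm (p s - p (s - h)) \<le> B * h))
     \<and> (\<forall>s\<in>{- N..0}. norm (p s) \<le> \<eta> \<and> (\<forall>h. 0 \<le> h \<longrightarrow> h \<le> 1 \<longrightarrow> norm (p s - p (s - h)) \<le> \<eta> * h))"

definition small_bound :: "(('m::finite) hist \<Rightarrow> 'm hist \<Rightarrow> bool) \<Rightarrow> real \<Rightarrow> nat \<Rightarrow> real \<Rightarrow> 'm hist \<Rightarrow> 'm hist \<Rightarrow> bool" where
  "small_bound le k n \<epsilon> p \<zeta> \<longleftrightarrow> ucb 0 \<zeta> \<and> (\<forall>s\<le>0. infnorm (\<zeta> s) \<le> k) \<and> (\<forall>s\<in>{- real n..0}. infnorm (\<zeta> s) \<le> \<epsilon>)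
     \<and> le (\<lambda>_. 0) (\<lambda>s. \<zeta> s + p s) \<and> le (\<lambda>_. 0) (\<lambda>s. \<zeta> s - p s)"

definition has_upper_bounds :: "(('m::finite) hist \<Rightarrow> 'm hist \<Rightarrow> bool) \<Rightarrow> bool" where
  "has_upper_bounds le \<longleftrightarrow> (\<forall>B>0. \<exists>k. \<forall>n \<epsilon>. 0 < \<epsilon> \<longrightarrow>
     (\<exists>N \<eta>. 0 < \<eta> \<and> 0 \<le> N \<and> (\<forall>p. locally_small B N \<eta> p \<longrightarrow> (\<exists>\<zeta>. small_bound le k n \<epsilon> p \<zeta>))))"

lemma eventually_at_right_lipschitz:
  fixes p :: "real \<Rightarrow> real^'m::finite"
  assumes "x < 0" "\<And>h. 0 \<le> h \<Longrightarrow> h \<le> 1 \<Longrightarrow> x + h \<le> 0 \<Longrightarrow> norm (p (x + h) - p x) \<le> L * h"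
  shows "\<forall>\<^sub>F h in at_right 0. \<bar>p (x + h) $ j - p x $ j\<bar> \<le> L * h"
proof -
  have "\<forall>\<^sub>F h in at_right 0. h < min 1 (- x)" using assms(1) unfolding eventually_at_right_field
    by (intro exI[of _ "min 1 (- x)"]) auto
  from this eventually_at_right_less[of "0::real"] show ?thesis
  proof eventually_elim
    case (elim h)
    then show ?case using assms(2)[of h] component_le_norm_cart[of "p (x + h) - p x" j] by simp
  qed
qed

section \<open>Upper bounds for the order with finite memory\<close>

text \<open>On the bounded window \<open>{- r..0}\<close> an exponential weight may grow faster than
  the row sums of \<open>A\<close> allow the solutions to grow, at the price of the factor
  \<open>exp ((M + 1) * r)\<close>.\<close>

lemma has_upper_bounds_le_fin:
  fixes A :: "real^'m^'m::finite"
  assumes A: "offdiag_nonneg A" and r: "0 < r"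
  shows "has_upper_bounds (le_fin A r)"
  unfolding has_upper_bounds_def
proof (intro allI impI)
  fix B :: real assume B: "0 < B"
  obtain M where M: "0 \<le> M" "\<And>i. (\<Sum>j\<in>UNIV. \<bar>A $ i $ j\<bar>) \<le> M" using matrix_row_sum_bound[of A] by metis
  \<comment> \<open>The maximum over the half-line of the weight \<open>\<phi>0\<close> below,
    divided by \<open>\<eta>\<close>.\<close>
  define c where "c = (2 + M) * exp ((M + 1) * r)"
  have c: "2 + M \<le> c" "0 < c" using M(1) r by (auto simp: c_def mult_le_cancel_left1)
  show "\<exists>k. \<forall>n \<epsilon>. 0 < \<epsilon> \<longrightarrow> (\<exists>N \<eta>. 0 < \<eta> \<and> 0 \<le> N \<and>
      (\<forall>p. locally_small B N \<eta> p \<longrightarrow> (\<exists>\<zeta>. small_bound (le_fin A r) k n \<epsilon> p \<zeta>)))"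
  proof (rule exI[of _ "c + B"], intro allI impI)
    fix n :: nat and \<epsilon> :: real assume \<epsilon>: "0 < \<epsilon>"
    define \<eta> where "\<eta> = min 1 (\<epsilon> / c)"
    have \<eta>: "0 < \<eta>" "\<eta> \<le> 1" "c * \<eta> \<le> \<epsilon>" using \<epsilon> c by (auto simp: \<eta>_def min_def field_simps)
    \<comment> \<open>Smallness of \<open>p\<close> is needed on the interval where closeness is
      asked and on the memory window of the order.\<close>
    define N where "N = max (real n) r"
    show "\<exists>N \<eta>. 0 < \<eta> \<and> 0 \<le> N \<and>
      (\<forall>p. locally_small B N \<eta> p \<longrightarrow> (\<exists>\<zeta>. small_bound (le_fin A r) (c + B) n \<epsilon> p \<zeta>))"
    proof (rule exI[of _ N], rule exI[of _ \<eta>], intro conjI allI impI)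
      fix p :: "real \<Rightarrow> real^'m" assume "locally_small B N \<eta> p"
      then have ucb: "ucb 0 p"
        and pB: "\<forall>s\<le>0. norm (p s) \<le> B \<and> (\<forall>h. 0 \<le> h \<longrightarrow> norm (p s - p (s - h)) \<le> B * h)"
        and p\<eta>: "\<forall>s\<in>{- N..0}. norm (p s) \<le> \<eta> \<and> (\<forall>h. 0 \<le> h \<longrightarrow> h \<le> 1 \<longrightarrow> norm (p s - p (s - h)) \<le> \<eta> * h)"
        by (auto simp: locally_small_def)
      \<comment> \<open>The rate \<open>M + 1\<close> exceeds the row sums by 1, so the slope of the
        weight beats \<open>A\<close> by at least \<open>\<phi>0\<close> itself. From
        \<open>- r\<close> on this is at least \<open>(2 + M) * \<eta>\<close>, more than the
        \<open>(1 + M) * \<eta>\<close> required by domination.\<close>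
      define \<phi>0 where "\<phi>0 t = \<eta> * (2 + M) * exp ((M + 1) * (t + r))" for t
      \<comment> \<open>Before \<open>- r\<close> the order asks only for
        \<open>\<zeta> s + p s\<close> and \<open>\<zeta> s - p s\<close> to be nonnegative, which
        the second argument of the maximum ensures. On the window the first argument wins, so the
        exponential inequality is undisturbed.\<close>
      define \<phi> where "\<phi> t = max (\<phi>0 t) (infnorm (p t))" for t
      define \<zeta> where "\<zeta> t = \<phi> t *\<^sub>R (1::real^'m)" for t
      have \<phi>0c: "\<phi>0 t \<le> c * \<eta>" if "t \<le> 0" for t
      proof -
        have "exp ((M + 1) * (t + r)) \<le> exp ((M + 1) * r)" using M(1) that by (simp add: mult_left_mono)
        then have "\<eta> * (2 + M) * exp ((M + 1) * (t + r)) \<le> \<eta> * (2 + M) * exp ((M + 1) * r)"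
          using \<eta>(1) M(1) by (intro mult_left_mono) auto
        then show ?thesis by (simp add: \<phi>0_def c_def mult_ac)
      qed
      have \<phi>0_ge: "(2 + M) * \<eta> \<le> \<phi>0 t" if "- r \<le> t" for t
        using that M(1) \<eta>(1) by (simp add: \<phi>0_def mult.commute[of \<eta>])
      have inf_eta: "infnorm (p s) \<le> \<eta>" if "s \<in> {- N..0}" for s
        using p\<eta> that infnorm_le_norm order_trans by blast
      have \<phi>_eq: "\<phi> t = \<phi>0 t" if "t \<in> {- r..0}" for t
      proof -
        have "infnorm (p t) \<le> \<eta>" using that by (intro inf_eta) (auto simp: N_def)
        also have "\<dots> \<le> (2 + M) * \<eta>" using M(1) \<eta>(1) by simp
        also have "\<dots> \<le> \<phi>0 t" using that by (intro \<phi>0_ge) auto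
        finally show ?thesis by (simp add: \<phi>_def)
      qed
      have inf\<zeta>: "infnorm (\<zeta> s) = \<phi> s" for s
      proof -
        have "infnorm (1::real^'m) = 1"
          by (rule antisym) (use component_le_infnorm_cart[of "1::real^'m"] in \<open>auto simp: infnorm_le_iff\<close>)
        moreover have "0 \<le> \<phi> s" by (simp add: \<phi>_def infnorm_pos_le le_max_iff_disj)
        ultimately show ?thesis by (simp add: \<zeta>_def infnorm_mul)
      qed
      have nonneg: "0 \<le> \<zeta> s + p s" "0 \<le> \<zeta> s - p s" for s
        using component_le_infnorm_cart[of "p s"]
        by (auto simp: less_eq_vec_def \<zeta>_def \<phi>_def abs_le_iff intro: max.coboundedI2 order_trans)
          (smt (verit) max.cobounded2)+
      have key: "mexp ((t - s) *\<^sub>R A) *v (\<zeta> s + p' s) \<le> \<zeta> t + p' t"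
        if st: "- r \<le> s" "s \<le> t" "t \<le> 0" and p': "p' = p \<or> p' = (\<lambda>s. - p s)" for s t p'
      proof -
        have "mexp ((t - s) *\<^sub>R A) *v (\<phi>0 s *\<^sub>R 1 + p' s) \<le> \<phi>0 t *\<^sub>R 1 + p' t"
        proof (rule mexp_mult_le_of_dominating[OF A st(2) _ _ M(2), where L = "\<lambda>_. \<eta>" and \<phi>' = "\<lambda>t. (M + 1) * \<phi>0 t"])
          have "continuous_on {s..t} p"
            using ucb st by (auto simp: ucb_def intro!: continuous_on_subset[OF uniformly_continuous_imp_continuous])
          then show "continuous_on {s..t} p'" using p' by (auto intro: continuous_intros)
          show "(\<phi>0 has_real_derivative (M + 1) * \<phi>0 x) (at x)" for x
            unfolding \<phi>0_def by (auto intro!: derivative_eq_intros)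
          fix x and i :: 'm assume x: "s \<le> x" "x < t"
          have xN: "x \<in> {- N..0}" using x st by (auto simp: N_def)
          have "\<bar>p x $ i\<bar> \<le> \<eta>" using p\<eta> xN component_le_norm_cart order_trans by blast
          then show "\<bar>p' x $ i\<bar> \<le> \<eta>" using p' by auto
          have "\<forall>\<^sub>F h in at_right 0. \<bar>p' (x + h) $ i - p' x $ i\<bar> \<le> \<eta> * h"
          proof (rule eventually_at_right_lipschitz)
            fix h :: real assume h: "0 \<le> h" "h \<le> 1" "x + h \<le> 0"
            have "x + h \<in> {- N..0}" using h xN by auto
            then have "norm (p (x + h) - p (x + h - h)) \<le> \<eta> * h" using p\<eta> h(1,2) by blast
            then show "norm (p' (x + h) - p' x) \<le> \<eta> * h" using p' by (auto simp: norm_minus_commute)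
          qed (use x st in simp)
          then show "\<forall>\<^sub>F h in at_right 0. \<bar>p' (x + h) $ i - p' x $ i\<bar> \<le> \<eta> * h" .
          have "(A *v 1) $ i \<le> (\<Sum>j\<in>UNIV. \<bar>A $ i $ j\<bar>)" unfolding matrix_vector_nth by (intro sum_mono) auto
          then have "(A *v 1) $ i \<le> M" using M(2)[of i] by linarith
          moreover have ge: "(2 + M) * \<eta> \<le> \<phi>0 x" using x st by (intro \<phi>0_ge) auto
          moreover have "0 \<le> \<phi>0 x" using M(1) \<eta>(1) by (simp add: \<phi>0_def)
          ultimately have "\<phi>0 x * (A *v 1) $ i \<le> \<phi>0 x * M" by (intro mult_left_mono)
          then show "(1 + M) * \<eta> < (M + 1) * \<phi>0 x * 1 $ i - \<phi>0 x * (A *v 1) $ i"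
            using ge \<eta>(1) by (simp add: algebra_simps)
        qed simp
        then show ?thesis using \<phi>_eq[of s] \<phi>_eq[of t] st by (simp add: \<zeta>_def)
      qed
      have "le_fin A r (\<lambda>_. 0) (\<lambda>s. \<zeta> s + p s)" "le_fin A r (\<lambda>_. 0) (\<lambda>s. \<zeta> s - p s)"
        unfolding le_fin_def using nonneg key[of _ _ p] key[of _ _ "\<lambda>s. - p s"] by auto
      moreover have "infnorm (\<zeta> s) \<le> c + B" if "s \<le> 0" for s
      proof -
        have "\<phi>0 s \<le> c" using \<phi>0c[OF that] mult_left_mono[OF \<eta>(2), of c] c(2) by linarith
        moreover have "infnorm (p s) \<le> B" using pB that infnorm_le_norm order_trans by blast
        ultimately show ?thesis unfolding inf\<zeta> \<phi>_def using B c(2) by simp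
      qed
      moreover have "infnorm (\<zeta> s) \<le> \<epsilon>" if "s \<in> {- real n..0}" for s
      proof -
        have "infnorm (p s) \<le> \<eta>" using that by (intro inf_eta) (auto simp: N_def)
        also have "\<eta> \<le> c * \<eta>" using c M(1) \<eta>(1) by simp
        finally show ?thesis unfolding inf\<zeta> \<phi>_def using \<phi>0c[of s] that \<eta>(3) by auto
      qed
      moreover have "ucb 0 \<zeta>"
      proof -
        have 1: "uniformly_continuous_on {..0} \<phi>0"
        proof -
          \<comment> \<open>\<open>ucb_exp\<close> speaks of vectors; the scalar weight is recovered
            as the component at an arbitrary index, here \<open>undefined\<close>.\<close>
          have "(\<lambda>t. (exp ((M + 1) * t) *\<^sub>R axis undefined (\<eta> * (2 + M) * exp ((M + 1) * r)) :: real^'m) $ undefined) = \<phi>0"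
            by (simp add: \<phi>0_def fun_eq_iff distrib_left exp_add axis_def)
          moreover have "uniformly_continuous_on {..0} (\<lambda>t. (exp ((M + 1) * t) *\<^sub>R axis undefined (\<eta> * (2 + M) * exp ((M + 1) * r)) :: real^'m) $ undefined)"
            using ucb_exp[of "M + 1" 0] M(1) unfolding ucb_def
            by (intro bounded_linear.uniformly_continuous_on[OF bounded_linear_vec_nth]) auto
          ultimately show ?thesis by simp
        qed
        have 2: "uniformly_continuous_on {..0} \<zeta>"
          unfolding uniformly_continuous_on_def
        proof (intro allI impI)
          fix e :: real assume e: "0 < e"
          define e' where "e' = e / (2 * CARD('m))"
          have e': "0 < e'" "CARD('m) * e' < e" using e by (auto simp: e'_def)
          obtain d1 where d1: "d1 > 0" "\<forall>x\<in>{..0}. \<forall>y\<in>{..0}. dist y x < d1 \<longrightarrow> dist (\<phi>0 y) (\<phi>0 x) < e'"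
            using 1 e'(1) unfolding uniformly_continuous_on_def by blast
          obtain d2 where d2: "d2 > 0" "\<forall>x\<in>{..0}. \<forall>y\<in>{..0}. dist y x < d2 \<longrightarrow> dist (p y) (p x) < e'"
            using ucb e'(1) unfolding ucb_def uniformly_continuous_on_def by blast
          have "dist (\<zeta> y) (\<zeta> x) < e" if "x \<le> 0" "y \<le> 0" "dist y x < min d1 d2" for x y
          proof -
            have "\<bar>\<phi>0 y - \<phi>0 x\<bar> < e'" using d1(2) that by (auto simp: dist_real_def)
            moreover have "norm (p y - p x) < e'" using d2(2) that by (auto simp: dist_norm)
            moreover have "\<bar>infnorm (p y) - infnorm (p x)\<bar> \<le> norm (p y - p x)"
              using absdiff_infnorm infnorm_le_norm order_trans by blast
            ultimately have "\<bar>\<phi> y - \<phi> x\<bar> < e'" unfolding \<phi>_def by linarith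
            moreover have "infnorm (\<zeta> y - \<zeta> x) \<le> \<bar>\<phi> y - \<phi> x\<bar>" by (simp add: infnorm_le_iff \<zeta>_def)
            ultimately have "CARD('m) * infnorm (\<zeta> y - \<zeta> x) \<le> CARD('m) * e'" by (intro mult_left_mono) auto
            then show ?thesis using norm_le_card_infnorm[of "\<zeta> y - \<zeta> x"] e'(2) unfolding dist_norm by linarith
          qed
          then show "\<exists>d>0. \<forall>x\<in>{..0}. \<forall>y\<in>{..0}. dist y x < d \<longrightarrow> dist (\<zeta> y) (\<zeta> x) < e"
            using d1(1) d2(1) by (intro exI[of _ "min d1 d2"]) auto
        qed
        have "norm (\<zeta> s) \<le> CARD('m) * (c + B)" if "s \<le> 0" for s
          using calculation(3)[OF that] by (intro order_trans[OF norm_le_card_infnorm mult_left_mono]) auto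
        then show ?thesis using 2 unfolding ucb_def bounded_iff by auto
      qed
      ultimately show "\<exists>\<zeta>. small_bound (le_fin A r) (c + B) n \<epsilon> p \<zeta>"
        unfolding small_bound_def by blast
    qed (use \<eta> N_def in auto)
  qed
qed

section \<open>Upper bounds for the order with infinite memory\<close>

text \<open>\<open>\<psi>\<close> is a smooth substitute for the minimum of 1 and
  \<open>exp (- \<beta> * (t + N))\<close>. It solves the logistic equation with derivative
  \<open>- \<beta> * \<psi> t * (1 - \<psi> t)\<close>, and both bounds follow from its values lying
  in \<open>{0..1}\<close>.\<close>

lemma logistic_derivative_bound:
  fixes \<beta> N :: real
  assumes "0 < \<beta>"
  defines "\<psi> \<equiv> \<lambda>t. 1 / (1 + exp (\<beta> * (t + N)))"
  obtains \<psi>' where "\<And>t. (\<psi> has_real_derivative \<psi>' t) (at t)" "\<And>t. - \<beta> * \<psi> t \<le> \<psi>' t" "\<And>t. \<bar>\<psi>' t\<bar> \<le> \<beta>"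
proof
  let ?E = "\<lambda>t. exp (\<beta> * (t + N))"
  have pos: "0 < 1 + ?E t" for t by (simp add: add_pos_pos)
  show "(\<psi> has_real_derivative - (?E t * \<beta>) / (1 + ?E t)^2) (at t)" for t
    unfolding \<psi>_def using pos[of t]
    by (auto intro!: derivative_eq_intros simp: power2_eq_square)
  have frac: "?E t / (1 + ?E t) \<le> 1" "0 \<le> ?E t / (1 + ?E t)" "0 \<le> \<psi> t" "\<psi> t \<le> 1" for t
    using pos[of t] by (simp_all add: \<psi>_def)
  have eq: "- (?E t * \<beta>) / (1 + ?E t)^2 = - (\<beta> * \<psi> t) * (?E t / (1 + ?E t))" for t
    by (simp add: \<psi>_def power2_eq_square)
  show "- \<beta> * \<psi> t \<le> - (?E t * \<beta>) / (1 + ?E t)^2" for t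
    unfolding eq using mult_left_mono[OF frac(1), of "\<beta> * \<psi> t" t] frac(3)[of t] assms(1) by simp
  show "\<bar>- (?E t * \<beta>) / (1 + ?E t)^2\<bar> \<le> \<beta>" for t
  proof -
    have "\<psi> t * (?E t / (1 + ?E t)) \<le> 1 * 1" using frac[of t] by (intro mult_mono) auto
    then have "\<beta> * (\<psi> t * (?E t / (1 + ?E t))) \<le> \<beta> * 1" using assms(1) by (intro mult_left_mono) auto
    moreover have "0 \<le> \<beta> * (\<psi> t * (?E t / (1 + ?E t)))" using frac[of t] assms(1) by (intro mult_nonneg_nonneg) auto
    ultimately show ?thesis unfolding eq by (simp add: mult.assoc)
  qed
qed

text \<open>The scalar weight decays exponentially on \<open>[-N, 0]\<close>, where \<open>p\<close> is small, and absorbs the bound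
  \<open>B\<close> of \<open>p\<close> before \<open>-N\<close>. Since its decay rate is slower than that of \<open>A\<close> it dominates.\<close>

lemma has_upper_bounds_le_inf:
  fixes A :: "real^'m^'m::finite"
  assumes A: "offdiag_nonneg A" and "eigenvalues_neg A"
  shows "has_upper_bounds (le_inf A)"
  unfolding has_upper_bounds_def
proof (intro allI impI)
  fix B :: real assume B: "0 < B"
  obtain M where M: "0 \<le> M" "\<And>i. (\<Sum>j\<in>UNIV. \<bar>A $ i $ j\<bar>) \<le> M" using matrix_row_sum_bound[of A] by metis
  obtain e where e: "\<And>i. 0 < e $ i" "\<And>i. (A *v e) $ i < 0"
    using eigenvalues_neg_subsolution[OF assms] by metis
  define e0 where "e0 = Min (range (($) e))"
  have e0: "e0 \<le> e $ i" for i unfolding e0_def by (rule Min_le) auto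
  have e00: "0 < e0" unfolding e0_def using e(1) by (subst Min_gr_iff) auto
  define e1 where "e1 = infnorm e"
  have e1: "e $ i \<le> e1" for i using component_le_infnorm_cart[of e i] by (simp add: e1_def)
  have e10: "0 < e1" using e1[of undefined] e(1)[of undefined] by linarith
  \<comment> \<open>The largest rate with \<open>A *v e \<le> - \<alpha> *\<^sub>R e\<close>: the
    decay that \<open>A\<close> grants in direction \<open>e\<close>.\<close>
  define \<alpha> where "\<alpha> = Min (range (\<lambda>i. - (A *v e) $ i / e $ i))"
  have \<alpha>0: "0 < \<alpha>" unfolding \<alpha>_def using e by (subst Min_gr_iff) (auto simp: divide_neg_pos)
  have \<alpha>: "(A *v e) $ i \<le> - \<alpha> * e $ i" for i
  proof -
    have "\<alpha> \<le> - (A *v e) $ i / e $ i" unfolding \<alpha>_def by (rule Min_le) auto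
    then have "\<alpha> * e $ i \<le> - (A *v e) $ i" unfolding pos_le_divide_eq[OF e(1)] .
    then show ?thesis by simp
  qed
  \<comment> \<open>The first term serves the slope condition: a factor 2 comes from bounding
    \<open>L\<close> by the weight, another 2 from halving the rate \<open>\<alpha>\<close>, and 5
    instead of 4 gives strictness. The second term makes \<open>\<zeta>\<close> dominate
    \<open>p\<close>.\<close>
  define c where "c = 5 * (1 + M) / (\<alpha> * e0) + 2 / e0"
  have c0: "0 < c" using M(1) \<alpha>0 e00 by (simp add: c_def add_pos_pos)
  have c1: "4 * (1 + M) < c * \<alpha> * e $ i" and c2: "2 \<le> c * e $ i" for i
  proof -
    have "4 * (1 + M) < 5 * (1 + M)" using M(1) by simp
    also have "\<dots> = 5 * (1 + M) / (\<alpha> * e0) * (\<alpha> * e0)" using \<alpha>0 e00 by simp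
    also have "\<dots> \<le> c * (\<alpha> * e $ i)"
      using M(1) \<alpha>0 e00 e0[of i] c0 by (intro mult_mono) (auto simp: c_def)
    finally show "4 * (1 + M) < c * \<alpha> * e $ i" by (simp add: mult.assoc)
    have "2 = 2 / e0 * e0" using e00 by simp
    also have "\<dots> \<le> c * e $ i" using M(1) \<alpha>0 e00 e0[of i] c0 by (intro mult_mono) (auto simp: c_def)
    finally show "2 \<le> c * e $ i" .
  qed
  \<comment> \<open>Half of the decay rate is given to the weight; the other half remains to
    dominate \<open>p\<close>.\<close>
  define \<beta> where "\<beta> = \<alpha> / 2"
  have \<beta>0: "0 < \<beta>" using \<alpha>0 by (simp add: \<beta>_def)
  \<comment> \<open>Since \<open>\<eta> \<le> 1\<close> and \<open>\<psi> t \<le> 1\<close>, the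
    bound involves neither \<open>N\<close> nor \<open>\<epsilon>\<close>.\<close>
  define k where "k = c * (1 + B) * e1"
  show "\<exists>k. \<forall>n \<epsilon>. 0 < \<epsilon> \<longrightarrow> (\<exists>N \<eta>. 0 < \<eta> \<and> 0 \<le> N \<and>
      (\<forall>p. locally_small B N \<eta> p \<longrightarrow> (\<exists>\<zeta>. small_bound (le_inf A) k n \<epsilon> p \<zeta>)))"
  proof (rule exI[of _ k], intro allI impI)
    fix n :: nat and \<epsilon> :: real assume \<epsilon>: "0 < \<epsilon>"
    define \<eta> where "\<eta> = min 1 (\<epsilon> / (2 * c * e1))"
    have \<eta>: "0 < \<eta>" "\<eta> \<le> 1" using \<epsilon> c0 e10 by (auto simp: \<eta>_def)
    have \<eta>\<epsilon>: "c * \<eta> * e1 \<le> \<epsilon> / 2"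
    proof -
      have "\<eta> \<le> \<epsilon> / (2 * c * e1)" by (simp add: \<eta>_def)
      then show ?thesis using c0 e10 by (simp add: pos_le_divide_eq mult_ac)
    qed
    \<comment> \<open>The waiting time after which the contribution of \<open>B\<close> has decayed
      to \<open>\<epsilon> / 2\<close>. The maximum covers a negative logarithm.\<close>
    define m where "m = max 0 (ln (2 * c * B * e1 / \<epsilon>) / \<beta>)"
    define N where "N = real n + m"
    have N: "0 \<le> N" by (simp add: N_def m_def)
    have far: "c * B * e1 * exp (- \<beta> * m) \<le> \<epsilon> / 2"
    proof -
      have pos: "0 < 2 * c * B * e1 / \<epsilon>" using c0 B e10 \<epsilon> by simp
      have "ln (2 * c * B * e1 / \<epsilon>) \<le> \<beta> * m"
        using \<beta>0 by (simp add: m_def max_def field_simps)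
      then have "2 * c * B * e1 / \<epsilon> \<le> exp (\<beta> * m)" using pos by (metis exp_le_cancel_iff exp_ln)
      then show ?thesis using \<epsilon> by (simp add: exp_minus field_simps)
    qed
    show "\<exists>N \<eta>. 0 < \<eta> \<and> 0 \<le> N \<and>
      (\<forall>p. locally_small B N \<eta> p \<longrightarrow> (\<exists>\<zeta>. small_bound (le_inf A) k n \<epsilon> p \<zeta>))"
    proof (rule exI[of _ N], rule exI[of _ \<eta>], intro conjI allI impI)
      fix p :: "real \<Rightarrow> real^'m" assume "locally_small B N \<eta> p"
      then have ucb: "ucb 0 p"
        and pB: "\<forall>s\<le>0. norm (p s) \<le> B \<and> (\<forall>h. 0 \<le> h \<longrightarrow> norm (p s - p (s - h)) \<le> B * h)"
        and p\<eta>: "\<forall>s\<in>{- N..0}. norm (p s) \<le> \<eta> \<and> (\<forall>h. 0 \<le> h \<longrightarrow> h \<le> 1 \<longrightarrow> norm (p s - p (s - h)) \<le> \<eta> * h)"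
        by (auto simp: locally_small_def)
      define \<psi> where "\<psi> t = 1 / (1 + exp (\<beta> * (t + N)))" for t
      obtain \<psi>' where \<psi>': "\<And>t. (\<psi> has_real_derivative \<psi>' t) (at t)" "\<And>t. - \<beta> * \<psi> t \<le> \<psi>' t" "\<And>t. \<bar>\<psi>' t\<bar> \<le> \<beta>"
        using logistic_derivative_bound[OF \<beta>0, of N] unfolding \<psi>_def[abs_def] by metis
      have \<psi>: "0 \<le> \<psi> t" "\<psi> t \<le> 1" for t
        using add_pos_pos[OF zero_less_one exp_gt_zero, of "\<beta> * (t + N)"] by (simp_all add: \<psi>_def)
      have \<psi>_half: "1 / 2 \<le> \<psi> t" if "t \<le> - N" for t
      proof -
        have "exp (\<beta> * (t + N)) \<le> 1" using \<beta>0 that by (simp add: mult_nonneg_nonpos)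
        then show ?thesis by (simp add: \<psi>_def field_simps add_pos_pos)
      qed
      define \<phi> where "\<phi> t = c * (\<eta> + B * \<psi> t)" for t
      define \<zeta> where "\<zeta> t = \<phi> t *\<^sub>R e" for t
      \<comment> \<open>The local bound for \<open>p\<close> and its slopes jumps at
        \<open>- N\<close>. To the left of the jump \<open>\<psi>\<close> is at least 1/2, so twice
        \<open>\<eta> + B * \<psi> t\<close> still dominates it.\<close>
      define L where "L t = (if - N \<le> t then \<eta> else B)" for t
      have L: "L t \<le> 2 * (\<eta> + B * \<psi> t)" "0 \<le> L t" for t
      proof -
        have "B \<le> 2 * (B * \<psi> t)" if "t < - N"
          using \<psi>_half[of t] that B by simp
        moreover have "0 \<le> B * \<psi> t" using B \<psi>(1)[of t] by simp
        ultimately show "L t \<le> 2 * (\<eta> + B * \<psi> t)" using \<eta>(1) by (cases "- N \<le> t") (simp_all add: L_def)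
        show "0 \<le> L t" using \<eta>(1) B by (simp add: L_def)
      qed
      have \<phi>0: "0 \<le> \<phi> t" for t using c0 \<eta>(1) B \<psi>(1)[of t] by (simp add: \<phi>_def)
      have pL: "\<bar>p t $ i\<bar> \<le> L t" if "t \<le> 0" for t i
        using pB p\<eta> that component_le_norm_cart[of "p t" i] by (auto simp: L_def intro: order_trans)
      have \<phi>_ge: "\<bar>p t $ i\<bar> \<le> \<phi> t * e $ i" if "t \<le> 0" for t i
      proof -
        have "\<bar>p t $ i\<bar> \<le> 2 * (\<eta> + B * \<psi> t)" using pL[OF that, of i] L(1)[of t] by linarith
        also have "\<dots> \<le> (c * e $ i) * (\<eta> + B * \<psi> t)"
          using c2[of i] \<eta>(1) B \<psi>(1)[of t] by (intro mult_right_mono) auto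
        finally show ?thesis by (simp add: \<phi>_def mult_ac)
      qed
      have key: "mexp ((t - s) *\<^sub>R A) *v (\<zeta> s + p' s) \<le> \<zeta> t + p' t"
        if st: "s \<le> t" "t \<le> 0" and p': "p' = p \<or> p' = (\<lambda>s. - p s)" for s t p'
        unfolding \<zeta>_def
      proof (rule mexp_mult_le_of_dominating[OF A st(1) _ e(1) M(2), where L = L and \<phi>' = "\<lambda>t. c * (B * \<psi>' t)"])
        have "continuous_on {s..t} p"
          using ucb st by (auto simp: ucb_def intro!: continuous_on_subset[OF uniformly_continuous_imp_continuous])
        then show "continuous_on {s..t} p'" using p' by (auto intro: continuous_intros)
        show "(\<phi> has_real_derivative c * (B * \<psi>' x)) (at x)" for x
          unfolding \<phi>_def by (auto intro!: derivative_eq_intros \<psi>')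
        fix x and i :: 'm assume x: "s \<le> x" "x < t"
        show "\<bar>p' x $ i\<bar> \<le> L x" using pL[of x i] p' x st by auto
        show "\<forall>\<^sub>F h in at_right 0. \<bar>p' (x + h) $ i - p' x $ i\<bar> \<le> L x * h"
        proof (rule eventually_at_right_lipschitz)
          fix h :: real assume h: "0 \<le> h" "h \<le> 1" "x + h \<le> 0"
          have "norm (p (x + h) - p (x + h - h)) \<le> B * h" using pB h by blast
          moreover have "norm (p (x + h) - p (x + h - h)) \<le> \<eta> * h" if "- N \<le> x"
          proof -
            have "x + h \<in> {- N..0}" using h that by auto
            then show ?thesis using p\<eta> h(1,2) by blast
          qed
          ultimately have "norm (p (x + h) - p (x + h - h)) \<le> L x * h" by (simp add: L_def)
          then show "norm (p' (x + h) - p' x) \<le> L x * h" using p' by (auto simp: norm_minus_commute)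
        qed (use x st in simp)
        \<comment> \<open>\<open>f\<close> is \<open>\<phi> x / c\<close>. The decay of
          \<open>A\<close> yields \<open>c * f * \<alpha> * e $ i\<close>, the decrease of the
          weight costs at most half of that, and the other half exceeds
          \<open>(1 + M) * L x\<close>.\<close>
        define f where "f = \<eta> + B * \<psi> x"
        have f: "0 < f" using \<eta>(1) B \<psi>(1)[of x] by (simp add: f_def add_pos_nonneg)
        have "(1 + M) * L x \<le> (1 + M) * (2 * f)" using L(1)[of x] M(1) by (intro mult_left_mono) (auto simp: f_def)
        also have "\<dots> = 4 * (1 + M) * (f / 2)" by simp
        also have "\<dots> < c * \<alpha> * e $ i * (f / 2)" using c1[of i] f by (intro mult_strict_right_mono) auto
        also have "\<dots> = c * f * \<alpha> * e $ i - c * (\<beta> * f) * e $ i" by (simp add: \<beta>_def algebra_simps)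
        also have "\<dots> \<le> c * (B * \<psi>' x) * e $ i - \<phi> x * (A *v e) $ i"
        proof -
          have "\<phi> x * (A *v e) $ i \<le> \<phi> x * (- \<alpha> * e $ i)" by (intro mult_left_mono \<alpha> \<phi>0)
          moreover have "- (\<beta> * f) \<le> B * \<psi>' x"
          proof -
            have "- (\<beta> * f) = B * (- \<beta> * \<psi> x) - \<beta> * \<eta>" by (simp add: f_def algebra_simps)
            then show ?thesis using mult_left_mono[OF \<psi>'(2), of B x] B mult_pos_pos[OF \<beta>0 \<eta>(1)] by linarith
          qed
          then have "c * (- (\<beta> * f)) * e $ i \<le> c * (B * \<psi>' x) * e $ i"
            using c0 e(1)[of i] by (intro mult_right_mono mult_left_mono) auto
          ultimately show ?thesis by (simp add: \<phi>_def f_def mult_ac)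
        qed
        finally show "(1 + M) * L x < c * (B * \<psi>' x) * e $ i - \<phi> x * (A *v e) $ i" .
      qed
      have nonneg: "0 \<le> \<zeta> s + p s" "0 \<le> \<zeta> s - p s" if "s \<le> 0" for s
        using \<phi>_ge[OF that] by (auto simp: less_eq_vec_def \<zeta>_def abs_le_iff) (smt (verit))+
      have inf\<zeta>: "infnorm (\<zeta> s) = \<phi> s * e1" for s using \<phi>0[of s] by (simp add: \<zeta>_def infnorm_mul e1_def)
      have "le_inf A (\<lambda>_. 0) (\<lambda>s. \<zeta> s + p s)" "le_inf A (\<lambda>_. 0) (\<lambda>s. \<zeta> s - p s)"
        unfolding le_inf_def using nonneg key[of _ _ p] key[of _ _ "\<lambda>s. - p s"] by auto
      moreover have bd: "infnorm (\<zeta> s) \<le> k" for s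
      proof -
        have "B * \<psi> s \<le> B" using B \<psi>(2)[of s] by simp
        then have "c * (\<eta> + B * \<psi> s) \<le> c * (1 + B)" using c0 \<eta>(2) by (intro mult_left_mono) auto
        then show ?thesis unfolding inf\<zeta> k_def \<phi>_def using e10 by (intro mult_right_mono) auto
      qed
      moreover have "infnorm (\<zeta> s) \<le> \<epsilon>" if s: "s \<in> {- real n..0}" for s
      proof -
        have "m \<le> s + N" using s by (simp add: N_def)
        then have "exp (\<beta> * m) \<le> 1 + exp (\<beta> * (s + N))" using \<beta>0 by (simp add: add_increasing)
        then have "\<psi> s \<le> exp (- \<beta> * m)"
          by (simp add: \<psi>_def exp_minus inverse_eq_divide frac_le)
        then have "c * B * e1 * \<psi> s \<le> c * B * e1 * exp (- \<beta> * m)"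
          using c0 B e10 by (intro mult_left_mono) auto
        then show ?thesis using far \<eta>\<epsilon> unfolding inf\<zeta> \<phi>_def by (simp add: algebra_simps)
      qed
      moreover have "ucb 0 \<zeta>"
      proof -
        have "norm (\<zeta> t - \<zeta> s) \<le> (c * B * \<beta> * norm e) * \<bar>t - s\<bar>" for s t
        proof (rule vector_derivative_lipschitz[where S = "min s t" and T = "max s t" and f' = "\<lambda>t. (c * (B * \<psi>' t)) *\<^sub>R e"])
          fix t'
          have "(\<phi> has_real_derivative c * (B * \<psi>' t')) (at t')"
            unfolding \<phi>_def by (auto intro!: derivative_eq_intros \<psi>')
          then show "(\<zeta> has_vector_derivative (c * (B * \<psi>' t')) *\<^sub>R e) (at t' within {min s t..max s t})"
            unfolding \<zeta>_def using has_vector_derivative_scaleR[of \<phi> "c * (B * \<psi>' t')" t' "{min s t..max s t}" "\<lambda>_. e" 0]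
            by (auto intro: DERIV_subset has_field_derivative_at_within)
          show "norm ((c * (B * \<psi>' t')) *\<^sub>R e) \<le> c * B * \<beta> * norm e"
            using c0 B \<psi>'(3)[of t'] by (auto simp: abs_mult intro!: mult_right_mono mult_left_mono)
        qed auto
        then have lip: "(c * B * \<beta> * norm e)-lipschitz_on {..0} \<zeta>"
          using c0 B \<beta>0 by (auto simp: lipschitz_on_def dist_norm norm_minus_commute abs_minus_commute)
        have "norm (\<zeta> s) \<le> CARD('m) * k" for s
          by (intro order_trans[OF norm_le_card_infnorm] mult_left_mono bd) simp
        then show ?thesis using lipschitz_on_uniformly_continuous[OF lip] unfolding ucb_def bounded_iff by auto
      qed
      ultimately show "\<exists>\<zeta>. small_bound (le_inf A) k n \<epsilon> p \<zeta>"
        unfolding small_bound_def by blast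
    qed (use \<eta> N in auto)
  qed
qed

section \<open>Translation invariance of the orders\<close>

text \<open>Only values on the half-line are compared, so the property also applies to functions
  outside \<open>BU\<close>, such as the constant 0 in \<open>small_bound\<close>.\<close>

definition translation_invariant :: "(('m::finite) hist \<Rightarrow> 'm hist \<Rightarrow> bool) \<Rightarrow> bool" where
  "translation_invariant le \<longleftrightarrow>
     (\<forall>x y x' y'. le x y \<longrightarrow> (\<forall>s\<le>0. y s - x s = y' s - x' s) \<longrightarrow> le x' y')"

lemma translation_invariantD:
  "translation_invariant le \<Longrightarrow> le x y \<Longrightarrow> (\<And>s. s \<le> 0 \<Longrightarrow> y s - x s = y' s - x' s) \<Longrightarrow> le x' y'"
  by (simp add: translation_invariant_def)

lemma translation_invariant_le_fin: "translation_invariant (le_fin A r)"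
  unfolding translation_invariant_def
proof (intro allI impI)
  fix x y x' y' :: "'a hist" assume le: "le_fin A r x y" and eq: "\<forall>s\<le>0. y s - x s = y' s - x' s"
  have "x' s \<le> y' s" if "s \<le> 0" for s
  proof -
    have "0 \<le> y s - x s" using le that by (simp add: le_fin_def)
    then show ?thesis using eq that by simp
  qed
  moreover have "mexp ((t - s) *\<^sub>R A) *v (y' s - x' s) \<le> y' t - x' t" if "- r \<le> s" "s \<le> t" "t \<le> 0" for s t
  proof -
    have "mexp ((t - s) *\<^sub>R A) *v (y s - x s) \<le> y t - x t" using le that unfolding le_fin_def by blast
    then show ?thesis using eq that by simp
  qed
  ultimately show "le_fin A r x' y'" unfolding le_fin_def by blast
qed

lemma translation_invariant_le_inf: "translation_invariant (le_inf A)"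
  unfolding translation_invariant_def
proof (intro allI impI)
  fix x y x' y' :: "'a hist" assume le: "le_inf A x y" and eq: "\<forall>s\<le>0. y s - x s = y' s - x' s"
  have "x' s \<le> y' s" if "s \<le> 0" for s
  proof -
    have "0 \<le> y s - x s" using le that by (simp add: le_inf_def)
    then show ?thesis using eq that by simp
  qed
  moreover have "mexp ((t - s) *\<^sub>R A) *v (y' s - x' s) \<le> y' t - x' t" if "s \<le> t" "t \<le> 0" for s t
  proof -
    have "mexp ((t - s) *\<^sub>R A) *v (y s - x s) \<le> y t - x t" using le that unfolding le_inf_def by blast
    then show ?thesis using eq that by simp
  qed
  ultimately show "le_inf A x' y'" unfolding le_inf_def by blast
qed

section \<open>Solutions\<close>

locale delay_flow = delay_operator \<nu> D w q
  for \<nu> :: "'m::finite \<Rightarrow> 'm \<Rightarrow> real measure" and D w q +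
  fixes \<sigma> :: "real \<Rightarrow> 'w::metric_space \<Rightarrow> 'w" and F :: "'w \<Rightarrow> 'm hist \<Rightarrow> real^'m"
  assumes flow: "continuous_flow \<sigma>" and F1: "cond_F1 F" and F2: "cond_F2 F" and F3: "cond_F3 F"
begin

lemma flow_add: "\<sigma> (s + t) \<omega> = \<sigma> t (\<sigma> s \<omega>)"
  using flow by (simp add: continuous_flow_def)

lemma flow_tendsto:
  assumes "(f \<longlongrightarrow> t) G" "(g \<longlongrightarrow> \<omega>) G"
  shows "((\<lambda>n. \<sigma> (f n) (g n)) \<longlongrightarrow> \<sigma> t \<omega>) G"
proof -
  have "continuous_on UNIV (\<lambda>(t, \<omega>). \<sigma> t \<omega>)" using flow by (simp add: continuous_flow_def)
  then have "isCont (\<lambda>(t, \<omega>). \<sigma> t \<omega>) (t, \<omega>)" by (simp add: continuous_on_eq_continuous_at)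
  from isCont_tendsto_compose[OF this tendsto_Pair[OF assms]] show ?thesis by simp
qed

lemma F_bounded:
  assumes "0 < k"
  obtains M where "0 < M" "\<And>\<omega> x. x \<in> BB k \<Longrightarrow> norm (F \<omega> x) \<le> M"
proof -
  have "bounded ((\<lambda>(\<omega>, x). F \<omega> x) ` (UNIV \<times> BB k))" using F2 assms by (simp add: cond_F2_def)
  then obtain M where "\<forall>x\<in>(\<lambda>(\<omega>, x). F \<omega> x) ` (UNIV \<times> BB k). norm x \<le> M" "0 < M"
    unfolding bounded_pos by blast
  then show thesis using that[of M] by auto
qed

lemma F_tendsto:
  assumes k: "0 < k" and \<omega>: "\<omega>s \<longlonglongrightarrow> \<omega>" and x: "\<And>n. x n \<in> BB k" "y \<in> BB k"
    and lim: "(\<lambda>n. co_dist (x n) y) \<longlonglongrightarrow> 0"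
  shows "(\<lambda>n. F (\<omega>s n) (x n)) \<longlonglongrightarrow> F \<omega> y"
proof -
  have CX: "x n \<in> CX" "y \<in> CX" for n using x by (auto simp: BB_def BU_in_CX)
  have "limitin co_top x y sequentially"
    unfolding co_top_def Metric_space.limitin_metric_dist_null[OF Metric_space_CX]
    using CX lim by simp
  then have "limitin (prod_topology euclidean (subtopology co_top (BB k))) (\<lambda>n. (\<omega>s n, x n)) (\<omega>, y) sequentially"
    using \<omega> x by (simp add: limitin_pairwise limitin_subtopology o_def)
  moreover have "continuous_map (prod_topology euclidean (subtopology co_top (BB k))) euclidean (\<lambda>(\<omega>, x). F \<omega> x)"
    using F3 k by (simp add: cond_F3_def)
  ultimately have "limitin euclidean ((\<lambda>(\<omega>, x). F \<omega> x) \<circ> (\<lambda>n. (\<omega>s n, x n))) (F \<omega> y) sequentially"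
    using continuous_map_limit by fastforce
  then show ?thesis by (simp add: o_def)
qed

text \<open>Unlike in \<open>is_solution\<close>, the starting time may be negative, so that a point
  of \<open>K\<close> can itself be a solution on its past. Requiring \<open>ucb\<close> puts all
  segments up to \<open>T\<close> into \<open>BU\<close>; for a solution with history in
  \<open>BU\<close> it follows from continuity by \<open>ucb_extend\<close>.\<close>

definition evolves :: "real \<Rightarrow> real \<Rightarrow> 'w \<Rightarrow> (real \<Rightarrow> real^'m) \<Rightarrow> bool" where
  "evolves S T \<omega> v \<longleftrightarrow> ucb T v \<and> (\<forall>t\<in>{S..T}.
     ((\<lambda>t. D (seg v t)) has_vector_derivative F (\<sigma> t \<omega>) (seg v t)) (at t within {S..T}))"

lemma is_solution_iff:
  assumes "x \<in> BU" "0 \<le> T"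
  shows "is_solution D F \<sigma> T \<omega> x v \<longleftrightarrow> evolves 0 T \<omega> v \<and> seg v 0 = x"
  using assms ucb_extend[of 0 v T] seg_in_BU_iff[of v 0]
  by (auto simp: is_solution_def evolves_def) (auto simp: ucb_def uniformly_continuous_imp_continuous)

lemma evolves_subinterval:
  assumes "evolves S T \<omega> v" "S \<le> S'" "T' \<le> T"
  shows "evolves S' T' \<omega> v"
  using assms ucb_mono[of T v T']
  by (auto simp: evolves_def intro: has_vector_derivative_within_subset[of _ _ _ "{S..T}"])

lemma evolves_shift:
  assumes v: "evolves S T \<omega> v"
  shows "evolves (S - a) (T - a) (\<sigma> a \<omega>) (\<lambda>t. v (a + t))"
proof -
  have seg: "seg (\<lambda>t. v (a + t)) t = seg v (a + t)" for t by (simp add: seg_def add.assoc)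
  have "ucb (T - a) (\<lambda>t. v (a + t))"
  proof -
    have "ucb T v" using v by (simp add: evolves_def)
    then have "seg (\<lambda>t. v (a + t)) (T - a) \<in> BU" unfolding seg by (simp add: seg_in_BU_iff)
    then show ?thesis by (simp add: seg_in_BU_iff)
  qed
  moreover have "((\<lambda>t. D (seg v (a + t))) has_vector_derivative F (\<sigma> (a + t) \<omega>) (seg v (a + t)))
      (at t within {S - a..T - a})" if "t \<in> {S - a..T - a}" for t
  proof -
    have "(+) a ` {S - a..T - a} = {S..T}" by simp
    then have "((\<lambda>t. D (seg v t)) has_vector_derivative F (\<sigma> (a + t) \<omega>) (seg v (a + t))) (at (a + t) within (+) a ` {S - a..T - a})"
      using v that by (auto simp: evolves_def)
    moreover have "((+) a has_vector_derivative 1) (at t within {S - a..T - a})"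
      by (auto intro!: derivative_eq_intros)
    ultimately show ?thesis
      using vector_diff_chain_within[of "(+) a" 1 t "{S - a..T - a}" "\<lambda>t. D (seg v t)"] by (simp add: o_def)
  qed
  ultimately show ?thesis unfolding evolves_def seg flow_add by blast
qed

lemma evolves_BB:
  assumes "evolves S T \<omega> v" "\<And>s. s \<le> T \<Longrightarrow> infnorm (v s) \<le> k" "t \<le> T"
  shows "seg v t \<in> BB k"
  using assms ucb_mono[of T v t] by (auto simp: BB_iff seg_in_BU_iff evolves_def)

lemma evolves_D_lipschitz:
  assumes v: "evolves S T \<omega> v" "\<And>s. s \<le> T \<Longrightarrow> infnorm (v s) \<le> k"
    and M: "\<And>\<omega> x. x \<in> BB k \<Longrightarrow> norm (F \<omega> x) \<le> M" and st: "s \<in> {S..T}" "t \<in> {S..T}"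
  shows "norm (D (seg v t) - D (seg v s)) \<le> M * \<bar>t - s\<bar>"
proof (rule vector_derivative_lipschitz[of S T])
  fix t assume t: "t \<in> {S..T}"
  show "((\<lambda>t. D (seg v t)) has_vector_derivative F (\<sigma> t \<omega>) (seg v t)) (at t within {S..T})"
    using v t by (simp add: evolves_def)
  show "norm (F (\<sigma> t \<omega>) (seg v t)) \<le> M" using t by (intro M evolves_BB[OF v]) auto
qed (use st in auto)

section \<open>Uniqueness of solutions\<close>

text \<open>(F1) gives a Lipschitz constant only near one point, so the argument is localized at the
  infimum \<open>t0\<close> of the times where the solutions differ. By uniform continuity segments
  move continuously in the supremum norm, hence both solutions stay in that neighbourhood for a
  while. There \<open>contraction_bound\<close> applies with bound 0 and factor
  \<open>(1 + q) / 2\<close>.\<close>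

lemma evolves_unique:
  assumes z: "evolves 0 T \<omega> z" and v: "evolves 0 T \<omega> v" and init: "\<And>s. s \<le> 0 \<Longrightarrow> z s = v s"
    and t: "t \<le> T"
  shows "z t = v t"
proof (rule ccontr)
  assume neq: "z t \<noteq> v t"
  define E where "E = {s\<in>{0..T}. z s \<noteq> v s}"
  have tE: "t \<in> E" using init[of t] neq t by (force simp: E_def)
  have bdd: "bdd_below E" by (intro bdd_belowI[of _ 0]) (auto simp: E_def)
  define t0 where "t0 = Inf E"
  have t0: "0 \<le> t0" "t0 \<le> T"
  proof -
    show "0 \<le> t0" unfolding t0_def using tE by (intro cInf_greatest) (auto simp: E_def)
    show "t0 \<le> T" using cInf_lower[OF tE bdd] t by (simp add: t0_def)
  qed
  have before: "z s = v s" if "s < t0" for s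
  proof (cases "s \<le> 0")
    case False
    show ?thesis
    proof (rule ccontr)
      assume "z s \<noteq> v s"
      then have "s \<in> E" using False that t0 by (auto simp: E_def)
      then show False using cInf_lower[OF _ bdd, of s] that by (simp add: t0_def)
    qed
  qed (use init in simp)
  have ucb: "ucb T z" "ucb T v" using z v by (auto simp: evolves_def)
  then have uc: "uniformly_continuous_on {..T} z" "uniformly_continuous_on {..T} v" by (auto simp: ucb_def)
  have upto: "z s = v s" if "s \<le> t0" for s
  proof -
    have "closed ({..T} \<inter> (\<lambda>s. z s - v s) -` {0})"
      by (intro continuous_closed_preimage continuous_intros uniformly_continuous_imp_continuous uc)
    moreover have "{..<t0} \<subseteq> {..T} \<inter> (\<lambda>s. z s - v s) -` {0}" using before t0 by auto
    ultimately have "closure {..<t0} \<subseteq> {..T} \<inter> (\<lambda>s. z s - v s) -` {0}" by (rule closure_minimal[rotated])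
    then have "s \<in> {..T} \<inter> (\<lambda>s. z s - v s) -` {0}" using that by auto
    then show ?thesis by simp
  qed
  have seg0: "seg v t0 = seg z t0" using upto by (intro seg_cong) simp
  have BU: "seg z t \<in> BU" "seg v t \<in> BU" if "t \<le> T" for t
    using ucb ucb_mono[OF _ that] by (auto simp: seg_in_BU_iff)
  obtain \<rho> L0 where \<rho>: "0 < \<rho>" "\<And>\<omega>' x y. dist \<omega>' (\<sigma> t0 \<omega>) < \<rho> \<Longrightarrow> x \<in> BU \<Longrightarrow> y \<in> BU \<Longrightarrow>
      BU_dist x (seg z t0) < \<rho> \<Longrightarrow> BU_dist y (seg z t0) < \<rho> \<Longrightarrow> infnorm (F \<omega>' x - F \<omega>' y) \<le> L0 * BU_dist x y"
    using F1 BU[OF t0(2)] unfolding cond_F1_def by blast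
  obtain a b where ab: "0 < a" "0 < b" "\<And>v. wnorm w v \<le> a * norm v" "\<And>v. norm v \<le> b * wnorm w v"
    using wnorm_equiv[of w] w by metis
  \<comment> \<open>\<open>cond_F1\<close> gives no sign for its constant.\<close>
  define L where "L = max L0 0"
  have near: "\<exists>d>0. \<forall>t\<in>{t0..T}. t < t0 + d \<longrightarrow> BU_dist (seg x t) (seg x t0) < \<rho>" if "ucb T x" for x
  proof -
    have "uniformly_continuous_on {..T} x" using that by (simp add: ucb_def)
    then obtain d where d: "0 < d" "\<And>s t. s \<le> T \<Longrightarrow> t \<le> T \<Longrightarrow> dist s t < d \<Longrightarrow> dist (x s) (x t) < \<rho> / 2"
      unfolding uniformly_continuous_on_def using \<rho>(1) by (meson atMost_iff half_gt_zero)
    have "BU_dist (seg x t) (seg x t0) < \<rho>" if "t \<in> {t0..T}" "t < t0 + d" for t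
    proof -
      have "BU_dist (seg x t) (seg x t0) \<le> \<rho> / 2"
      proof (rule BU_dist_le)
        show "seg x t \<in> BU" "seg x t0 \<in> BU"
          using ucb_mono[OF \<open>ucb T x\<close>] that t0 by (auto simp: seg_in_BU_iff)
        fix s :: real assume "s \<le> 0"
        then have "dist (x (t + s)) (x (t0 + s)) < \<rho> / 2" using that t0 by (intro d(2)) (auto simp: dist_real_def)
        then show "infnorm (seg x t s - seg x t0 s) \<le> \<rho> / 2"
          using \<open>s \<le> 0\<close> infnorm_le_norm[of "x (t + s) - x (t0 + s)"] by (simp add: dist_norm)
      qed
      then show ?thesis using \<rho>(1) by linarith
    qed
    then show ?thesis using d(1) by blast
  qed
  obtain d1 where d1: "d1 > 0" "\<And>t. t \<in> {t0..T} \<Longrightarrow> t < t0 + d1 \<Longrightarrow> BU_dist (seg z t) (seg z t0) < \<rho>"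
    using near[OF ucb(1)] by blast
  obtain d2 where d2: "d2 > 0" "\<And>t. t \<in> {t0..T} \<Longrightarrow> t < t0 + d2 \<Longrightarrow> BU_dist (seg v t) (seg z t0) < \<rho>"
    using near[OF ucb(2)] seg0 by auto
  have "((\<lambda>t. \<sigma> t \<omega>) \<longlongrightarrow> \<sigma> t0 \<omega>) (at t0)" by (intro flow_tendsto tendsto_intros)
  from tendstoD[OF this \<rho>(1)] obtain d3 where d3: "d3 > 0" "\<And>t. t \<noteq> t0 \<Longrightarrow> dist t t0 < d3 \<Longrightarrow> dist (\<sigma> t \<omega>) (\<sigma> t0 \<omega>) < \<rho>"
    unfolding eventually_at by auto
  have den: "0 < a * CARD('m) * L * b + 1" using ab by (simp add: L_def add_nonneg_pos)
  \<comment> \<open>Over a time of this length the difference of the values of \<open>F\<close>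
    contributes at most \<open>(1 - q) / 2\<close> times \<open>c\<close>, half of the gap left by
    \<open>q\<close>. The summand 1 in the denominator covers \<open>L = 0\<close>.\<close>
  define e where "e = (1 - q) / (2 * (a * CARD('m) * L * b + 1))"
  have "0 < e" using den q(2) unfolding e_def by (intro divide_pos_pos mult_pos_pos) auto
  define h where "h = min (min d1 d2) (min d3 e) / 2"
  have h: "0 < h" "h < d1" "h < d2" "h < d3" "h \<le> (1 - q) / (2 * (a * CARD('m) * L * b + 1))"
    using d1(1) d2(1) d3(1) \<open>0 < e\<close> unfolding e_def[symmetric] by (auto simp: h_def)
  have hL: "a * CARD('m) * L * b * h \<le> (1 - q) / 2"
  proof -
    have "(a * CARD('m) * L * b + 1) * h \<le> (1 - q) / 2" using h(5) den by (simp add: field_simps)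
    then show ?thesis using h(1) by (simp add: distrib_right)
  qed
  define T1 where "T1 = min T (t0 + h)"
  define g where "g t = wnorm w (z t - v t)" for t
  have T1: "t0 \<le> T1" "T1 \<le> T" using t0 h by (auto simp: T1_def)
  have g_le: "g t \<le> 0 / (1 - (1 + q) / 2)" if "t \<in> {t0..T1}" for t
  proof (rule contraction_bound[where S = "{t0..T1}" and g = g])
    show "bdd_above (g ` {t0..T1})"
    proof -
      obtain kz kv where "\<forall>s\<in>{..T}. norm (z s) \<le> kz" "\<forall>s\<in>{..T}. norm (v s) \<le> kv"
        using ucb by (auto simp: ucb_def bounded_iff)
      then have "g t \<le> a * (kz + kv)" if "t \<in> {t0..T1}" for t
        using ab(3)[of "z t - v t"] norm_triangle_ineq4[of "z t" "v t"] that T1 ab(1)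
          mult_left_mono[of "norm (z t - v t)" "kz + kv" a] unfolding g_def
        by (smt (verit, best) atLeastAtMost_iff atMost_iff)
      then show ?thesis by (intro bdd_aboveI2)
    qed
    fix c assume c: "0 \<le> c" "\<forall>t\<in>{t0..T1}. g t \<le> c"
    have gc: "wnorm w (z s - v s) \<le> c" if "s \<le> T1" for s
    proof (cases "s \<le> t0")
      case True
      then show ?thesis using upto[OF True] c(1) by (simp add: wnorm_def)
    qed (use c that in \<open>auto simp: g_def\<close>)
    have gseg: "wnorm w (seg z t s - seg v t s) \<le> c" if "t \<le> T1" "s \<le> 0" for s t
      using gc[of "t + s"] that by simp
    show "\<forall>t\<in>{t0..T1}. g t \<le> 0 + (1 + q) / 2 * c"
    proof
      fix t assume t: "t \<in> {t0..T1}"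
      define f where "f t = D (seg z t) - D (seg v t)" for t
      have "norm (f t - f t0) \<le> (CARD('m) * (L * (b * c))) * \<bar>t - t0\<bar>"
      proof (rule vector_derivative_lipschitz[of t0 T1])
        fix x assume x: "x \<in> {t0..T1}"
        have "(f has_vector_derivative F (\<sigma> x \<omega>) (seg z x) - F (\<sigma> x \<omega>) (seg v x)) (at x within {0..T})"
          unfolding f_def using z v x T1 t0 by (intro has_vector_derivative_diff) (auto simp: evolves_def)
        then show "(f has_vector_derivative F (\<sigma> x \<omega>) (seg z x) - F (\<sigma> x \<omega>) (seg v x)) (at x within {t0..T1})"
          by (rule has_vector_derivative_within_subset) (use t0 T1 in auto)
        have xT: "x \<le> T" "x \<in> {t0..T}" "x \<le> t0 + h" using x T1 by (auto simp: T1_def)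
        have "infnorm (F (\<sigma> x \<omega>) (seg z x) - F (\<sigma> x \<omega>) (seg v x)) \<le> L0 * BU_dist (seg z x) (seg v x)"
        proof (rule \<rho>(2))
          show "dist (\<sigma> x \<omega>) (\<sigma> t0 \<omega>) < \<rho>"
            using d3(2)[of x] \<rho>(1) xT h by (cases "x = t0") (auto simp: dist_real_def)
        qed (use d1(2) d2(2) xT h BU in auto)
        also have "\<dots> \<le> L * BU_dist (seg z x) (seg v x)"
          by (intro mult_right_mono Metric_space.nonneg[OF Metric_space_BU]) (simp add: L_def)
        also have "\<dots> \<le> L * (b * c)"
        proof (intro mult_left_mono BU_dist_le BU xT)
          fix s :: real assume "s \<le> 0"
          have "norm (seg z x s - seg v x s) \<le> b * c"
            using order_trans[OF ab(4) mult_left_mono[OF gseg, of x s b]] x \<open>s \<le> 0\<close> ab(2) by simp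
          then show "infnorm (seg z x s - seg v x s) \<le> b * c" using infnorm_le_norm order_trans by blast
        qed (simp add: L_def)
        finally have "infnorm (F (\<sigma> x \<omega>) (seg z x) - F (\<sigma> x \<omega>) (seg v x)) \<le> L * (b * c)" .
        then have "CARD('m) * infnorm (F (\<sigma> x \<omega>) (seg z x) - F (\<sigma> x \<omega>) (seg v x)) \<le> CARD('m) * (L * (b * c))"
          by (rule mult_left_mono) simp
        then show "norm (F (\<sigma> x \<omega>) (seg z x) - F (\<sigma> x \<omega>) (seg v x)) \<le> CARD('m) * (L * (b * c))"
          using norm_le_card_infnorm order_trans by blast
      qed (use t in auto)
      also have "\<dots> \<le> (CARD('m) * (L * (b * c))) * h"
        using t ab(2) c(1) by (intro mult_left_mono) (auto simp: T1_def L_def)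
      finally have "norm (f t) \<le> (CARD('m) * (L * (b * c))) * h" using seg0 by (simp add: f_def)
      then have "wnorm w (f t) \<le> a * ((CARD('m) * (L * (b * c))) * h)"
        using ab(1) by (intro order_trans[OF ab(3) mult_left_mono]) auto
      also have "\<dots> = (a * CARD('m) * L * b * h) * c" by (simp add: mult_ac)
      also have "\<dots> \<le> (1 - q) / 2 * c" using hL c(1) by (rule mult_right_mono)
      finally have "wnorm w (f t) \<le> (1 - q) / 2 * c" .
      moreover have "wnorm w (seg z t 0 - seg v t 0) \<le> wnorm w (D (seg z t) - D (seg v t)) + q * c"
        using t T1 by (intro D_diff_bound BU c gseg) auto
      ultimately show "g t \<le> 0 + (1 + q) / 2 * c" by (simp add: g_def f_def field_simps)
    qed
  qed (use that q wnorm_nonneg[of w] w in \<open>auto simp: g_def\<close>)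
  obtain s where s: "s \<in> E" "s < t0 + h" using cInf_lessD[of E "t0 + h"] tE h by (auto simp: t0_def)
  then have "s \<in> {t0..T1}" using cInf_lower[OF s(1) bdd] by (auto simp: t0_def T1_def E_def)
  from g_le[OF this] have "wnorm w (z s - v s) \<le> 0" by (simp add: g_def)
  then have "norm (z s - v s) \<le> b * 0"
    using ab(2) by (intro order_trans[OF ab(4) mult_left_mono]) auto
  then show False using s(1) by (simp add: E_def)
qed

section \<open>Compactness of families of solutions\<close>

text \<open>The pairs at distance below \<open>d\<close> are closed under joint shifts to the left,
  so the increments themselves can be put into \<open>D_diff_bound\<close>; the increments of
  \<open>D\<close> are small since \<open>F\<close> is bounded on \<open>BB k\<close>. A pair
  straddling 0 is split at 0, which costs the second summand \<open>a * e1\<close>.\<close>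

lemma evolves_equicontinuous:
  assumes ev: "\<And>n. evolves 0 T (\<omega> n) (v n)" and k: "0 < k" and bd: "\<And>n s. s \<le> T \<Longrightarrow> infnorm (v n s) \<le> k"
    and init: "\<And>e. 0 < e \<Longrightarrow> \<exists>d>0. \<forall>n s t. s \<le> 0 \<longrightarrow> t \<le> 0 \<longrightarrow> \<bar>s - t\<bar> < d \<longrightarrow> norm (v n s - v n t) < e"
    and T: "0 \<le> T" and e: "0 < e"
  shows "\<exists>d>0. \<forall>n s t. s \<le> T \<longrightarrow> t \<le> T \<longrightarrow> \<bar>s - t\<bar> < d \<longrightarrow> norm (v n s - v n t) < e"
proof -
  obtain a b where ab: "0 < a" "0 < b" "\<And>v. wnorm w v \<le> a * norm v" "\<And>v. norm v \<le> b * wnorm w v"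
    using wnorm_equiv[of w] w by metis
  obtain M where M: "0 < M" "\<And>\<omega> x. x \<in> BB k \<Longrightarrow> norm (F \<omega> x) \<le> M" using F_bounded[OF k] by metis
  \<comment> \<open>Makes the final bound \<open>b * ((a * e1 + a * e1) / (1 - q))\<close> equal to
    \<open>e / 2\<close>.\<close>
  define e1 where "e1 = e * (1 - q) / (4 * a * b)"
  have e1: "0 < e1" using e q(2) ab by (simp add: e1_def)
  obtain d0 where d0: "d0 > 0" "\<And>n s t. s \<le> 0 \<Longrightarrow> t \<le> 0 \<Longrightarrow> \<bar>s - t\<bar> < d0 \<Longrightarrow> norm (v n s - v n t) < e1"
    using init[OF e1] by blast
  define d where "d = min d0 (e1 / M)"
  have d: "0 < d" "d \<le> d0" "M * d \<le> e1" using d0(1) M(1) e1 by (auto simp: d_def min_def field_simps)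
  have BU: "seg (v n) t \<in> BU" if "t \<le> T" for n t
    using evolves_BB[OF ev bd that, of n] by (simp add: BB_iff)
  have main: "wnorm w (v n t - v n s) \<le> (a * e1 + a * e1) / (1 - q)" if st: "s \<le> t" "t \<le> T" "t - s < d" for n s t
  proof -
    define P where "P = {(s, t). s \<le> t \<and> t \<le> T \<and> t - s < d}"
    define g where "g = (\<lambda>(s, t). wnorm w (v n t - v n s))"
    have "g (s, t) \<le> (a * e1 + a * e1) / (1 - q)"
    proof (rule contraction_bound[where S = P and g = g])
      show "bdd_above (g ` P)"
      proof (rule bdd_aboveI2)
        fix p assume "p \<in> P"
        then obtain s t where p: "p = (s, t)" "s \<le> T" "t \<le> T" by (auto simp: P_def)
        have "norm (v n t) \<le> CARD('m) * k" "norm (v n s) \<le> CARD('m) * k"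
          using norm_le_card_infnorm bd[OF p(2)] bd[OF p(3)] by (meson mult_left_mono of_nat_0_le_iff order_trans)+
        then have "norm (v n t - v n s) \<le> CARD('m) * k + CARD('m) * k"
          using norm_triangle_ineq4[of "v n t" "v n s"] by linarith
        then show "g p \<le> a * (CARD('m) * k + CARD('m) * k)"
          unfolding g_def p(1) prod.case using ab(1) by (intro order_trans[OF ab(3) mult_left_mono]) auto
      qed
      fix c assume c: "0 \<le> c" "\<forall>p\<in>P. g p \<le> c"
      then have gc: "wnorm w (v n t - v n s) \<le> c" if "s \<le> t" "t \<le> T" "t - s < d" for s t
        using that by (auto simp: P_def g_def)
      have neg: "wnorm w (v n t - v n s) \<le> a * e1" if "s \<le> t" "t \<le> 0" "t - s < d" for s t
        using d0(2)[of t s n] that d ab(1) by (intro order_trans[OF ab(3) mult_left_mono]) auto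
      have pos: "wnorm w (v n t - v n s) \<le> a * e1 + q * c" if st: "0 \<le> s" "s \<le> t" "t \<le> T" "t - s < d" for s t
      proof -
        have "norm (D (seg (v n) t) - D (seg (v n) s)) \<le> M * \<bar>t - s\<bar>"
          using st by (intro evolves_D_lipschitz[OF ev bd M(2)]) auto
        also have "\<dots> \<le> M * d" using st M(1) by (intro mult_left_mono) auto
        finally have "norm (D (seg (v n) t) - D (seg (v n) s)) \<le> e1" using d(3) by linarith
        then have "wnorm w (D (seg (v n) t) - D (seg (v n) s)) \<le> a * e1"
          using ab(1) by (intro order_trans[OF ab(3) mult_left_mono]) auto
        moreover have "wnorm w (seg (v n) t 0 - seg (v n) s 0) \<le> wnorm w (D (seg (v n) t) - D (seg (v n) s)) + q * c"
        proof (intro D_diff_bound BU c)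
          fix r :: real assume "r \<le> 0"
          then show "wnorm w (seg (v n) t r - seg (v n) s r) \<le> c" using st gc[of "s + r" "t + r"] by simp
        qed (use st in auto)
        ultimately show ?thesis by simp
      qed
      show "\<forall>p\<in>P. g p \<le> (a * e1 + a * e1) + q * c"
      proof
        fix p assume "p \<in> P"
        then obtain s t where p: "p = (s, t)" "s \<le> t" "t \<le> T" "t - s < d" by (auto simp: P_def)
        have nn: "0 \<le> a * e1" "0 \<le> q * c" using ab(1) e1 q(1) c(1) by auto
        consider "t \<le> 0" | "0 \<le> s" | "s < 0" "0 < t" by linarith
        then have "wnorm w (v n t - v n s) \<le> (a * e1 + a * e1) + q * c"
        proof cases
          case 3
          have "wnorm w ((v n t - v n 0) + (v n 0 - v n s)) \<le> wnorm w (v n t - v n 0) + wnorm w (v n 0 - v n s)"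
            by (rule wnorm_triangle[OF w])
          then show ?thesis using pos[of 0 t] neg[of s 0] 3 p by simp
        qed (use pos[of s t] neg[of s t] p nn in auto)
        then show "g p \<le> (a * e1 + a * e1) + q * c" by (simp add: g_def p)
      qed
    qed (use st q wnorm_nonneg[of w] w in \<open>auto simp: P_def g_def\<close>)
    then show ?thesis by (simp add: g_def)
  qed
  have small: "b * ((a * e1 + a * e1) / (1 - q)) < e"
  proof -
    have eq: "b * ((a * e1 + a * e1) / (1 - q)) = e / 2" using ab q(2) by (simp add: e1_def field_simps)
    show ?thesis unfolding eq using e by simp
  qed
  have less: "norm (v n t - v n s) < e" if "s \<le> t" "t \<le> T" "t - s < d" for n s t
    using order_trans[OF ab(4) mult_left_mono[OF main[OF that]], of n] ab(2) small by simp
  have "norm (v n s - v n t) < e" if "s \<le> T" "t \<le> T" "\<bar>s - t\<bar> < d" for n s t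
    using less[of s t n] less[of t s n] that by (cases "s \<le> t") (auto simp: norm_minus_commute)
  then show ?thesis using d(1) by blast
qed

text \<open>Derivatives need not pass to the limit, but the integrated equation does, by dominated
  convergence with the constant bound of \<open>F\<close> on \<open>BB k\<close>. It can be
  differentiated again since the limiting integrand is continuous.\<close>

lemma evolves_limit:
  assumes \<omega>: "\<omega>s \<longlonglongrightarrow> \<omega>" and ev: "\<And>n. evolves S T (\<omega>s n) (v n)" and k: "0 < k"
    and bd: "\<And>n s. s \<le> T \<Longrightarrow> infnorm (v n s) \<le> k" and ucb: "ucb T z"
    and lim: "\<And>R e. 0 < e \<Longrightarrow> \<forall>\<^sub>F n in sequentially. \<forall>s\<in>{R..T}. norm (v n s - z s) < e"
  shows "\<And>s. s \<le> T \<Longrightarrow> infnorm (z s) \<le> k"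
    and "\<And>t. t \<le> T \<Longrightarrow> (\<lambda>n. co_dist (seg (v n) t) (seg z t)) \<longlonglongrightarrow> 0"
    and "evolves S T \<omega> z"
proof -
  have pt: "(\<lambda>n. v n s) \<longlonglongrightarrow> z s" if "s \<le> T" for s
  proof (rule tendstoI)
    fix e :: real assume "0 < e"
    from lim[OF this, of s] show "\<forall>\<^sub>F n in sequentially. dist (v n s) (z s) < e"
      by eventually_elim (use that in \<open>auto simp: dist_norm\<close>)
  qed
  show zk: "infnorm (z s) \<le> k" if "s \<le> T" for s
    unfolding infnorm_le_iff
  proof
    fix i
    have "(\<lambda>n. \<bar>v n s $ i\<bar>) \<longlonglongrightarrow> \<bar>z s $ i\<bar>" by (intro tendsto_intros pt that)
    then show "\<bar>z s $ i\<bar> \<le> k"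
      by (rule LIMSEQ_le_const2) (use bd[OF that] in \<open>auto simp: infnorm_le_iff\<close>)
  qed
  have BB: "seg (v n) t \<in> BB k" "seg z t \<in> BB k" if "t \<le> T" for n t
    using evolves_BB[OF ev bd that] ucb_mono[OF ucb that] zk that by (auto simp: BB_iff seg_in_BU_iff)
  then have CX: "seg (v n) t \<in> CX" "seg z t \<in> CX" if "t \<le> T" for n t
    using that by (auto simp: BB_iff BU_in_CX)
  show co: "(\<lambda>n. co_dist (seg (v n) t) (seg z t)) \<longlonglongrightarrow> 0" if "t \<le> T" for t
    unfolding co_dist_tendsto_zero_iff[OF CX[OF that]]
  proof (intro allI impI)
    fix R e :: real assume "0 < e"
    from lim[OF this, of "t - R"]
    show "\<forall>\<^sub>F n in sequentially. \<forall>s\<in>{- R..0}. norm (seg (v n) t s - seg z t s) < e"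
      by eventually_elim (use that in auto)
  qed
  have Dlim: "(\<lambda>n. D (seg (v n) t)) \<longlonglongrightarrow> D (seg z t)" if "t \<le> T" for t
    using BB[OF that] that by (intro D_tendsto) (auto simp: BB_iff intro!: pt)
  have Flim: "(\<lambda>n. F (\<sigma> t (\<omega>s n)) (seg (v n) t)) \<longlonglongrightarrow> F (\<sigma> t \<omega>) (seg z t)" if "t \<le> T" for t
    using BB[OF that] that co \<omega> by (intro F_tendsto[OF k] flow_tendsto tendsto_const) auto
  obtain M where M: "0 < M" "\<And>\<omega> x. x \<in> BB k \<Longrightarrow> norm (F \<omega> x) \<le> M" using F_bounded[OF k] by metis
  have Fcont: "continuous_on {S..T} (\<lambda>t. F (\<sigma> t \<omega>) (seg z t))"
    unfolding continuous_on_sequentially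
  proof (intro allI ballI impI, elim conjE)
    fix x :: "nat \<Rightarrow> real" and a assume x: "\<forall>n. x n \<in> {S..T}" "x \<longlonglongrightarrow> a" and a: "a \<in> {S..T}"
    have "(\<lambda>n. co_dist (seg z (x n)) (seg z a)) \<longlonglongrightarrow> 0"
    proof (subst co_dist_tendsto_zero_iff, use CX x a in force, use CX x a in force, intro allI impI)
      fix R e :: real assume "0 < e"
      then obtain d where d: "0 < d" "\<And>s t. s \<le> T \<Longrightarrow> t \<le> T \<Longrightarrow> dist s t < d \<Longrightarrow> dist (z s) (z t) < e"
        using ucb unfolding ucb_def uniformly_continuous_on_def by (meson atMost_iff)
      from tendstoD[OF x(2) d(1)]
      show "\<forall>\<^sub>F n in sequentially. \<forall>s\<in>{- R..0}. norm (seg z (x n) s - seg z a s) < e"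
      proof eventually_elim
        case (elim n)
        have "dist (z (x n + s)) (z (a + s)) < e" if "s \<le> 0" for s
          using x(1)[rule_format, of n] a that elim by (intro d(2)) (auto simp: dist_real_def)
        then show ?case by (auto simp: dist_norm)
      qed
    qed
    then show "((\<lambda>t. F (\<sigma> t \<omega>) (seg z t)) \<circ> x) \<longlonglongrightarrow> F (\<sigma> a \<omega>) (seg z a)"
      unfolding o_def using x a BB by (intro F_tendsto[OF k] flow_tendsto tendsto_const) auto
  qed
  have int: "D (seg z t) = D (seg z S) + integral {S..t} (\<lambda>t. F (\<sigma> t \<omega>) (seg z t))" if t: "t \<in> {S..T}" for t
  proof -
    have ftc: "((\<lambda>t. F (\<sigma> t (\<omega>s n)) (seg (v n) t)) has_integral (D (seg (v n) t) - D (seg (v n) S))) {S..t}" for n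
    proof (rule fundamental_theorem_of_calculus)
      fix x assume x: "x \<in> {S..t}"
      then have "((\<lambda>t. D (seg (v n) t)) has_vector_derivative F (\<sigma> x (\<omega>s n)) (seg (v n) x)) (at x within {S..T})"
        using ev[of n] t by (auto simp: evolves_def)
      then show "((\<lambda>t. D (seg (v n) t)) has_vector_derivative F (\<sigma> x (\<omega>s n)) (seg (v n) x)) (at x within {S..t})"
        by (rule has_vector_derivative_within_subset) (use t in auto)
    qed (use t in auto)
    have "(\<lambda>n. integral {S..t} (\<lambda>t. F (\<sigma> t (\<omega>s n)) (seg (v n) t))) \<longlonglongrightarrow> integral {S..t} (\<lambda>t. F (\<sigma> t \<omega>) (seg z t))"
    proof (rule dominated_convergence(2))
      show "(\<lambda>t. F (\<sigma> t (\<omega>s n)) (seg (v n) t)) integrable_on {S..t}" for n using ftc by blast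
      show "(\<lambda>_. M) integrable_on {S..t}" by (rule integrable_const_ivl)
      show "norm (F (\<sigma> x (\<omega>s n)) (seg (v n) x)) \<le> M" if "x \<in> {S..t}" for n x using that t by (intro M(2) BB) auto
    qed (use Flim t in auto)
    moreover have "integral {S..t} (\<lambda>t. F (\<sigma> t (\<omega>s n)) (seg (v n) t)) = D (seg (v n) t) - D (seg (v n) S)" for n
      using ftc by (rule integral_unique)
    ultimately have "(\<lambda>n. D (seg (v n) t) - D (seg (v n) S)) \<longlonglongrightarrow> integral {S..t} (\<lambda>t. F (\<sigma> t \<omega>) (seg z t))"
      by simp
    moreover have "(\<lambda>n. D (seg (v n) t) - D (seg (v n) S)) \<longlonglongrightarrow> D (seg z t) - D (seg z S)"
      using t by (intro tendsto_diff Dlim) auto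
    ultimately show ?thesis using LIMSEQ_unique by fastforce
  qed
  show "evolves S T \<omega> z"
    unfolding evolves_def
  proof (intro conjI ballI ucb)
    fix t assume t: "t \<in> {S..T}"
    have *: "((\<lambda>t. D (seg z S) + integral {S..t} (\<lambda>t. F (\<sigma> t \<omega>) (seg z t))) has_vector_derivative
        F (\<sigma> t \<omega>) (seg z t)) (at t within {S..T})"
      using has_vector_derivative_add[OF has_vector_derivative_const integral_has_vector_derivative[OF Fcont t]]
      by simp
    show "((\<lambda>t. D (seg z t)) has_vector_derivative F (\<sigma> t \<omega>) (seg z t)) (at t within {S..T})"
      by (rule has_vector_derivative_transform[OF t _ *]) (erule int)
  qed
qed

text \<open>Arzela-Ascoli is used on \<open>{0..T}\<close> only; on the negative half-line
  convergence is assumed. Equicontinuity of the histories is still needed, since the equation looks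
  back across 0.\<close>

lemma evolves_subsequence_limit:
  assumes \<omega>: "\<omega>s \<longlonglongrightarrow> \<omega>" and ev: "\<And>n. evolves 0 T (\<omega>s n) (v n)" and k: "0 < k"
    and bd: "\<And>n s. s \<le> T \<Longrightarrow> infnorm (v n s) \<le> k"
    and init: "\<And>e. 0 < e \<Longrightarrow> \<exists>d>0. \<forall>n s t. s \<le> 0 \<longrightarrow> t \<le> 0 \<longrightarrow> \<bar>s - t\<bar> < d \<longrightarrow> norm (v n s - v n t) < e"
    and y: "y \<in> BU" "(\<lambda>n. co_dist (seg (v n) 0) y) \<longlonglongrightarrow> 0" and T: "0 \<le> T"
  obtains r z where "strict_mono (r :: nat \<Rightarrow> nat)" "evolves 0 T \<omega> z" "seg z 0 = y"
    "\<And>t. t \<le> T \<Longrightarrow> (\<lambda>n. co_dist (seg (v (r n)) t) (seg z t)) \<longlonglongrightarrow> 0"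
proof -
  have equi: "\<exists>d>0. \<forall>n s t. s \<le> T \<longrightarrow> t \<le> T \<longrightarrow> \<bar>s - t\<bar> < d \<longrightarrow> norm (v n s - v n t) < e" if "0 < e" for e
    by (rule evolves_equicontinuous[OF ev k _ _ T that]) (erule bd init)+
  have AA: "\<exists>d. 0 < d \<and> (\<forall>n y. y \<in> {0..T} \<and> norm (x - y) < d \<longrightarrow> norm (v n x - v n y) < e)"
    if x: "x \<in> {0..T}" and e: "0 < e" for x e
  proof -
    obtain d where "0 < d" "\<And>n s t. s \<le> T \<Longrightarrow> t \<le> T \<Longrightarrow> \<bar>s - t\<bar> < d \<Longrightarrow> norm (v n s - v n t) < e"
      using equi[OF e] by blast
    then show ?thesis using x by (intro exI[of _ d]) auto
  qed
  have bd': "norm (v n x) \<le> CARD('m) * k" if "x \<in> {0..T}" for n x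
    using that by (intro order_trans[OF norm_le_card_infnorm mult_left_mono] bd) auto
  obtain g r where g: "continuous_on {0..T} g" "strict_mono (r :: nat \<Rightarrow> nat)"
    "\<And>e. 0 < e \<Longrightarrow> \<exists>N. \<forall>n x. n \<ge> N \<and> x \<in> {0..T} \<longrightarrow> norm (v (r n) x - g x) < e"
    using Arzela_Ascoli[of "{0..T}" v "CARD('m) * k", OF compact_Icc bd' AA] by blast
  \<comment> \<open>The two limits agree at 0, as both are limits of \<open>v (r n) 0\<close>, so
    the glued function is continuous.\<close>
  define z where "z s = (if s \<le> 0 then y s else g s)" for s
  have seg0: "seg z 0 = y" using y by (auto simp: seg_def z_def BU_def extensional_def fun_eq_iff)
  have CX: "seg (v n) 0 \<in> CX" "y \<in> CX" for n
    using evolves_BB[OF ev bd T, of n] y by (auto simp: BB_iff BU_in_CX)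
  have neg: "\<forall>\<^sub>F n in sequentially. \<forall>s\<in>{- R..0}. norm (v (r n) s - y s) < e" if "0 < e" for R e
  proof -
    have "\<forall>\<^sub>F n in sequentially. \<forall>s\<in>{- R..0}. norm (seg (v n) 0 s - y s) < e"
      using y(2) that unfolding co_dist_tendsto_zero_iff[OF CX] by blast
    then have "\<forall>\<^sub>F n in sequentially. \<forall>s\<in>{- R..0}. norm (seg (v (r n)) 0 s - y s) < e"
      by (rule eventually_subseq[OF g(2)])
    then show ?thesis by eventually_elim auto
  qed
  have g0: "g 0 = y 0"
  proof (rule LIMSEQ_unique)
    show "(\<lambda>n. v (r n) 0) \<longlonglongrightarrow> g 0"
      unfolding LIMSEQ_iff using g(3) T by fastforce
    show "(\<lambda>n. v (r n) 0) \<longlonglongrightarrow> y 0"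
    proof (rule tendstoI)
      fix e :: real assume "0 < e"
      from neg[OF this, of 0] show "\<forall>\<^sub>F n in sequentially. dist (v (r n) 0) (y 0) < e"
        by eventually_elim (auto simp: dist_norm)
    qed
  qed
  have cont: "continuous_on {..T} z"
  proof -
    have "continuous_on {..0} y" using y by (auto simp: BU_def uniformly_continuous_imp_continuous)
    then have "continuous_on {..0} z" by (rule continuous_on_eq) (auto simp: z_def)
    moreover have "continuous_on {0..T} z" by (rule continuous_on_eq[OF g(1)]) (auto simp: z_def g0)
    moreover have "{..T} = {..0} \<union> {0..T}" using T by auto
    ultimately show ?thesis using continuous_on_closed_Un[of "{..0}" "{0..T}" z] by auto
  qed
  have ucb: "ucb T z" using ucb_extend[OF _ cont, of 0] seg0 y(1) seg_in_BU_iff[of z 0] by simp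
  have lim: "\<forall>\<^sub>F n in sequentially. \<forall>s\<in>{R..T}. norm (v (r n) s - z s) < e" if "0 < e" for R e
  proof -
    have "\<forall>\<^sub>F n in sequentially. \<forall>s\<in>{0..T}. norm (v (r n) s - g s) < e"
      using g(3)[OF that] unfolding eventually_sequentially by blast
    with neg[OF that, of "- R"] show ?thesis
      by eventually_elim (auto simp: z_def g0)
  qed
  have "(\<lambda>n. \<omega>s (r n)) \<longlonglongrightarrow> \<omega>" using LIMSEQ_subseq_LIMSEQ[OF \<omega> g(2)] by (simp add: o_def)
  note L = evolves_limit(2,3)[OF this ev k _ ucb]
  show thesis
  proof (rule that[OF g(2) _ seg0])
    show "evolves 0 T \<omega> z" by (rule L(2)) (erule bd lim)+
    show "(\<lambda>n. co_dist (seg (v (r n)) t) (seg z t)) \<longlonglongrightarrow> 0" if "t \<le> T" for t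
      by (rule L(1)) (erule bd lim | rule that)+
  qed
qed

section \<open>Solutions and the local semiflow\<close>

text \<open>Uniqueness makes the definite description in \<open>sol_u\<close> proper, so any
  solution at hand computes it.\<close>

lemma sol_u_eq:
  assumes x: "x \<in> BU" and z: "evolves 0 t \<omega> z" "seg z 0 = x" and t: "0 \<le> t"
  shows "sol_u D F \<sigma> t \<omega> x = seg z t"
  unfolding sol_u_def
proof (rule the_equality)
  show "\<exists>z'. is_solution D F \<sigma> t \<omega> x z' \<and> seg z t = seg z' t"
    using z is_solution_iff[OF x t] by blast
  fix y assume "\<exists>z'. is_solution D F \<sigma> t \<omega> x z' \<and> y = seg z' t"
  then obtain z' where z': "evolves 0 t \<omega> z'" "seg z' 0 = x" "y = seg z' t"
    using is_solution_iff[OF x t] by blast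
  have "z' s = z s" if "s \<le> 0" for s
    using that fun_cong[OF trans[OF z'(2) z(2)[symmetric]], of s] by simp
  then have "z' s = z s" if "s \<le> t" for s using evolves_unique[OF z'(1) z(1)] that by blast
  then show "y = seg z t" unfolding z'(3) by (rule seg_cong)
qed

lemma sol_exists_iff:
  assumes "x \<in> BU" "0 \<le> t"
  shows "sol_exists D F \<sigma> t \<omega> x \<longleftrightarrow> (\<exists>z. evolves 0 t \<omega> z \<and> seg z 0 = x)"
  using assms by (simp add: sol_exists_def is_solution_iff)

lemma sol_u_in_BU:
  assumes "x \<in> BU" "sol_exists D F \<sigma> t \<omega> x"
  shows "sol_u D F \<sigma> t \<omega> x \<in> BU"
proof -
  have t: "0 \<le> t" using assms by (simp add: sol_exists_def)
  then obtain z where z: "evolves 0 t \<omega> z" "seg z 0 = x" using sol_exists_iff assms by blast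
  then have "seg z t \<in> BU" by (simp add: seg_in_BU_iff evolves_def)
  then show ?thesis using sol_u_eq[OF assms(1) z t] by simp
qed

lemma evolves_cong:
  assumes "evolves S T \<omega> v" "\<And>s. s \<le> T \<Longrightarrow> v s = z s"
  shows "evolves S T \<omega> z"
proof -
  have seg: "seg v t = seg z t" if "t \<le> T" for t using that assms(2) by (intro seg_cong) auto
  have "ucb T z" using assms(1) seg[of T] seg_in_BU_iff[of v T] seg_in_BU_iff[of z T] by (simp add: evolves_def)
  moreover have "((\<lambda>t. D (seg z t)) has_vector_derivative F (\<sigma> t \<omega>) (seg z t)) (at t within {S..T})"
    if t: "t \<in> {S..T}" for t
  proof -
    have "((\<lambda>t. D (seg v t)) has_vector_derivative F (\<sigma> t \<omega>) (seg z t)) (at t within {S..T})"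
      using assms(1) t unfolding evolves_def seg[symmetric, OF t[THEN atLeastAtMost_iff[THEN iffD1], THEN conjunct2]] by blast
    then show ?thesis by (rule has_vector_derivative_transform[OF t, rotated]) (use seg in auto)
  qed
  ultimately show ?thesis by (simp add: evolves_def)
qed

lemma D_seg_diff:
  assumes "seg x t \<in> BU" "seg y t \<in> BU"
  shows "seg (\<lambda>s. x s - y s) t \<in> BU" "D (seg (\<lambda>s. x s - y s) t) = D (seg x t) - D (seg y t)"
proof -
  have ucb: "ucb t x" "ucb t y" using assms by (simp_all add: seg_in_BU_iff)
  have "ucb t (\<lambda>s. x s - y s)" by (intro ucb_diff ucb)
  then show BU: "seg (\<lambda>s. x s - y s) t \<in> BU" by (simp add: seg_in_BU_iff)
  show "D (seg (\<lambda>s. x s - y s) t) = D (seg x t) - D (seg y t)"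
  proof (subst vec_eq_iff, intro allI)
    fix i
    have "(LINT s|\<nu> i j. seg (\<lambda>s. x s - y s) t s $ j) = (LINT s|\<nu> i j. seg x t s $ j) - (LINT s|\<nu> i j. seg y t s $ j)" for j
    proof -
      have "(LINT s|\<nu> i j. seg (\<lambda>s. x s - y s) t s $ j) = (LINT s|\<nu> i j. seg x t s $ j - seg y t s $ j)"
        by (rule Bochner_Integration.integral_cong) (auto simp: D_measures(4)[OF D])
      then show ?thesis
        using BU_integrable[OF D assms(1)] BU_integrable[OF D assms(2)] by simp
    qed
    then show "D (seg (\<lambda>s. x s - y s) t) $ i = (D (seg x t) - D (seg y t)) $ i"
      by (simp add: D_nth[OF D] BU assms sum_subtractf)
  qed
qed

end

section \<open>The orbit and its omega-limit set\<close>

locale delay_orbit = delay_flow \<nu> D w q \<sigma> F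
  for \<nu> :: "'m::finite \<Rightarrow> 'm \<Rightarrow> real measure" and D w q
    and \<sigma> :: "real \<Rightarrow> 'w::metric_space \<Rightarrow> 'w" and F +
  fixes \<omega>0 :: 'w and x0 :: "'m hist"
  assumes compact_base: "compact (UNIV :: 'w set)" and x0: "x0 \<in> BU"
    and global: "\<And>t. 0 \<le> t \<Longrightarrow> sol_exists D F \<sigma> t \<omega>0 x0"
    and rel_compact: "relatively_compact (forward_orbit D F \<sigma> \<omega>0 x0)"
begin

section \<open>The orbit as one function of time\<close>

text \<open>\<open>sol_u\<close> selects a history separately for each time; \<open>Z\<close>
  collects their end values, so that the whole orbit consists of segments of a single
  function.\<close>

definition Z :: "real \<Rightarrow> real^'m" where
  "Z t = (if t \<le> 0 then x0 t else sol_u D F \<sigma> t \<omega>0 x0 0)"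

lemma Z_evolves: "0 \<le> T \<Longrightarrow> evolves 0 T \<omega>0 Z" and Z_init: "seg Z 0 = x0"
proof -
  show Z0: "seg Z 0 = x0" using x0 by (auto simp: seg_def Z_def BU_def extensional_def fun_eq_iff)
  assume T: "0 \<le> T"
  obtain z where z: "evolves 0 T \<omega>0 z" "seg z 0 = x0" using sol_exists_iff[OF x0 T] global[OF T] by blast
  have "z s = Z s" if "s \<le> T" for s
  proof (cases "s \<le> 0")
    case True
    then show ?thesis using fun_cong[OF z(2), of s] by (simp add: Z_def)
  next
    case False
    then have "sol_u D F \<sigma> s \<omega>0 x0 = seg z s"
      using that by (intro sol_u_eq[OF x0 evolves_subinterval[OF z(1)] z(2)]) auto
    then show ?thesis using False by (simp add: Z_def)
  qed
  then show "evolves 0 T \<omega>0 Z" by (rule evolves_cong[OF z(1)])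
qed

lemma sol_u_orbit: "0 \<le> t \<Longrightarrow> sol_u D F \<sigma> t \<omega>0 x0 = seg Z t"
  using sol_u_eq[OF x0 Z_evolves Z_init] by blast

lemma Z_ucb: "ucb T Z"
proof (cases "0 \<le> T")
  case True then show ?thesis using Z_evolves by (simp add: evolves_def)
next
  case False
  then show ?thesis using ucb_mono[of 0 Z T] x0 seg_in_BU_iff[of Z 0] Z_init by simp
qed

lemma segZ_CX: "seg Z t \<in> CX"
  using Z_ucb by (simp add: BU_in_CX seg_in_BU_iff)

text \<open>The closure is taken in the larger space, so the limit is known only to be continuous;
  \<open>orbit_limit_in_BB\<close> later puts it into a ball of \<open>BU\<close>.\<close>

lemma orbit_subsequence:
  assumes "\<And>n. 0 \<le> s n"
  obtains r y where "strict_mono (r :: nat \<Rightarrow> nat)" "y \<in> CX" "(\<lambda>n. co_dist (seg Z (s (r n))) y) \<longlonglongrightarrow> 0"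
proof -
  define C where "C = pmt closure_of (forward_orbit D F \<sigma> \<omega>0 x0)"
  have top: "topspace (pmt :: ('w \<times> 'm hist) topology) = UNIV \<times> CX"
    by (simp add: pmt_def co_top_def Metric_space.topspace_mtopology[OF Metric_space_CX])
  have "forward_orbit D F \<sigma> \<omega>0 x0 \<subseteq> C"
    unfolding C_def by (rule closure_of_subset) (auto simp: top forward_orbit_def sol_u_orbit segZ_CX)
  then have u: "seg Z t \<in> snd ` C" if "0 \<le> t" for t
    using that by (force simp: forward_orbit_def sol_u_orbit intro: image_eqI[where x = "(\<sigma> t \<omega>0, seg Z t)"])
  have "compactin pmt C" using rel_compact by (simp add: relatively_compact_def C_def)
  moreover have "continuous_map (pmt :: ('w \<times> 'm hist) topology) co_top snd" unfolding pmt_def by (rule continuous_map_snd)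
  ultimately have "compactin co_top (snd ` C)" by (rule image_compactin)
  then have "\<exists>l r. l \<in> snd ` C \<and> strict_mono r \<and> limitin co_top ((\<lambda>n. seg Z (s n)) \<circ> r) l sequentially"
    unfolding co_top_def Metric_space.compactin_sequentially[OF Metric_space_CX]
    using u assms by (auto elim!: allE[where x = "\<lambda>n. seg Z (s n)"])
  then show thesis
    using that unfolding co_top_def Metric_space.limitin_metric_dist_null[OF Metric_space_CX] o_def by blast
qed

text \<open>Evaluation at 0 is continuous for the distance, so values of \<open>Z\<close> at
  unbounded size would contradict the convergence of a subsequence of segments.\<close>

lemma Z_bounded: obtains k where "0 < k" "\<And>t. infnorm (Z t) \<le> k"
proof -
  have "\<exists>k>0. \<forall>t\<ge>0. infnorm (Z t) \<le> k"
  proof (rule ccontr)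
    assume "\<not> (\<exists>k>0. \<forall>t\<ge>0. infnorm (Z t) \<le> k)"
    then have "\<exists>t\<ge>0. real (Suc n) < infnorm (Z t)" for n
      by (metis not_le of_nat_0_less_iff zero_less_Suc)
    then obtain s where s: "\<And>n. 0 \<le> s n" "\<And>n. real (Suc n) < infnorm (Z (s n))" by metis
    obtain r y where r: "strict_mono (r :: nat \<Rightarrow> nat)" "y \<in> CX" "(\<lambda>n. co_dist (seg Z (s (r n))) y) \<longlonglongrightarrow> 0"
      using orbit_subsequence[OF s(1)] .
    have "\<forall>\<^sub>F n in sequentially. \<forall>s'\<in>{- 0..0}. norm (seg Z (s (r n)) s' - y s') < 1"
      using r(3)[unfolded co_dist_tendsto_zero_iff[OF segZ_CX r(2)], rule_format, OF zero_less_one] .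
    then obtain N where N: "\<And>n. N \<le> n \<Longrightarrow> norm (Z (s (r n)) - y 0) < 1"
      by (auto simp: eventually_sequentially)
    obtain n where n: "1 + norm (y 0) \<le> real n" using real_arch_simple by blast
    define m where "m = max n N"
    have "real (Suc (r m)) < norm (Z (s (r m)))" using s(2)[of "r m"] infnorm_le_norm[of "Z (s (r m))"] by linarith
    also have "\<dots> \<le> norm (Z (s (r m)) - y 0) + norm (y 0)" using norm_triangle_ineq[of "Z (s (r m)) - y 0" "y 0"] by simp
    also have "\<dots> \<le> real m" using N[of m] n by (simp add: m_def)
    finally show False using seq_suble[OF r(1), of m] by simp
  qed
  then obtain k1 where k1: "0 < k1" "\<And>t. 0 \<le> t \<Longrightarrow> infnorm (Z t) \<le> k1" by blast
  obtain k2 where k2: "0 < k2" "x0 \<in> BB k2" using BU_obtain_BB[OF x0] .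
  show thesis
  proof (rule that[of "max k1 k2"])
    show "infnorm (Z t) \<le> max k1 k2" for t
      using k1(2)[of t] k2(2) by (cases "t \<le> 0") (auto simp: BB_iff Z_def le_max_iff_disj)
  qed (use k1 in simp)
qed

text \<open>Along times where uniform continuity fails, a subsequence of segments converges
  uniformly on \<open>{- 1..0}\<close> to a continuous function, which is nearly constant close to
  0. Thus relative compactness yields a modulus of continuity valid on the whole line.\<close>

lemma Z_uniformly_continuous:
  assumes e: "0 < e"
  obtains d where "0 < d" "\<And>s t. \<bar>s - t\<bar> < d \<Longrightarrow> norm (Z s - Z t) < e"
proof -
  have "\<exists>d>0. \<forall>s t. 0 \<le> t \<longrightarrow> s \<le> t \<longrightarrow> t - s < d \<longrightarrow> norm (Z s - Z t) < e"
  proof (rule ccontr)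
    assume neg: "\<not> ?thesis"
    have "\<exists>s t. 0 \<le> t \<and> s \<le> t \<and> t - s < 1 / Suc n \<and> e \<le> norm (Z s - Z t)" for n
    proof (rule ccontr)
      assume "\<not> ?thesis"
      then have "\<forall>s t. 0 \<le> t \<longrightarrow> s \<le> t \<longrightarrow> t - s < 1 / Suc n \<longrightarrow> norm (Z s - Z t) < e" by (meson not_le)
      then show False using neg by (meson of_nat_0_less_iff zero_less_Suc zero_less_divide_1_iff)
    qed
    then obtain s t where st: "\<And>n. 0 \<le> t n" "\<And>n. s n \<le> t n" "\<And>n. t n - s n < 1 / Suc n"
      "\<And>n. e \<le> norm (Z (s n) - Z (t n))" by metis
    obtain r y where r: "strict_mono (r :: nat \<Rightarrow> nat)" "y \<in> CX" "(\<lambda>n. co_dist (seg Z (t (r n))) y) \<longlonglongrightarrow> 0"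
      using orbit_subsequence[OF st(1)] .
    have ev: "\<forall>\<^sub>F n in sequentially. \<forall>s'\<in>{- 1..0}. norm (seg Z (t (r n)) s' - y s') < e / 3"
      by (rule r(3)[unfolded co_dist_tendsto_zero_iff[OF segZ_CX r(2)], rule_format]) (use e in simp)
    have cy: "continuous_on {..0} y" using r(2) by (simp add: CX_def)
    have "\<exists>d>0. \<forall>s\<in>{..0}. dist s 0 < d \<longrightarrow> dist (y s) (y 0) < e / 3"
      by (rule cy[unfolded continuous_on_iff, rule_format]) (use e in auto)
    then obtain d where d: "0 < d" "\<And>s. s \<le> 0 \<Longrightarrow> dist s 0 < d \<Longrightarrow> dist (y s) (y 0) < e / 3"
      by auto
    obtain N where N: "1 / Suc N < d" using nat_approx_posE[OF d(1)] by blast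
    obtain n where n: "N \<le> n" "\<forall>s'\<in>{- 1..0}. norm (seg Z (t (r n)) s' - y s') < e / 3"
      using eventually_happens[OF eventually_conj[OF ev eventually_ge_at_top[of N]]] by auto
    define h where "h = s (r n) - t (r n)"
    have "1 / Suc (r n) \<le> 1 / Suc N"
      using seq_suble[OF r(1), of n] n(1) by (intro divide_left_mono) auto
    then have "- h < d" using st(3)[of "r n"] N unfolding h_def by linarith
    moreover have "- h < 1"
    proof -
      have "1 / Suc (r n) \<le> (1::real)" by simp
      then show ?thesis using st(3)[of "r n"] unfolding h_def by linarith
    qed
    moreover have "h \<le> 0" using st(2)[of "r n"] by (simp add: h_def)
    ultimately have h: "h \<le> 0" "- 1 \<le> h" "dist h 0 < d" by (auto simp: dist_real_def)
    have "norm (seg Z (t (r n)) h - y h) < e / 3" "norm (seg Z (t (r n)) 0 - y 0) < e / 3"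
      by (rule n(2)[rule_format], use h in simp)+
    then have "dist (Z (s (r n))) (y h) < e / 3" "dist (y 0) (Z (t (r n))) < e / 3"
      using h(1) by (simp_all add: h_def dist_norm norm_minus_commute)
    then have "dist (Z (s (r n))) (Z (t (r n))) < e" using d(2)[OF h(1,3)] dist_triangle_third by blast
    then show False using st(4)[of "r n"] by (simp add: dist_norm)
  qed
  then obtain d1 where d1: "0 < d1" "\<And>s t. 0 \<le> t \<Longrightarrow> s \<le> t \<Longrightarrow> t - s < d1 \<Longrightarrow> norm (Z s - Z t) < e" by blast
  have "uniformly_continuous_on {..0} Z" using Z_ucb by (simp add: ucb_def)
  then obtain d2 where d2: "0 < d2" "\<And>s t. s \<le> 0 \<Longrightarrow> t \<le> 0 \<Longrightarrow> dist s t < d2 \<Longrightarrow> dist (Z s) (Z t) < e"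
    unfolding uniformly_continuous_on_def using e by (meson atMost_iff)
  have *: "norm (Z s - Z t) < e" if "s \<le> t" "t - s < min d1 d2" for s t
    using d1(2)[of t s] d2(2)[of s t] that by (cases "0 \<le> t") (auto simp: dist_norm)
  show thesis
  proof (rule that[of "min d1 d2"])
    show "norm (Z s - Z t) < e" if "\<bar>s - t\<bar> < min d1 d2" for s t
      using *[of s t] *[of t s] that by (cases "s \<le> t") (auto simp: norm_minus_commute)
  qed (use d1 d2 in simp)
qed

section \<open>The omega-limit set and the solutions through its points\<close>

abbreviation K :: "('w \<times> 'm hist) set" where "K \<equiv> omega_limit D F \<sigma> \<omega>0 x0"

text \<open>The bound and the modulus of continuity of \<open>Z\<close> do not depend on the time
  shift, so both pass to pointwise limits of segments.\<close>

lemma orbit_limit_in_BB: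
  assumes k: "\<And>t. infnorm (Z t) \<le> k" and x: "x \<in> CX" and lim: "(\<lambda>n. co_dist (seg Z (t n)) x) \<longlonglongrightarrow> 0"
  shows "x \<in> BB k"
proof -
  have pt: "(\<lambda>n. Z (t n + s)) \<longlonglongrightarrow> x s" if "s \<le> 0" for s
  proof (rule tendstoI)
    fix e :: real assume "0 < e"
    then have "\<forall>\<^sub>F n in sequentially. \<forall>s\<in>{- (- s)..0}. norm (seg Z (t n) s - x s) < e"
      by (rule lim[unfolded co_dist_tendsto_zero_iff[OF segZ_CX x], rule_format])
    then show "\<forall>\<^sub>F n in sequentially. dist (Z (t n + s)) (x s) < e"
      by eventually_elim (use that in \<open>auto simp: dist_norm\<close>)
  qed
  have xk: "infnorm (x s) \<le> k" if "s \<le> 0" for s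
    unfolding infnorm_le_iff
  proof
    fix i
    have "(\<lambda>n. \<bar>Z (t n + s) $ i\<bar>) \<longlonglongrightarrow> \<bar>x s $ i\<bar>" by (intro tendsto_intros pt that)
    then show "\<bar>x s $ i\<bar> \<le> k"
      by (rule LIMSEQ_le_const2) (use k in \<open>auto simp: infnorm_le_iff\<close>)
  qed
  have "uniformly_continuous_on {..0} x"
    unfolding uniformly_continuous_on_def
  proof (intro allI impI)
    fix e :: real assume "0 < e"
    then obtain d where d: "0 < d" "\<And>s t. \<bar>s - t\<bar> < d \<Longrightarrow> norm (Z s - Z t) < e / 2"
      using Z_uniformly_continuous[of "e / 2"] by auto
    have "dist (x s') (x s) < e" if "s \<le> 0" "s' \<le> 0" "dist s' s < d" for s s'
    proof -
      have "(\<lambda>n. norm (Z (t n + s') - Z (t n + s))) \<longlonglongrightarrow> norm (x s' - x s)" by (intro tendsto_intros pt that)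
      then have "norm (x s' - x s) \<le> e / 2"
        by (rule LIMSEQ_le_const2) (use d(2) that in \<open>auto simp: dist_real_def intro!: less_imp_le\<close>)
      then show ?thesis using \<open>0 < e\<close> by (simp add: dist_norm)
    qed
    then show "\<exists>d>0. \<forall>s\<in>{..0}. \<forall>s'\<in>{..0}. dist s' s < d \<longrightarrow> dist (x s') (x s) < e" using d(1) by auto
  qed
  moreover have "bounded (x ` {..0})"
    unfolding bounded_iff using xk norm_le_card_infnorm
    by (metis (no_types, lifting) atMost_iff imageE mult_left_mono of_nat_0_le_iff order_trans)
  ultimately have "x \<in> BU" using x by (simp add: BU_def CX_def)
  then show ?thesis using xk by (simp add: BB_iff)
qed

text \<open>The definition asks for increasing times at which the solution exists. A sequence
  tending to infinity has a monotone subsequence, which cannot be decreasing; dropping its first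
  terms makes the times nonnegative.\<close>

lemma K_intro:
  assumes x: "x \<in> CX" and t: "filterlim t at_top sequentially"
    and \<omega>: "(\<lambda>n. \<sigma> (t n) \<omega>0) \<longlonglongrightarrow> \<omega>" and lim: "(\<lambda>n. co_dist (seg Z (t n)) x) \<longlonglongrightarrow> 0"
  shows "(\<omega>, x) \<in> K"
proof -
  obtain f where f: "strict_mono (f :: nat \<Rightarrow> nat)" "monoseq (t \<circ> f)" unfolding o_def using seq_monosub[of t] by blast
  have tf: "filterlim (t \<circ> f) at_top sequentially"
    unfolding o_def by (rule filterlim_compose[OF t filterlim_subseq[OF f(1)]])
  have inc: "incseq (t \<circ> f)"
  proof (rule ccontr)
    assume "\<not> incseq (t \<circ> f)"
    then have "decseq (t \<circ> f)" using f(2) monoseq_iff by blast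
    then have "(t \<circ> f) n \<le> (t \<circ> f) 0" for n by (simp add: decseq_def)
    moreover have "\<exists>n. (t \<circ> f) 0 + 1 \<le> (t \<circ> f) n"
      by (rule eventually_happens'[OF sequentially_bot]) (use tf in \<open>unfold filterlim_at_top, blast\<close>)
    ultimately show False by (metis add_le_same_cancel1 not_one_le_zero order_trans)
  qed
  have "\<forall>\<^sub>F n in sequentially. 0 \<le> (t \<circ> f) n" using tf by (simp add: filterlim_at_top)
  then obtain N where N: "\<And>n. N \<le> n \<Longrightarrow> 0 \<le> (t \<circ> f) n" by (auto simp: eventually_sequentially)
  define g where "g n = f (n + N)" for n
  have g: "strict_mono g" using f(1) by (auto simp: g_def strict_mono_def)
  have pos: "0 \<le> t (g n)" for n using N[of "n + N"] by (simp add: g_def)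
  obtain k where k: "0 < k" "\<And>t. infnorm (Z t) \<le> k" using Z_bounded by metis
  have "x \<in> BU" using orbit_limit_in_BB[OF k(2) x lim] by (simp add: BB_iff)
  moreover have "incseq (\<lambda>n. t (g n))" using inc by (auto simp: g_def incseq_def)
  moreover have "filterlim (\<lambda>n. t (g n)) at_top sequentially"
    by (rule filterlim_compose[OF t filterlim_subseq[OF g]])
  moreover have "(\<lambda>n. \<sigma> (t (g n)) \<omega>0) \<longlonglongrightarrow> \<omega>"
    using LIMSEQ_subseq_LIMSEQ[OF \<omega> g] by (simp add: o_def)
  moreover have "(\<lambda>n. co_dist (sol_u D F \<sigma> (t (g n)) \<omega>0 x0) x) \<longlonglongrightarrow> 0"
    using LIMSEQ_subseq_LIMSEQ[OF lim g] pos by (simp add: o_def sol_u_orbit)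
  ultimately show ?thesis unfolding omega_limit_def using pos global by blast
qed

lemma K_elim:
  assumes "(\<omega>, x) \<in> K"
  obtains t where "filterlim t at_top sequentially" "\<And>n. 0 \<le> t n"
    "(\<lambda>n. \<sigma> (t n) \<omega>0) \<longlonglongrightarrow> \<omega>" "(\<lambda>n. co_dist (seg Z (t n)) x) \<longlonglongrightarrow> 0"
proof -
  obtain t where t: "filterlim t at_top sequentially" "\<And>n. sol_exists D F \<sigma> (t n) \<omega>0 x0"
    "(\<lambda>n. \<sigma> (t n) \<omega>0) \<longlonglongrightarrow> \<omega>" "(\<lambda>n. co_dist (sol_u D F \<sigma> (t n) \<omega>0 x0) x) \<longlonglongrightarrow> 0"
    using assms by (auto simp: omega_limit_def)
  have "0 \<le> t n" for n using t(2) by (simp add: sol_exists_def)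
  then show thesis using that t by (simp add: sol_u_orbit)
qed

lemma K_BU: "(\<omega>, x) \<in> K \<Longrightarrow> x \<in> BU"
  by (simp add: omega_limit_def)

lemma K_BB:
  assumes "\<And>t. infnorm (Z t) \<le> k" "(\<omega>, x) \<in> K"
  shows "x \<in> BB k"
  using K_elim[OF assms(2)] orbit_limit_in_BB[OF assms(1) BU_in_CX[OF K_BU[OF assms(2)]]] by metis

lemma orbit_shift_evolves:
  assumes "0 \<le> a + S" "0 \<le> a + T"
  shows "evolves S T (\<sigma> a \<omega>0) (\<lambda>t. Z (a + t))"
  using evolves_shift[OF evolves_subinterval[OF Z_evolves[OF assms(2)] assms(1) order_refl], of a] by simp

lemma seg_orbit_shift: "seg (\<lambda>t. Z (a + t)) s = seg Z (a + s)"
  by (simp add: seg_def add.assoc)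

text \<open>One sequence of times serves all \<open>s \<le> T\<close>: the solution through a point
  of \<open>K\<close> is a limit of shifts of \<open>Z\<close>. Invariance of \<open>K\<close> and
  the transfer of stability both rest on this.\<close>

lemma K_orbit_limit:
  assumes "(\<omega>, x) \<in> K" and T: "0 \<le> T"
  obtains t z where "filterlim t at_top sequentially" "\<And>n. 0 \<le> t n" "(\<lambda>n. \<sigma> (t n) \<omega>0) \<longlonglongrightarrow> \<omega>"
    "evolves 0 T \<omega> z" "seg z 0 = x" "\<And>s. s \<le> T \<Longrightarrow> (\<lambda>n. co_dist (seg Z (t n + s)) (seg z s)) \<longlonglongrightarrow> 0"
proof -
  obtain t where t: "filterlim t at_top sequentially" "\<And>n. 0 \<le> t n"
    "(\<lambda>n. \<sigma> (t n) \<omega>0) \<longlonglongrightarrow> \<omega>" "(\<lambda>n. co_dist (seg Z (t n)) x) \<longlonglongrightarrow> 0"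
    using K_elim[OF assms(1)] by metis
  obtain k where k: "0 < k" "\<And>t. infnorm (Z t) \<le> k" using Z_bounded by metis
  have x: "x \<in> BU" using assms(1) K_BU by blast
  obtain r z where rz: "strict_mono (r :: nat \<Rightarrow> nat)" "evolves 0 T \<omega> z" "seg z 0 = x"
    "\<And>s. s \<le> T \<Longrightarrow> (\<lambda>n. co_dist (seg (\<lambda>s. Z (t (r n) + s)) s) (seg z s)) \<longlonglongrightarrow> 0"
  proof (rule evolves_subsequence_limit[OF t(3), of T "\<lambda>n s. Z (t n + s)" k x])
    show "evolves 0 T (\<sigma> (t n) \<omega>0) (\<lambda>s. Z (t n + s))" for n using t(2)[of n] T by (intro orbit_shift_evolves) auto
    show "\<exists>d>0. \<forall>n s s'. s \<le> 0 \<longrightarrow> s' \<le> 0 \<longrightarrow> \<bar>s - s'\<bar> < d \<longrightarrow> norm (Z (t n + s) - Z (t n + s')) < e"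
      if e: "0 < e" for e
    proof -
      obtain d where "0 < d" "\<And>s t. \<bar>s - t\<bar> < d \<Longrightarrow> norm (Z s - Z t) < e"
        using Z_uniformly_continuous[OF e] by metis
      then show ?thesis by (intro exI[of _ d]) auto
    qed
    show "(\<lambda>n. co_dist (seg (\<lambda>s. Z (t n + s)) 0) x) \<longlonglongrightarrow> 0" using t(4) by (simp add: seg_orbit_shift)
  qed (use k x T in auto)
  show thesis
  proof (rule that[OF _ _ _ rz(2,3)])
    show "filterlim (\<lambda>n. t (r n)) at_top sequentially"
      by (rule filterlim_compose[OF t(1) filterlim_subseq[OF rz(1)]])
    show "(\<lambda>n. \<sigma> (t (r n)) \<omega>0) \<longlonglongrightarrow> \<omega>"
      using LIMSEQ_subseq_LIMSEQ[OF t(3) rz(1)] by (simp add: o_def)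
    show "(\<lambda>n. co_dist (seg Z (t (r n) + s)) (seg z s)) \<longlonglongrightarrow> 0" if "s \<le> T" for s
      using rz(4)[OF that] by (simp add: seg_orbit_shift)
  qed (rule t)
qed

lemma K_orbit:
  assumes "(\<omega>, x) \<in> K" and T: "0 \<le> T"
  obtains z where "evolves 0 T \<omega> z" "seg z 0 = x" "\<And>t. t \<le> T \<Longrightarrow> (\<sigma> t \<omega>, seg z t) \<in> K"
proof -
  obtain t z where t: "filterlim t at_top sequentially" "\<And>n. 0 \<le> t n" "(\<lambda>n. \<sigma> (t n) \<omega>0) \<longlonglongrightarrow> \<omega>"
    and z: "evolves 0 T \<omega> z" "seg z 0 = x"
    and lim: "\<And>s. s \<le> T \<Longrightarrow> (\<lambda>n. co_dist (seg Z (t n + s)) (seg z s)) \<longlonglongrightarrow> 0"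
    by (rule K_orbit_limit[OF assms], rule that) blast+
  have "(\<sigma> s \<omega>, seg z s) \<in> K" if s: "s \<le> T" for s
  proof (rule K_intro[where t = "\<lambda>n. t n + s"])
    have "ucb T z" using z(1) by (simp add: evolves_def)
    then show "seg z s \<in> CX" using ucb_mono s by (intro BU_in_CX) (auto simp: seg_in_BU_iff)
    show "filterlim (\<lambda>n. t n + s) at_top sequentially"
      using filterlim_tendsto_add_at_top[OF tendsto_const[of s] t(1)] by (simp add: add.commute)
    have "(\<lambda>n. \<sigma> s (\<sigma> (t n) \<omega>0)) \<longlonglongrightarrow> \<sigma> s \<omega>" by (intro flow_tendsto tendsto_const t)
    then show "(\<lambda>n. \<sigma> (t n + s) \<omega>0) \<longlonglongrightarrow> \<sigma> s \<omega>" by (simp add: flow_add)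
  qed (rule lim[OF s])
  then show thesis by (rule that[OF z])
qed

lemma K_forward:
  assumes K: "(\<omega>, x) \<in> K" and t: "0 \<le> t"
  shows "sol_exists D F \<sigma> t \<omega> x" "(\<sigma> t \<omega>, sol_u D F \<sigma> t \<omega> x) \<in> K"
proof -
  obtain z where z: "evolves 0 t \<omega> z" "seg z 0 = x" "\<And>s. s \<le> t \<Longrightarrow> (\<sigma> s \<omega>, seg z s) \<in> K"
    by (rule K_orbit[OF K t], rule that) blast+
  then show "sol_exists D F \<sigma> t \<omega> x" "(\<sigma> t \<omega>, sol_u D F \<sigma> t \<omega> x) \<in> K"
    using sol_u_eq[OF K_BU[OF K] z(1,2) t] sol_exists_iff[OF K_BU[OF K] t] by auto
qed

lemma K_pos_invariant: "pos_invariant D F \<sigma> K"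
  unfolding pos_invariant_def
proof (intro conjI)
  show "K \<subseteq> UNIV \<times> BU" using K_BU by auto
  show "\<forall>(\<omega>, x)\<in>K. \<forall>t\<ge>0. sol_exists D F \<sigma> t \<omega> x \<and> (\<sigma> t \<omega>, sol_u D F \<sigma> t \<omega> x) \<in> K"
    using K_forward by (intro ballI, clarsimp)
qed

text \<open>The past of the point is recorded in its own history, and the times of the approximating
  orbit points, shifted by \<open>s\<close>, still tend to infinity.\<close>

lemma K_backward:
  assumes "(\<omega>, x) \<in> K" "s \<le> 0"
  shows "(\<sigma> s \<omega>, seg x s) \<in> K"
proof -
  obtain z where "evolves 0 0 \<omega> z" "seg z 0 = x" "(\<sigma> s \<omega>, seg z s) \<in> K"
    using K_orbit[OF assms(1) order_refl] assms(2) by metis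
  moreover have "seg (seg z 0) s = seg z s" using seg_seg[OF assms(2), of z 0] by simp
  ultimately show ?thesis by simp
qed

text \<open>The shift of \<open>Z\<close> by \<open>t n\<close> solves the equation from time
  \<open>- t n\<close> on, hence on \<open>{S..0}\<close> once \<open>n\<close> is large; this
  passes to the limit \<open>x\<close> for every \<open>S\<close>.\<close>

lemma K_backward_evolves:
  assumes K: "(\<omega>, x) \<in> K"
  shows "evolves S 0 \<omega> x"
proof -
  obtain t where t: "filterlim t at_top sequentially" "\<And>n. 0 \<le> t n"
    "(\<lambda>n. \<sigma> (t n) \<omega>0) \<longlonglongrightarrow> \<omega>" "(\<lambda>n. co_dist (seg Z (t n)) x) \<longlonglongrightarrow> 0"
    using K_elim[OF assms(1)] by metis
  obtain k where k: "0 < k" "\<And>t. infnorm (Z t) \<le> k" using Z_bounded by metis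
  have "\<forall>\<^sub>F n in sequentially. - S \<le> t n" using t(1) by (simp add: filterlim_at_top)
  then obtain N where N: "\<And>n. N \<le> n \<Longrightarrow> - S \<le> t n" by (auto simp: eventually_sequentially)
  have x: "x \<in> BU" using K K_BU by blast
  show ?thesis
  proof (rule evolves_limit(3)[of "\<lambda>n. \<sigma> (t (n + N)) \<omega>0" \<omega> S 0 "\<lambda>n s. Z (t (n + N) + s)"])
    show "(\<lambda>n. \<sigma> (t (n + N)) \<omega>0) \<longlonglongrightarrow> \<omega>" using LIMSEQ_ignore_initial_segment[OF t(3)] .
    show "evolves S 0 (\<sigma> (t (n + N)) \<omega>0) (\<lambda>s. Z (t (n + N) + s))" for n
      using N[of "n + N"] t(2)[of "n + N"] by (intro orbit_shift_evolves) auto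
    show "ucb 0 x" using x seg_in_BU_iff[of x 0] seg_zero[OF x] by simp
    fix R e :: real assume "0 < e"
    then have "\<forall>\<^sub>F n in sequentially. \<forall>s\<in>{- (- R)..0}. norm (seg Z (t n) s - x s) < e"
      by (rule t(4)[unfolded co_dist_tendsto_zero_iff[OF segZ_CX BU_in_CX[OF x]], rule_format])
    then have "\<forall>\<^sub>F n in sequentially. \<forall>s\<in>{- (- R)..0}. norm (seg Z (t (n + N)) s - x s) < e"
      by (rule eventually_sequentially_seg[THEN iffD2])
    then show "\<forall>\<^sub>F n in sequentially. \<forall>s\<in>{R..0}. norm (Z (t (n + N) + s) - x s) < e"
      by eventually_elim auto
  qed (use k in auto)
qed

section \<open>Compactness of the omega-limit set\<close>

text \<open>Approximate the \<open>n\<close>-th point within \<open>1 / Suc n\<close> by an orbit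
  point at a time beyond \<open>n\<close>. Compactness of the orbit closure and of the base then
  gives a limit, which lies in \<open>K\<close> because the times tend to infinity.\<close>

lemma K_subsequence:
  assumes "\<And>n. (\<omega>s n, x n) \<in> K"
  obtains r \<omega> y where "strict_mono (r :: nat \<Rightarrow> nat)" "(\<omega>, y) \<in> K" "(\<lambda>n. \<omega>s (r n)) \<longlonglongrightarrow> \<omega>"
    "(\<lambda>n. co_dist (x (r n)) y) \<longlonglongrightarrow> 0"
proof -
  have xCX: "x n \<in> CX" for n using assms K_BU BU_in_CX by blast
  have "\<exists>s\<ge>real n. dist (\<sigma> s \<omega>0) (\<omega>s n) < 1 / Suc n \<and> co_dist (seg Z s) (x n) < 1 / Suc n" for n
  proof -
    obtain t where t: "filterlim t at_top sequentially" "\<And>n. 0 \<le> t n"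
      "(\<lambda>m. \<sigma> (t m) \<omega>0) \<longlonglongrightarrow> \<omega>s n" "(\<lambda>m. co_dist (seg Z (t m)) (x n)) \<longlonglongrightarrow> 0"
      using K_elim[OF assms] by metis
    have "\<forall>\<^sub>F m in sequentially. real n \<le> t m" using t(1) by (simp add: filterlim_at_top)
    moreover have "\<forall>\<^sub>F m in sequentially. dist (\<sigma> (t m) \<omega>0) (\<omega>s n) < 1 / Suc n" by (rule tendstoD[OF t(3)]) simp
    moreover have "\<forall>\<^sub>F m in sequentially. co_dist (seg Z (t m)) (x n) < 1 / Suc n" by (rule order_tendstoD(2)[OF t(4)]) simp
    ultimately have "\<forall>\<^sub>F m in sequentially. real n \<le> t m \<and> dist (\<sigma> (t m) \<omega>0) (\<omega>s n) < 1 / Suc n \<and> co_dist (seg Z (t m)) (x n) < 1 / Suc n"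
      by eventually_elim simp
    then show ?thesis by (auto simp: eventually_sequentially)
  qed
  then obtain s where s: "\<And>n. real n \<le> s n" "\<And>n. dist (\<sigma> (s n) \<omega>0) (\<omega>s n) < 1 / Suc n"
    "\<And>n. co_dist (seg Z (s n)) (x n) < 1 / Suc n" by metis
  have s0: "0 \<le> s n" for n using s(1)[of n] by linarith
  obtain r1 y where r1: "strict_mono (r1 :: nat \<Rightarrow> nat)" "y \<in> CX" "(\<lambda>n. co_dist (seg Z (s (r1 n))) y) \<longlonglongrightarrow> 0"
    using orbit_subsequence[OF s0] .
  obtain \<omega> r2 where r2: "strict_mono (r2 :: nat \<Rightarrow> nat)" "((\<lambda>n. \<sigma> (s (r1 n)) \<omega>0) \<circ> r2) \<longlonglongrightarrow> \<omega>"
    using compact_base unfolding compact_def by blast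
  define r where "r = r1 \<circ> r2"
  have r: "strict_mono r" unfolding r_def using strict_mono_o r1(1) r2(1) by blast
  have small: "(\<lambda>n. 1 / real (Suc (r n))) \<longlonglongrightarrow> 0"
    using LIMSEQ_subseq_LIMSEQ[OF LIMSEQ_inverse_real_of_nat r] by (simp add: o_def inverse_eq_divide)
  have \<sigma>lim: "(\<lambda>n. \<sigma> (s (r n)) \<omega>0) \<longlonglongrightarrow> \<omega>" using r2(2) by (simp add: o_def r_def)
  have ulim: "(\<lambda>n. co_dist (seg Z (s (r n))) y) \<longlonglongrightarrow> 0"
    using LIMSEQ_subseq_LIMSEQ[OF r1(3) r2(1)] by (simp add: o_def r_def)
  show thesis
  proof (rule that[OF r])
    have "filterlim s at_top sequentially"
      by (rule filterlim_at_top_mono[OF filterlim_real_sequentially]) (use s(1) in auto)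
    then show "(\<omega>, y) \<in> K"
      by (intro K_intro[OF r1(2) _ \<sigma>lim ulim] filterlim_compose[OF _ filterlim_subseq[OF r]])
    show "(\<lambda>n. \<omega>s (r n)) \<longlonglongrightarrow> \<omega>"
      unfolding tendsto_dist_iff[of _ \<omega>]
    proof (rule tendsto_sandwich[OF _ _ tendsto_const])
      show "(\<lambda>n. 1 / real (Suc (r n)) + dist (\<sigma> (s (r n)) \<omega>0) \<omega>) \<longlonglongrightarrow> 0"
        using tendsto_add[OF small \<sigma>lim[unfolded tendsto_dist_iff[of _ \<omega>]]] by simp
      have "dist (\<omega>s (r n)) \<omega> \<le> 1 / real (Suc (r n)) + dist (\<sigma> (s (r n)) \<omega>0) \<omega>" for n
        using s(2)[of "r n"] dist_triangle3[of "\<omega>s (r n)" \<omega> "\<sigma> (s (r n)) \<omega>0"] by linarith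
      then show "\<forall>\<^sub>F n in sequentially. dist (\<omega>s (r n)) \<omega> \<le> 1 / real (Suc (r n)) + dist (\<sigma> (s (r n)) \<omega>0) \<omega>"
        by (intro always_eventually allI)
    qed (intro always_eventually allI zero_le_dist)
    show "(\<lambda>n. co_dist (x (r n)) y) \<longlonglongrightarrow> 0"
    proof (rule tendsto_sandwich[OF _ _ tendsto_const])
      show "(\<lambda>n. 1 / real (Suc (r n)) + co_dist (seg Z (s (r n))) y) \<longlonglongrightarrow> 0"
        using tendsto_add[OF small ulim] by simp
      have "co_dist (x (r n)) y \<le> 1 / real (Suc (r n)) + co_dist (seg Z (s (r n))) y" for n
        using s(3)[of "r n"] co_dist_triangle[OF xCX segZ_CX r1(2), of "r n" "s (r n)"]
          co_dist_commute[of "x (r n)" "seg Z (s (r n))"] by linarith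
      then show "\<forall>\<^sub>F n in sequentially. co_dist (x (r n)) y \<le> 1 / real (Suc (r n)) + co_dist (seg Z (s (r n))) y"
        by (intro always_eventually allI)
    qed (intro always_eventually allI co_dist_nonneg)
  qed
qed

lemma K_compact: "compactin pmt K"
proof -
  interpret P: Metric_space12 "UNIV :: 'w set" dist "CX :: 'm hist set" co_dist
    by (intro Metric_space12.intro Metric_space_CX Met_TC.Metric_space_axioms)
  have top: "P.Prod_metric.mtopology = (pmt :: ('w \<times> 'm hist) topology)"
    by (simp add: P.mtopology_prod_metric pmt_def co_top_def)
  show ?thesis
    unfolding top[symmetric] P.Prod_metric.compactin_sequentially
  proof (intro conjI allI impI)
    show "K \<subseteq> UNIV \<times> CX" using K_BU BU_in_CX by auto
    fix p :: "nat \<Rightarrow> 'w \<times> 'm hist" assume "range p \<subseteq> K"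
    then have p: "(fst (p n), snd (p n)) \<in> K" for n by auto
    obtain r \<omega> y where r: "strict_mono (r :: nat \<Rightarrow> nat)" "(\<omega>, y) \<in> K" "(\<lambda>n. fst (p (r n))) \<longlonglongrightarrow> \<omega>"
      "(\<lambda>n. co_dist (snd (p (r n))) y) \<longlonglongrightarrow> 0"
      using K_subsequence[OF p] .
    have "limitin co_top (\<lambda>n. snd (p (r n))) y sequentially"
      unfolding co_top_def Metric_space.limitin_metric_dist_null[OF Metric_space_CX]
      using r(4) K_BU[OF p] K_BU[OF r(2)] BU_in_CX by auto
    then have "limitin P.Prod_metric.mtopology (p \<circ> r) (\<omega>, y) sequentially"
      using r(3) unfolding top pmt_def limitin_pairwise by (simp add: o_def)
    then show "\<exists>l r. l \<in> K \<and> strict_mono r \<and> limitin P.Prod_metric.mtopology (p \<circ> r) l sequentially"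
      using r by blast
  qed
qed

end

section \<open>Stability of the omega-limit set\<close>

context delay_orbit
begin

section \<open>Regularity of points of the omega-limit set and of their differences\<close>

lemma K_seg_BU: "(\<omega>, x) \<in> K \<Longrightarrow> t \<le> 0 \<Longrightarrow> seg x t \<in> BU"
  using K_backward K_BU by blast

text \<open>For fixed \<open>h\<close> the increments of \<open>D\<close> along the past of
  \<open>x\<close> are at most \<open>M * h\<close>, at every \<open>s \<le> 0\<close>, since
  \<open>x\<close> solves the equation on its entire past. The contraction over all
  \<open>s \<le> 0\<close> keeps this linear in \<open>h\<close>.\<close>

lemma K_lipschitz:
  obtains L where "0 < L" "\<And>\<omega> x t h. (\<omega>, x) \<in> K \<Longrightarrow> t \<le> 0 \<Longrightarrow> 0 \<le> h \<Longrightarrow> norm (x t - x (t - h)) \<le> L * h"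
proof -
  obtain a b where ab: "0 < a" "0 < b" "\<And>v. wnorm w v \<le> a * norm v" "\<And>v. norm v \<le> b * wnorm w v"
    using wnorm_equiv[of w] w by metis
  obtain k where k: "0 < k" "\<And>t. infnorm (Z t) \<le> k" using Z_bounded by metis
  obtain M where M: "0 < M" "\<And>\<omega> x. x \<in> BB k \<Longrightarrow> norm (F \<omega> x) \<le> M" using F_bounded[OF k(1)] by metis
  define L where "L = b * (a * M / (1 - q))"
  show thesis
  proof (rule that)
    show "0 < L" using ab M(1) q(2) by (simp add: L_def)
    fix \<omega> x and t h :: real assume K: "(\<omega>, x) \<in> K" and t: "t \<le> 0" and h: "0 \<le> h"
    have xk: "infnorm (x s) \<le> k" if "s \<le> 0" for s using K_BB[OF k(2) K] that by (simp add: BB_iff)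
    define g where "g s = wnorm w (x s - x (s - h))" for s
    have "g t \<le> (a * (M * h)) / (1 - q)"
    proof (rule contraction_bound[where S = "{..0}" and g = g])
      show "bdd_above (g ` {..0})"
      proof (rule bdd_aboveI2)
        fix s :: real assume "s \<in> {..0}"
        then have "norm (x s) \<le> CARD('m) * k" "norm (x (s - h)) \<le> CARD('m) * k"
          using h by (intro order_trans[OF norm_le_card_infnorm mult_left_mono] xk; simp)+
        then have "norm (x s - x (s - h)) \<le> CARD('m) * k + CARD('m) * k"
          using norm_triangle_ineq4[of "x s" "x (s - h)"] by linarith
        then show "g s \<le> a * (CARD('m) * k + CARD('m) * k)"
          unfolding g_def using ab(1) by (intro order_trans[OF ab(3) mult_left_mono]) auto
      qed
      fix c assume c: "0 \<le> c" "\<forall>s\<in>{..0}. g s \<le> c"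
      show "\<forall>s\<in>{..0}. g s \<le> a * (M * h) + q * c"
      proof
        fix s :: real assume "s \<in> {..0}"
        then have s: "s \<le> 0" by simp
        have "norm (D (seg x s) - D (seg x (s - h))) \<le> M * \<bar>s - (s - h)\<bar>"
          by (rule evolves_D_lipschitz[OF K_backward_evolves[OF K, of "s - h"] xk M(2)]) (use s h in auto)
        then have "wnorm w (D (seg x s) - D (seg x (s - h))) \<le> a * (M * h)"
          using ab(1) h by (intro order_trans[OF ab(3) mult_left_mono]) auto
        moreover have "wnorm w (seg x s 0 - seg x (s - h) 0) \<le> wnorm w (D (seg x s) - D (seg x (s - h))) + q * c"
        proof (intro D_diff_bound K_seg_BU[OF K] c)
          fix r :: real assume "r \<le> 0"
          then show "wnorm w (seg x s r - seg x (s - h) r) \<le> c"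
            using c(2)[rule_format, of "s + r"] s by (simp add: g_def algebra_simps)
        qed (use s h in auto)
        ultimately show "g s \<le> a * (M * h) + q * c" by (simp add: g_def)
      qed
    qed (use t q wnorm_nonneg[of w] w in \<open>auto simp: g_def\<close>)
    then have "norm (x t - x (t - h)) \<le> b * ((a * (M * h)) / (1 - q))"
      using ab(2) unfolding g_def by (intro order_trans[OF ab(4) mult_left_mono]) auto
    then show "norm (x t - x (t - h)) \<le> L * h" by (simp add: L_def mult_ac)
  qed
qed

text \<open>By contradiction and compactness: a shift by at most \<open>N\<close> into the past
  keeps two close histories close, so the shifted pairs have a common limit in \<open>K\<close>, and
  by (F3) both values of \<open>F\<close> converge to the same vector.\<close>

lemma K_close_F:
  assumes \<eta>: "0 < \<eta>"
  obtains \<delta> where "0 < \<delta>" "\<And>\<omega> x y s. (\<omega>, x) \<in> K \<Longrightarrow> (\<omega>, y) \<in> K \<Longrightarrow> co_dist x y < \<delta> \<Longrightarrow> s \<in> {- N..0} \<Longrightarrow>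
    norm (F (\<sigma> s \<omega>) (seg x s) - F (\<sigma> s \<omega>) (seg y s)) \<le> \<eta>"
proof (rule ccontr)
  assume "\<not> thesis"
  then have neg: "\<not> (\<exists>\<delta>>0. \<forall>\<omega> x y s. (\<omega>, x) \<in> K \<longrightarrow> (\<omega>, y) \<in> K \<longrightarrow> co_dist x y < \<delta> \<longrightarrow> s \<in> {- N..0} \<longrightarrow>
    norm (F (\<sigma> s \<omega>) (seg x s) - F (\<sigma> s \<omega>) (seg y s)) \<le> \<eta>)" using that by blast
  have "\<exists>\<omega> x y s. (\<omega>, x) \<in> K \<and> (\<omega>, y) \<in> K \<and> co_dist x y < 1 / Suc n \<and> s \<in> {- N..0} \<and>
      \<eta> < norm (F (\<sigma> s \<omega>) (seg x s) - F (\<sigma> s \<omega>) (seg y s))" for n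
  proof (rule ccontr)
    assume none: "\<not> ?thesis"
    have "\<exists>\<delta>>0. \<forall>\<omega> x y s. (\<omega>, x) \<in> K \<longrightarrow> (\<omega>, y) \<in> K \<longrightarrow> co_dist x y < \<delta> \<longrightarrow> s \<in> {- N..0} \<longrightarrow>
      norm (F (\<sigma> s \<omega>) (seg x s) - F (\<sigma> s \<omega>) (seg y s)) \<le> \<eta>"
    proof (intro exI[of _ "1 / real (Suc n)"] conjI allI impI)
      show "0 < 1 / real (Suc n)" by simp
    next
      fix \<omega> x y s assume "(\<omega>, x) \<in> K" "(\<omega>, y) \<in> K" "co_dist x y < 1 / real (Suc n)" "s \<in> {- N..0}"
      then show "norm (F (\<sigma> s \<omega>) (seg x s) - F (\<sigma> s \<omega>) (seg y s)) \<le> \<eta>" using none not_le by blast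
    qed
    then show False using neg by blast
  qed
  then obtain \<omega> x y s where K: "\<And>n. (\<omega> n, x n) \<in> K" "\<And>n. (\<omega> n, y n) \<in> K"
    and close: "\<And>n. co_dist (x n) (y n) < 1 / Suc n" and s: "\<And>n. s n \<in> {- N..0}"
    and far: "\<And>n. \<eta> < norm (F (\<sigma> (s n) (\<omega> n)) (seg (x n) (s n)) - F (\<sigma> (s n) (\<omega> n)) (seg (y n) (s n)))"
    by metis
  have s0: "s n \<le> 0" for n using s[of n] by simp
  obtain r \<omega>' x' where r: "strict_mono (r :: nat \<Rightarrow> nat)" "(\<omega>', x') \<in> K"
    "(\<lambda>n. \<sigma> (s (r n)) (\<omega> (r n))) \<longlonglongrightarrow> \<omega>'" "(\<lambda>n. co_dist (seg (x (r n)) (s (r n))) x') \<longlonglongrightarrow> 0"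
    using K_subsequence[of "\<lambda>n. \<sigma> (s n) (\<omega> n)" "\<lambda>n. seg (x n) (s n)", OF K_backward[OF K(1) s0]] .
  have CX: "x n \<in> CX" "y n \<in> CX" for n using K K_BU BU_in_CX by blast+
  have CXs: "seg (x n) (s n) \<in> CX" "seg (y n) (s n) \<in> CX" "x' \<in> CX" for n
    using K_seg_BU[OF K(1) s0] K_seg_BU[OF K(2) s0] K_BU[OF r(2)] BU_in_CX by blast+
  have "(\<lambda>n. co_dist (x n) (y n)) \<longlonglongrightarrow> 0"
  proof (rule tendsto_sandwich[OF _ _ tendsto_const])
    show "(\<lambda>n. 1 / real (Suc n)) \<longlonglongrightarrow> 0"
      using LIMSEQ_inverse_real_of_nat by (simp add: inverse_eq_divide)
  qed (use close less_imp_le co_dist_nonneg in \<open>blast intro: always_eventually\<close>)+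
  note xy = this[unfolded co_dist_tendsto_zero_iff[OF CX], rule_format]
  have "(\<lambda>n. co_dist (seg (x n) (s n)) (seg (y n) (s n))) \<longlonglongrightarrow> 0"
    unfolding co_dist_tendsto_zero_iff[OF CXs(1,2)]
  proof (intro allI impI)
    fix R e :: real assume "0 < e"
    from xy[OF this, of "R + N"]
    show "\<forall>\<^sub>F n in sequentially. \<forall>t\<in>{- R..0}. norm (seg (x n) (s n) t - seg (y n) (s n) t) < e"
    proof eventually_elim
      case (elim n)
      show ?case
      proof
        fix t assume "t \<in> {- R..0}"
        then have "s n + t \<in> {- (R + N)..0}" using s[of n] by auto
        then show "norm (seg (x n) (s n) t - seg (y n) (s n) t) < e" using elim \<open>t \<in> {- R..0}\<close> by simp
      qed
    qed
  qed
  from LIMSEQ_subseq_LIMSEQ[OF this r(1)]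
  have sub: "(\<lambda>n. co_dist (seg (x (r n)) (s (r n))) (seg (y (r n)) (s (r n)))) \<longlonglongrightarrow> 0" by (simp add: o_def)
  have y': "(\<lambda>n. co_dist (seg (y (r n)) (s (r n))) x') \<longlonglongrightarrow> 0"
  proof (rule tendsto_sandwich[OF _ _ tendsto_const])
    show "(\<lambda>n. co_dist (seg (x (r n)) (s (r n))) (seg (y (r n)) (s (r n))) + co_dist (seg (x (r n)) (s (r n))) x') \<longlonglongrightarrow> 0"
      using tendsto_add[OF sub r(4)] by simp
    have "co_dist (seg (y (r n)) (s (r n))) x' \<le>
        co_dist (seg (x (r n)) (s (r n))) (seg (y (r n)) (s (r n))) + co_dist (seg (x (r n)) (s (r n))) x'" for n
      using co_dist_triangle[OF CXs(2,1,3), of "r n" "r n"]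
        co_dist_commute[of "seg (y (r n)) (s (r n))"] by simp
    then show "\<forall>\<^sub>F n in sequentially. co_dist (seg (y (r n)) (s (r n))) x' \<le>
        co_dist (seg (x (r n)) (s (r n))) (seg (y (r n)) (s (r n))) + co_dist (seg (x (r n)) (s (r n))) x'"
      by (intro always_eventually allI)
  qed (intro always_eventually allI co_dist_nonneg)
  obtain k where k: "0 < k" "\<And>t. infnorm (Z t) \<le> k" using Z_bounded by metis
  note BB = K_BB[OF k(2)]
  have "(\<lambda>n. F (\<sigma> (s (r n)) (\<omega> (r n))) (seg (x (r n)) (s (r n)))) \<longlonglongrightarrow> F \<omega>' x'"
    by (rule F_tendsto[OF k(1) r(3) BB[OF K_backward[OF K(1) s0]] BB[OF r(2)] r(4)])
  moreover have "(\<lambda>n. F (\<sigma> (s (r n)) (\<omega> (r n))) (seg (y (r n)) (s (r n)))) \<longlonglongrightarrow> F \<omega>' x'"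
    by (rule F_tendsto[OF k(1) r(3) BB[OF K_backward[OF K(2) s0]] BB[OF r(2)] y'])
  ultimately have "(\<lambda>n. norm (F (\<sigma> (s (r n)) (\<omega> (r n))) (seg (x (r n)) (s (r n)))
      - F (\<sigma> (s (r n)) (\<omega> (r n))) (seg (y (r n)) (s (r n))))) \<longlonglongrightarrow> norm (F \<omega>' x' - F \<omega>' x')"
    by (intro tendsto_intros)
  then have "\<eta> \<le> norm (F \<omega>' x' - F \<omega>' x')"
    by (rule LIMSEQ_le_const) (use far less_imp_le in blast)
  then show False using \<eta> by simp
qed

text \<open>Closeness of the derivatives of \<open>t \<mapsto> D x\<^sub>t\<close> passes to the differences of \<open>x\<close> itself through the
  contraction estimate for \<open>D\<close>; each application costs a time shift \<open>R\<close> beyond which \<open>\<nu>\<close>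
  has little mass.\<close>

lemma K_close_lipschitz:
  assumes \<eta>: "0 < \<eta>" and N: "0 \<le> N"
  obtains \<delta> where "0 < \<delta>" "\<And>\<omega> x y t h. (\<omega>, x) \<in> K \<Longrightarrow> (\<omega>, y) \<in> K \<Longrightarrow> co_dist x y < \<delta> \<Longrightarrow> t \<in> {- N..0} \<Longrightarrow>
    0 \<le> h \<Longrightarrow> h \<le> 1 \<Longrightarrow> norm ((x t - y t) - (x (t - h) - y (t - h))) \<le> \<eta> * h"
proof -
  obtain a b where ab: "0 < a" "0 < b" "\<And>v. wnorm w v \<le> a * norm v" "\<And>v. norm v \<le> b * wnorm w v"
    using wnorm_equiv[of w] w by metis
  obtain L where L: "0 < L" "\<And>\<omega> x t h. (\<omega>, x) \<in> K \<Longrightarrow> t \<le> 0 \<Longrightarrow> 0 \<le> h \<Longrightarrow> norm (x t - x (t - h)) \<le> L * h"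
    by (rule K_lipschitz, rule that) blast+
  define C where "C = a * (L + L)"
  have C: "0 < C" using ab(1) L(1) by (simp add: C_def)
  \<comment> \<open>Chosen so that \<open>b * T\<close>, with the next constant, equals
    \<open>2 * \<eta> / 3\<close>.\<close>
  define \<theta> where "\<theta> = \<eta> * (1 - q) / (3 * b)"
  have \<theta>: "0 < \<theta>" using \<eta> q(2) ab(2) by (simp add: \<theta>_def)
  \<comment> \<open>The fixed point of the recursion that one contraction step produces: one
    \<open>\<theta>\<close> comes from the derivative, one from the tail of
    \<open>\<nu>\<close>.\<close>
  define T where "T = 2 * \<theta> / (1 - q)"
  have T: "0 \<le> T" "2 * \<theta> + q * T = T" using \<theta> q(2) by (auto simp: T_def field_simps)
  obtain R where R: "0 \<le> R" "\<And>i. (\<Sum>j\<in>UNIV. measure (\<nu> i j) {..<- R} * w $ j) \<le> \<theta> / C * w $ i"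
    by (rule D_tail[OF divide_pos_pos[OF \<theta> C]], rule that) blast+
  \<comment> \<open>After \<open>J\<close> steps the contribution of the global Lipschitz constant
    \<open>C\<close> is below \<open>\<eta> / 3\<close>.\<close>
  obtain J where J: "q ^ J < \<eta> / (3 * b * C)" using real_arch_pow_inv[OF _ q(2), of "\<eta> / (3 * b * C)"] \<eta> ab(2) C by auto
  \<comment> \<open>Each step reaches back another \<open>R\<close>; the last 1 leaves room for
    \<open>h \<le> 1\<close>.\<close>
  define N0 where "N0 = N + real J * R + 1"
  obtain \<delta> where \<delta>: "0 < \<delta>" "\<And>\<omega> x y s. (\<omega>, x) \<in> K \<Longrightarrow> (\<omega>, y) \<in> K \<Longrightarrow> co_dist x y < \<delta> \<Longrightarrow> s \<in> {- N0..0} \<Longrightarrow>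
    norm (F (\<sigma> s \<omega>) (seg x s) - F (\<sigma> s \<omega>) (seg y s)) \<le> \<theta> / a"
    by (rule K_close_F[OF divide_pos_pos[OF \<theta> ab(1)], of N0], rule that) blast+
  show thesis
  proof (rule that[OF \<delta>(1)])
    fix \<omega> x y and t h :: real assume K: "(\<omega>, x) \<in> K" "(\<omega>, y) \<in> K" and d: "co_dist x y < \<delta>"
      and t: "t \<in> {- N..0}" and h: "0 \<le> h" "h \<le> 1"
    define p where "p s = x s - y s" for s
    have segBU: "seg p s \<in> BU" and Dp: "D (seg p s) = D (seg x s) - D (seg y s)" if "s \<le> 0" for s
      unfolding p_def[abs_def] using D_seg_diff[OF K_seg_BU[OF K(1) that] K_seg_BU[OF K(2) that]] by auto
    have glob: "wnorm w (p s - p (s - h)) \<le> C * h" if "s \<le> 0" for s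
    proof -
      have eq: "p s - p (s - h) = (x s - x (s - h)) - (y s - y (s - h))" by (simp add: p_def)
      have "norm (p s - p (s - h)) \<le> L * h + L * h"
        using L(2)[OF K(1) that h(1)] L(2)[OF K(2) that h(1)] norm_triangle_ineq4[of "x s - x (s - h)" "y s - y (s - h)"]
        unfolding eq by linarith
      then have "wnorm w (p s - p (s - h)) \<le> a * (L * h + L * h)"
        using ab(1) by (intro order_trans[OF ab(3) mult_left_mono]) auto
      then show ?thesis by (simp add: C_def algebra_simps)
    qed
    have Dlip: "wnorm w (D (seg p s) - D (seg p (s - h))) \<le> \<theta> * h" if s: "s \<le> 0" "- N0 \<le> s - h" for s
    proof -
      have "norm ((D (seg x s) - D (seg y s)) - (D (seg x (s - h)) - D (seg y (s - h)))) \<le> \<theta> / a * \<bar>s - (s - h)\<bar>"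
      proof (rule vector_derivative_lipschitz[of "- N0" 0])
        fix r assume r: "r \<in> {- N0..0}"
        show "((\<lambda>s. D (seg x s) - D (seg y s)) has_vector_derivative F (\<sigma> r \<omega>) (seg x r) - F (\<sigma> r \<omega>) (seg y r))
            (at r within {- N0..0})"
          using r by (intro has_vector_derivative_diff
              K_backward_evolves[OF K(1), unfolded evolves_def, THEN conjunct2, rule_format]
              K_backward_evolves[OF K(2), unfolded evolves_def, THEN conjunct2, rule_format])
        show "norm (F (\<sigma> r \<omega>) (seg x r) - F (\<sigma> r \<omega>) (seg y r)) \<le> \<theta> / a" by (rule \<delta>(2)[OF K d r])
      qed (use s h in auto)
      then have "norm (D (seg p s) - D (seg p (s - h))) \<le> \<theta> / a * h"
        using s h by (simp add: Dp)
      then have "wnorm w (D (seg p s) - D (seg p (s - h))) \<le> a * (\<theta> / a * h)"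
        using ab(1) by (intro order_trans[OF ab(3) mult_left_mono]) auto
      then show ?thesis using ab(1) by simp
    qed
    \<comment> \<open>With each step the estimate improves, while the interval where it holds loses
      length \<open>R\<close> on the left, down to \<open>{- N..0}\<close> at
      \<open>j = J\<close>.\<close>
    have step: "wnorm w (p s - p (s - h)) \<le> (q ^ j * C + T) * h"
      if "j \<le> J" "s \<le> 0" "- (N + real (J - j) * R) \<le> s" for j s
      using that
    proof (induction j arbitrary: s)
      case 0
      have "0 \<le> T * h" using T(1) h(1) by simp
      then show ?case using glob[OF 0(2)] by (simp add: distrib_right)
    next
      case (Suc j)
      define c where "c = (q ^ j * C + T) * h"
      have c: "0 \<le> c" using q C T(1) h(1) by (simp add: c_def)
      have JR: "real (J - j) * R = real (J - Suc j) * R + R"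
        using Suc.prems(1) by (simp add: of_nat_diff algebra_simps)
      have "real (J - Suc j) * R \<le> real J * R" using R(1) by (intro mult_right_mono) auto
      then have sN0: "- N0 \<le> s - h" using Suc.prems(3) h(2) by (simp add: N0_def)
      have "wnorm w (seg p s 0 - seg p (s - h) 0) \<le> wnorm w (D (seg p s) - D (seg p (s - h))) + q * c + \<theta> * h"
      proof (rule D_diff_bound_tail[where R = R and C = "C * h"])
        show "seg p s \<in> BU" "seg p (s - h) \<in> BU" using Suc.prems h by (auto intro!: segBU)
        show "0 \<le> C * h" using C h(1) by simp
        fix u :: real assume u: "u \<le> 0"
        have eq: "seg p s u - seg p (s - h) u = p (s + u) - p (s + u - h)" using u by (simp add: algebra_simps)
        show "wnorm w (seg p s u - seg p (s - h) u) \<le> c + C * h"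
          unfolding eq using glob[of "s + u"] Suc.prems u c by simp
        assume "- R \<le> u"
        then show "wnorm w (seg p s u - seg p (s - h) u) \<le> c"
          unfolding eq c_def using Suc.prems u JR by (intro Suc.IH) auto
      next
        fix i
        show "C * h * (\<Sum>j\<in>UNIV. measure (\<nu> i j) {..<- R} * w $ j) \<le> \<theta> * h * w $ i"
        proof -
          have "C * h * (\<Sum>j\<in>UNIV. measure (\<nu> i j) {..<- R} * w $ j) \<le> C * h * (\<theta> / C * w $ i)"
            using C h(1) by (intro mult_left_mono R(2)) auto
          also have "\<dots> = \<theta> * h * w $ i" using C by simp
          finally show ?thesis .
        qed
      qed (use c R in auto)
      also have "\<dots> \<le> \<theta> * h + q * c + \<theta> * h" using Dlip[OF Suc.prems(2) sN0] by simp
      also have "\<dots> = (q ^ Suc j * C + T) * h"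
      proof -
        have "\<theta> * h + q * c + \<theta> * h = (q * (q ^ j * C) + (2 * \<theta> + q * T)) * h"
          by (simp add: c_def algebra_simps)
        then show ?thesis unfolding T(2) by (simp add: mult.assoc)
      qed
      finally show ?case by simp
    qed
    have "wnorm w (p t - p (t - h)) \<le> (q ^ J * C + T) * h" using step[of J t] t by simp
    then have "norm (p t - p (t - h)) \<le> b * ((q ^ J * C + T) * h)"
      using ab(2) by (intro order_trans[OF ab(4) mult_left_mono]) auto
    also have "\<dots> = b * (q ^ J * C) * h + b * T * h" by (simp add: algebra_simps)
    also have "\<dots> \<le> \<eta> / 3 * h + 2 * \<eta> / 3 * h"
    proof (intro add_mono mult_right_mono h)
      show "b * (q ^ J * C) \<le> \<eta> / 3" using J ab(2) C by (simp add: field_simps)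
      show "b * T \<le> 2 * \<eta> / 3" using ab(2) q(2) by (simp add: \<theta>_def T_def)
    qed
    also have "\<dots> = \<eta> * h" by simp
    finally show "norm ((x t - y t) - (x (t - h) - y (t - h))) \<le> \<eta> * h" by (simp add: p_def)
  qed
qed

section \<open>Transfer of stability from the orbit to the omega-limit set\<close>

text \<open>The distance is bounded, so only a small value of it bounds the norm. The first summand
  has weight 1/2, hence 1/8 forces \<open>p0 / (1 + p0) \<le> 1 / 4\<close>, and then
  \<open>p0 \<le> 1\<close>.\<close>

lemma orbit_perturbation_bound:
  assumes k: "\<And>t. infnorm (Z t) \<le> k" and d: "co_dist (seg Z t) (seg v s) \<le> 1 / 8" and BU: "seg v s \<in> BU"
  shows "infnorm (v s) \<le> k + 1"
proof -
  note p = co_dist_summand[OF segZ_CX[of t] BU_in_CX[OF BU]]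
  define p0 where "p0 = seminorm_on (Suc 0) (\<lambda>r. seg Z t r - seg v s r)"
  define X where "X = p0 / (1 + p0)"
  have "(1/2) ^ Suc 0 * X \<le> 1 / 8" using order_trans[OF p(5) d, of 0] unfolding X_def p0_def .
  then have "X \<le> 1 / 4" by simp
  then have "p0 / (1 + p0) \<le> 1 / 4" by (simp only: X_def)
  moreover have p00: "0 \<le> p0" unfolding p0_def by (rule p(1))
  ultimately have "p0 \<le> 1" by (simp add: divide_le_eq)
  moreover have "infnorm (seg Z t 0 - seg v s 0) \<le> p0" unfolding p0_def by (rule p(2)) simp
  ultimately have "infnorm (Z t - v s) \<le> 1" by simp
  then show ?thesis using infnorm_triangle[of "v s - Z t" "Z t"] k[of t] infnorm_sub[of "v s" "Z t"] by simp
qed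

text \<open>A perturbation \<open>y\<close> of a point \<open>x\<close> of \<open>K\<close> is transported to the perturbations
  \<open>u(t\<^sub>n) + (y - x)\<close> of the orbit, to which the stability of the orbit applies.\<close>

lemma K_set_stable:
  assumes le: "translation_invariant le"
    and stable: "orbit_stable_le_bounded le D F \<sigma> \<omega>0 x0"
  shows "set_stable_le_bounded le D F \<sigma> K"
  unfolding set_stable_le_bounded_def set_stable_le_in_def
proof (intro allI impI conjI K_pos_invariant)
  fix k \<epsilon> :: real assume k: "0 < k" and \<epsilon>: "0 < \<epsilon>"
  obtain k0 where k0: "0 < k0" "\<And>t. infnorm (Z t) \<le> k0" using Z_bounded by metis
  \<comment> \<open>Bounds an orbit segment plus \<open>y - x\<close>, with \<open>y\<close> in
    \<open>BB k\<close> and \<open>x\<close> in \<open>BB k0\<close>.\<close>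
  define k1 where "k1 = k0 + (k + k0)"
  have k1: "0 < k1" using k0 k by (simp add: k1_def)
  \<comment> \<open>The cap keeps the perturbed solutions uniformly bounded, by
    \<open>orbit_perturbation_bound\<close>, which the passage to a limiting solution
    requires.\<close>
  define \<epsilon>' where "\<epsilon>' = min \<epsilon> (1/8)"
  have \<epsilon>': "0 < \<epsilon>'" "\<epsilon>' \<le> \<epsilon>" "\<epsilon>' \<le> 1/8" using \<epsilon> by (auto simp: \<epsilon>'_def)
  have "\<exists>\<delta>>0. \<forall>s\<ge>0. \<forall>x\<in>BB k1.
        co_dist (sol_u D F \<sigma> s \<omega>0 x0) x \<le> \<delta>
        \<and> (le x (sol_u D F \<sigma> s \<omega>0 x0) \<or> le (sol_u D F \<sigma> s \<omega>0 x0) x) \<longrightarrow>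
        (\<forall>t\<ge>0. sol_exists D F \<sigma> t (\<sigma> s \<omega>0) x
           \<and> co_dist (sol_u D F \<sigma> (t + s) \<omega>0 x0) (sol_u D F \<sigma> t (\<sigma> s \<omega>0) x) \<le> \<epsilon>')"
    using stable[unfolded orbit_stable_le_bounded_def orbit_stable_le_in_def, rule_format, OF k1 \<epsilon>'(1)] .
  then obtain \<delta> where \<delta>0: "0 < \<delta>" and stab: "\<forall>s\<ge>0. \<forall>x\<in>BB k1.
        co_dist (sol_u D F \<sigma> s \<omega>0 x0) x \<le> \<delta>
        \<and> (le x (sol_u D F \<sigma> s \<omega>0 x0) \<or> le (sol_u D F \<sigma> s \<omega>0 x0) x) \<longrightarrow>
        (\<forall>t\<ge>0. sol_exists D F \<sigma> t (\<sigma> s \<omega>0) x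
           \<and> co_dist (sol_u D F \<sigma> (t + s) \<omega>0 x0) (sol_u D F \<sigma> t (\<sigma> s \<omega>0) x) \<le> \<epsilon>')"
    by (elim exE conjE)
  have \<delta>: "sol_exists D F \<sigma> t (\<sigma> s \<omega>0) x \<and> co_dist (seg Z (t + s)) (sol_u D F \<sigma> t (\<sigma> s \<omega>0) x) \<le> \<epsilon>'"
    if "0 \<le> s" "x \<in> BB k1" "co_dist (seg Z s) x \<le> \<delta>" "le x (seg Z s) \<or> le (seg Z s) x" "0 \<le> t" for s x t
    using stab[rule_format, OF that(1,2), of t] that sol_u_orbit[of s] sol_u_orbit[of "t + s"] by simp
  have "sol_exists D F \<sigma> T \<omega> y \<and> co_dist (sol_u D F \<sigma> T \<omega> x) (sol_u D F \<sigma> T \<omega> y) \<le> \<epsilon>"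
    if K: "(\<omega>, x) \<in> K" and y: "y \<in> BB k" and d: "co_dist x y < \<delta>" and ord: "le x y \<or> le y x" and T: "0 \<le> T"
    for \<omega> x y T
  proof -
    obtain t z where t: "filterlim t at_top sequentially" "\<And>n. 0 \<le> t n" "(\<lambda>n. \<sigma> (t n) \<omega>0) \<longlonglongrightarrow> \<omega>"
      and z: "evolves 0 T \<omega> z" "seg z 0 = x"
      and lim: "\<And>s. s \<le> T \<Longrightarrow> (\<lambda>n. co_dist (seg Z (t n + s)) (seg z s)) \<longlonglongrightarrow> 0"
      by (rule K_orbit_limit[OF K T], rule that) blast+
    have x: "x \<in> BU" "x \<in> BB k0" using K_BU[OF K] K_BB[OF k0(2) K] by auto
    have yBU: "y \<in> BU" using y by (simp add: BB_iff)
    \<comment> \<open>Taking the segment at 0 makes the perturbed history extensional, as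
      \<open>BU\<close> demands.\<close>
    define Y where "Y n = seg (\<lambda>s. Z (t n + s) + (y s - x s)) 0" for n
    have Y: "Y n s = Z (t n + s) + (y s - x s)" if "s \<le> 0" for n s using that by (simp add: Y_def)
    have uc_yx: "uniformly_continuous_on {..0} (\<lambda>s. y s - x s)"
      using x yBU by (auto simp: BU_def intro: uniformly_continuous_on_diff)
    have YBU: "Y n \<in> BU" for n
    proof -
      have "seg Z (t n) \<in> BU" using Z_ucb seg_in_BU_iff by blast
      then have "uniformly_continuous_on {..0} (\<lambda>s. seg Z (t n) s + (y s - x s))" "bounded ((\<lambda>s. seg Z (t n) s + (y s - x s)) ` {..0})"
        using x(1) yBU uc_yx
        by (auto simp: BU_def intro!: uniformly_continuous_on_add bounded_plus_comp bounded_minus_comp)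
      then have "ucb 0 (\<lambda>s. seg Z (t n) s + (y s - x s))" by (simp add: ucb_def)
      then have "seg (\<lambda>s. seg Z (t n) s + (y s - x s)) 0 \<in> BU" by (simp add: seg_in_BU_iff)
      moreover have "seg (\<lambda>s. seg Z (t n) s + (y s - x s)) 0 = Y n" unfolding Y_def by (rule seg_cong) simp
      ultimately show ?thesis by simp
    qed
    have YBB: "Y n \<in> BB k1" for n
      unfolding BB_iff
    proof (intro conjI allI impI YBU)
      fix s :: real assume s: "s \<le> 0"
      have "infnorm (y s - x s) \<le> k + k0"
        using infnorm_triangle[of "y s" "- x s"] y x(2) s by (simp add: BB_iff infnorm_neg) (smt (verit))
      then show "infnorm (Y n s) \<le> k1"
        using infnorm_triangle[of "Z (t n + s)" "y s - x s"] k0(2)[of "t n + s"] by (simp add: Y[OF s] k1_def)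
    qed
    have "co_dist (seg Z (t n)) (Y n) = co_dist x y" for n
      by (rule co_dist_cong) (use segZ_CX x yBU YBU BU_in_CX Y in auto)
    then have close: "co_dist (seg Z (t n)) (Y n) \<le> \<delta>" for n using d by simp
    have "le (Y n) (seg Z (t n)) \<or> le (seg Z (t n)) (Y n)" for n
      using ord
    proof
      assume "le x y" then have "le (seg Z (t n)) (Y n)" by (rule translation_invariantD[OF le]) (simp add: Y)
      then show ?thesis ..
    next
      assume "le y x" then have "le (Y n) (seg Z (t n))" by (rule translation_invariantD[OF le]) (simp add: Y)
      then show ?thesis ..
    qed
    note st = \<delta>[OF t(2) YBB close this]
    have "\<exists>v. evolves 0 T (\<sigma> (t n) \<omega>0) v \<and> seg v 0 = Y n" for n
      using st[OF T] sol_exists_iff[OF YBU T] by blast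
    then obtain v where v: "\<And>n. evolves 0 T (\<sigma> (t n) \<omega>0) (v n)" "\<And>n. seg (v n) 0 = Y n" by metis
    have v0: "v n s = Z (t n + s) + (y s - x s)" if "s \<le> 0" for n s
      using fun_cong[OF v(2), of n s] that by (simp add: Y)
    have vdist: "co_dist (seg Z (s + t n)) (seg (v n) s) \<le> \<epsilon>'" if "0 \<le> s" "s \<le> T" for n s
      using st[OF that(1), of n] sol_u_eq[OF YBU evolves_subinterval[OF v(1) order_refl that(2)] v(2) that(1)] by simp
    have vk: "infnorm (v n s) \<le> k1 + 1" if "s \<le> T" for n s
    proof (cases "s \<le> 0")
      case True
      then have "infnorm (Y n s) \<le> k1" using YBB[of n] by (simp add: BB_iff)
      then show ?thesis using v0[OF True, of n] Y[OF True, of n] by simp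
    next
      case False
      have "seg (v n) s \<in> BU"
        using ucb_mono[OF conjunct1[OF v(1)[unfolded evolves_def]] that] by (simp add: seg_in_BU_iff)
      then have "infnorm (v n s) \<le> k0 + 1"
        using vdist[of s n] False that \<epsilon>'(3) by (intro orbit_perturbation_bound[OF k0(2), of "s + t n"]) auto
      then show ?thesis using k k0(1) by (simp add: k1_def)
    qed
    have equi: "\<exists>d>0. \<forall>n s s'. s \<le> 0 \<longrightarrow> s' \<le> 0 \<longrightarrow> \<bar>s - s'\<bar> < d \<longrightarrow> norm (v n s - v n s') < e" if e: "0 < e" for e
    proof -
      have e2: "0 < e / 2" using e by simp
      obtain d1 where d1: "0 < d1" "\<And>s t. \<bar>s - t\<bar> < d1 \<Longrightarrow> norm (Z s - Z t) < e / 2"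
        using Z_uniformly_continuous[OF e2] by metis
      obtain d2 where d2: "0 < d2" "\<forall>s\<in>{..0}. \<forall>s'\<in>{..0}. dist s' s < d2 \<longrightarrow> dist (y s' - x s') (y s - x s) < e / 2"
        using uc_yx e2 unfolding uniformly_continuous_on_def by blast
      have "norm (v n s - v n s') < e" if "s \<le> 0" "s' \<le> 0" "\<bar>s - s'\<bar> < min d1 d2" for n s s'
      proof -
        have "v n s - v n s' = (Z (t n + s) - Z (t n + s')) + ((y s - x s) - (y s' - x s'))"
          using that by (simp add: v0)
        moreover have "norm (Z (t n + s) - Z (t n + s')) < e / 2" using d1(2) that by simp
        moreover have "norm ((y s - x s) - (y s' - x s')) < e / 2"
          using d2(2)[rule_format, of s' s] that by (simp add: dist_real_def dist_norm)
        ultimately show ?thesis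
          using norm_triangle_ineq[of "Z (t n + s) - Z (t n + s')" "(y s - x s) - (y s' - x s')"] by simp
      qed
      then show ?thesis using d1(1) d2(1) by (intro exI[of _ "min d1 d2"]) auto
    qed
    \<comment> \<open>\<open>Y n - y\<close> is the orbit segment minus \<open>x\<close>, so by
      translation invariance the perturbed histories converge to \<open>y\<close> exactly as the
      orbit segments converge to \<open>x\<close>.\<close>
    have vy: "(\<lambda>n. co_dist (seg (v n) 0) y) \<longlonglongrightarrow> 0"
    proof -
      have "co_dist (seg (v n) 0) y = co_dist (seg Z (t n + 0)) (seg z 0)" for n
        unfolding v(2) z(2) by (rule co_dist_cong) (use segZ_CX x yBU YBU BU_in_CX Y in auto)
      then show ?thesis using lim[of 0] T by simp
    qed
    obtain r z' where r: "strict_mono (r :: nat \<Rightarrow> nat)" and z': "evolves 0 T \<omega> z'" "seg z' 0 = y"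
      and lim': "\<And>s. s \<le> T \<Longrightarrow> (\<lambda>n. co_dist (seg (v (r n)) s) (seg z' s)) \<longlonglongrightarrow> 0"
    proof (rule evolves_subsequence_limit[OF t(3) v(1) _ vk equi yBU vy T])
      show "0 < k1 + 1" using k1 by simp
    qed blast+
    have ex: "sol_exists D F \<sigma> T \<omega> y" using z' sol_exists_iff[OF yBU T] by blast
    have CX: "seg z T \<in> CX" "seg z' T \<in> CX" "seg (v n) T \<in> CX" for n
      using z(1) z'(1) v(1)[of n] by (simp_all add: evolves_def BU_in_CX seg_in_BU_iff)
    have l1: "(\<lambda>n. co_dist (seg Z (t (r n) + T)) (seg z T)) \<longlonglongrightarrow> 0"
      using LIMSEQ_subseq_LIMSEQ[OF lim[OF order_refl] r] by (simp add: o_def)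
    have "co_dist (seg z T) (seg z' T) \<le> 0 + \<epsilon>' + 0"
    proof (rule LIMSEQ_le_const)
      show "(\<lambda>n. co_dist (seg Z (t (r n) + T)) (seg z T) + \<epsilon>' + co_dist (seg (v (r n)) T) (seg z' T)) \<longlonglongrightarrow> 0 + \<epsilon>' + 0"
        by (intro tendsto_add l1 lim' tendsto_const order_refl)
      have "co_dist (seg z T) (seg z' T) \<le> co_dist (seg Z (t (r n) + T)) (seg z T) + \<epsilon>' + co_dist (seg (v (r n)) T) (seg z' T)" for n
        using co_dist_triangle[OF CX(1) segZ_CX CX(2), of "t (r n) + T"]
          co_dist_triangle[OF segZ_CX CX(3) CX(2), of "t (r n) + T" "r n"]
          co_dist_commute[of "seg z T"] vdist[OF T order_refl, of "r n"]
        by (simp add: add.commute[of T])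
      then show "\<exists>N. \<forall>n\<ge>N. co_dist (seg z T) (seg z' T) \<le> co_dist (seg Z (t (r n) + T)) (seg z T) + \<epsilon>' + co_dist (seg (v (r n)) T) (seg z' T)"
        by blast
    qed
    then show ?thesis using ex \<epsilon>'(2) sol_u_eq[OF x(1) z T] sol_u_eq[OF yBU z' T] by simp
  qed
  then show "\<exists>\<delta>>0. \<forall>\<omega> x y. (\<omega>, x) \<in> K \<and> y \<in> BB k \<and> co_dist x y < \<delta> \<and> (le x y \<or> le y x) \<longrightarrow>
          (\<forall>t\<ge>0. sol_exists D F \<sigma> t \<omega> y
             \<and> co_dist (sol_u D F \<sigma> t \<omega> x) (sol_u D F \<sigma> t \<omega> y) \<le> \<epsilon>)"
    using \<delta>0 by blast
qed

section \<open>Common upper bounds and uniform stability\<close>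

text \<open>The order of choices matters: \<open>K_uniformly_stable\<close> takes
  \<open>\<epsilon>\<close> to be the stability threshold belonging to \<open>BB k\<close>, so
  \<open>k\<close> has to be fixed first.\<close>

lemma K_upper_bound:
  assumes le: "translation_invariant le"
    and ub: "has_upper_bounds le"
  obtains k where "0 < k" "\<And>\<epsilon>. 0 < \<epsilon> \<Longrightarrow> \<exists>\<delta>>0. \<forall>\<omega> x y. (\<omega>, x) \<in> K \<longrightarrow> (\<omega>, y) \<in> K \<longrightarrow> co_dist x y < \<delta> \<longrightarrow>
    (\<exists>a\<in>BB k. le x a \<and> le y a \<and> co_dist x a < \<epsilon> \<and> co_dist y a < \<epsilon>)"
proof -
  obtain k0 where k0: "0 < k0" "\<And>t. infnorm (Z t) \<le> k0" using Z_bounded by metis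
  obtain L where L: "0 < L" "\<And>\<omega> x t h. (\<omega>, x) \<in> K \<Longrightarrow> t \<le> 0 \<Longrightarrow> 0 \<le> h \<Longrightarrow> norm (x t - x (t - h)) \<le> L * h"
    by (rule K_lipschitz, rule that) blast+
  \<comment> \<open>One constant for both the size and the Lipschitz constant of half the difference
    of two points of \<open>K\<close>.\<close>
  define B where "B = max L (CARD('m) * k0)"
  have B: "0 < B" "L \<le> B" "CARD('m) * k0 \<le> B" using L(1) by (auto simp: B_def)
  obtain k where k: "\<And>n \<epsilon>. 0 < \<epsilon> \<Longrightarrow> \<exists>N \<eta>. 0 < \<eta> \<and> 0 \<le> N \<and> (\<forall>p. locally_small B N \<eta> p \<longrightarrow> (\<exists>\<zeta>. small_bound le k n \<epsilon> p \<zeta>))"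
    using ub B(1) unfolding has_upper_bounds_def by metis
  show thesis
  proof (rule that[of "max 1 (k0 + k)"])
    fix \<epsilon> :: real assume \<epsilon>: "0 < \<epsilon>"
    \<comment> \<open>One third of \<open>\<epsilon>\<close> each for the part of the distance
      beyond \<open>{- real n..0}\<close>, for \<open>\<zeta>\<close>, and for half the
      difference.\<close>
    obtain n where n: "(1/2::real) ^ n < \<epsilon> / 3" using real_arch_pow_inv[of "\<epsilon> / 3" "1/2"] \<epsilon> by auto
    obtain N \<eta> where N: "0 < \<eta>" "0 \<le> N" "\<And>p. locally_small B N \<eta> p \<Longrightarrow> \<exists>\<zeta>. small_bound le k n (\<epsilon> / 3) p \<zeta>"
      using k[of "\<epsilon> / 3" n] \<epsilon> by auto
    obtain M where M: "N \<le> real M" "n \<le> M" using real_arch_simple[of "max N (real n)"] by auto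
    \<comment> \<open>The first bound, multiplied by the dimension, gives the Euclidean bound of
      \<open>locally_small\<close>; the second serves the distance from \<open>a\<close> to
      \<open>x\<close> and \<open>y\<close>.\<close>
    define \<eta>' where "\<eta>' = min (\<eta> / CARD('m)) (\<epsilon> / 3)"
    have \<eta>': "0 < \<eta>'" "CARD('m) * \<eta>' \<le> \<eta>" "\<eta>' \<le> \<epsilon> / 3"
      using N(1) \<epsilon> by (auto simp: \<eta>'_def min_def field_simps)
    obtain d1 where d1: "0 < d1" "\<And>x y s. x \<in> CX \<Longrightarrow> y \<in> CX \<Longrightarrow> co_dist x y < d1 \<Longrightarrow>
        s \<in> {- real M..0} \<Longrightarrow> infnorm (x s - y s :: real^'m) \<le> \<eta>'"
      by (rule co_dist_small[OF \<eta>'(1), of M], rule that) blast+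
    obtain d2 where d2: "0 < d2" "\<And>\<omega> x y t h. (\<omega>, x) \<in> K \<Longrightarrow> (\<omega>, y) \<in> K \<Longrightarrow> co_dist x y < d2 \<Longrightarrow> t \<in> {- N..0} \<Longrightarrow>
        0 \<le> h \<Longrightarrow> h \<le> 1 \<Longrightarrow> norm ((x t - y t) - (x (t - h) - y (t - h))) \<le> \<eta> * h"
      by (rule K_close_lipschitz[OF N(1,2)], rule that) blast+
    have "\<exists>a\<in>BB (max 1 (k0 + k)). le x a \<and> le y a \<and> co_dist x a < \<epsilon> \<and> co_dist y a < \<epsilon>"
      if K: "(\<omega>, x) \<in> K" "(\<omega>, y) \<in> K" and d: "co_dist x y < min d1 d2" for \<omega> x y
    proof -
      have BU: "x \<in> BU" "y \<in> BU" using K_BU K by auto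
      have CX: "x \<in> CX" "y \<in> CX" using BU BU_in_CX by auto
      have ucb: "ucb 0 x" "ucb 0 y" using BU seg_in_BU_iff[of x 0] seg_in_BU_iff[of y 0] seg_zero[OF BU(1)] seg_zero[OF BU(2)] by simp_all
      have k0x: "infnorm (x s) \<le> k0" "infnorm (y s) \<le> k0" if "s \<le> 0" for s
        using K_BB[OF k0(2)] K that by (auto simp: BB_iff)
      define p where "p s = (1/2) *\<^sub>R (x s - y s)" for s
      have small: "infnorm (x s - y s) \<le> \<eta>'" if "s \<in> {- real M..0}" for s using d1(2)[OF CX _ that] d by simp
      have half: "norm (p s) \<le> c" if "norm (x s - y s) \<le> 2 * c" for s c using that by (simp add: p_def)
      have pd: "p s - p s' = (1/2) *\<^sub>R ((x s - y s) - (x s' - y s'))" for s s' by (simp add: p_def algebra_simps)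
      have "locally_small B N \<eta> p"
        unfolding locally_small_def
      proof (intro conjI allI ballI impI)
        show "ucb 0 p"
          unfolding p_def[abs_def] by (intro ucb_scaleR ucb_diff ucb)
        fix s h :: real
        {
          assume s: "s \<le> 0"
          have "norm (x s) \<le> CARD('m) * k0" "norm (y s) \<le> CARD('m) * k0"
            using k0x[OF s] by (intro order_trans[OF norm_le_card_infnorm mult_left_mono]; simp)+
          then show "norm (p s) \<le> B" using norm_triangle_ineq4[of "x s" "y s"] B(3) by (intro half) simp
          assume h: "0 \<le> h"
          have eq: "(x s - y s) - (x (s - h) - y (s - h)) = (x s - x (s - h)) - (y s - y (s - h))" by simp
          have "norm ((x s - y s) - (x (s - h) - y (s - h))) \<le> L * h + L * h"
            using norm_triangle_ineq4[of "x s - x (s - h)" "y s - y (s - h)"] L(2)[OF K(1) s h] L(2)[OF K(2) s h]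
            unfolding eq by linarith
          then have "norm (p s - p (s - h)) \<le> L * h" unfolding pd by simp
          also have "\<dots> \<le> B * h" using B(2) h by (rule mult_right_mono)
          finally show "norm (p s - p (s - h)) \<le> B * h" .
        }
        assume s: "s \<in> {- N..0}"
        have "norm (x s - y s) \<le> CARD('m) * \<eta>'"
          using s M(1) by (intro order_trans[OF norm_le_card_infnorm mult_left_mono] small) auto
        then show "norm (p s) \<le> \<eta>" using \<eta>'(2) N(1) by (intro half) linarith
        assume h: "0 \<le> h" "h \<le> 1"
        have "norm ((x s - y s) - (x (s - h) - y (s - h))) \<le> \<eta> * h" using d2(2)[OF K _ s h] d by simp
        moreover have "0 \<le> \<eta> * h" using N(1) h by simp
        ultimately show "norm (p s - p (s - h)) \<le> \<eta> * h" unfolding pd by simp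
      qed
      then obtain \<zeta> where "small_bound le k n (\<epsilon> / 3) p \<zeta>" using N(3) by blast
      then have \<zeta>: "ucb 0 \<zeta>" "\<And>s. s \<le> 0 \<Longrightarrow> infnorm (\<zeta> s) \<le> k" "\<And>s. s \<in> {- real n..0} \<Longrightarrow> infnorm (\<zeta> s) \<le> \<epsilon> / 3"
        "le (\<lambda>_. 0) (\<lambda>s. \<zeta> s + p s)" "le (\<lambda>_. 0) (\<lambda>s. \<zeta> s - p s)"
        by (auto simp: small_bound_def)
      define a where "a = seg (\<lambda>s. (1/2) *\<^sub>R (x s + y s) + \<zeta> s) 0"
      have a: "a s = (1/2) *\<^sub>R (x s + y s) + \<zeta> s" if "s \<le> 0" for s using that by (simp add: a_def)
      have ax: "a s - x s = \<zeta> s - p s" and ay: "a s - y s = \<zeta> s + p s" if "s \<le> 0" for s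
        unfolding a[OF that] p_def by (simp_all add: vec_eq_iff field_simps)
      have aBU: "a \<in> BU"
      proof -
        have "ucb 0 (\<lambda>s. (1/2) *\<^sub>R (x s + y s) + \<zeta> s)"
          by (intro ucb_scaleR ucb_add ucb \<zeta>(1))
        then show ?thesis by (simp add: a_def seg_in_BU_iff)
      qed
      have "infnorm (a s) \<le> max 1 (k0 + k)" if s: "s \<le> 0" for s
      proof -
        have "infnorm ((1/2) *\<^sub>R (x s + y s)) \<le> k0"
          using infnorm_triangle[of "x s" "y s"] k0x[OF s] by (simp add: infnorm_mul)
        then show ?thesis
          using infnorm_triangle[of "(1/2) *\<^sub>R (x s + y s)" "\<zeta> s"] \<zeta>(2)[OF s] unfolding a[OF s] by linarith
      qed
      then have "a \<in> BB (max 1 (k0 + k))" using aBU by (simp add: BB_iff)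
      moreover have "le x a" by (rule translation_invariantD[OF le \<zeta>(5)]) (simp add: ax)
      moreover have "le y a" by (rule translation_invariantD[OF le \<zeta>(4)]) (simp add: ay)
      moreover have near: "infnorm (a s - x s) \<le> 2 * (\<epsilon> / 3)" "infnorm (a s - y s) \<le> 2 * (\<epsilon> / 3)" if s: "s \<in> {- real n..0}" for s
      proof -
        have "infnorm (p s) \<le> \<epsilon> / 3"
          using small[of s] s M(2) \<eta>'(3) infnorm_pos_le[of "x s - y s"] by (simp add: p_def infnorm_mul)
        then show "infnorm (a s - x s) \<le> 2 * (\<epsilon> / 3)" "infnorm (a s - y s) \<le> 2 * (\<epsilon> / 3)"
          using \<zeta>(3)[OF s] infnorm_triangle[of "\<zeta> s" "p s"] infnorm_triangle[of "\<zeta> s" "- p s"] infnorm_neg[of "p s"]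
            ax[of s] ay[of s] s by simp_all
      qed
      have "co_dist x a < \<epsilon>" "co_dist y a < \<epsilon>"
      proof -
        have "co_dist x a \<le> 2 * (\<epsilon> / 3) + (1/2) ^ n"
          by (rule co_dist_le[OF CX(1) BU_in_CX[OF aBU]]) (use \<epsilon> near infnorm_sub in \<open>auto simp: infnorm_sub\<close>)
        then show "co_dist x a < \<epsilon>" using n by simp
        have "co_dist y a \<le> 2 * (\<epsilon> / 3) + (1/2) ^ n"
          by (rule co_dist_le[OF CX(2) BU_in_CX[OF aBU]]) (use \<epsilon> near infnorm_sub in \<open>auto simp: infnorm_sub\<close>)
        then show "co_dist y a < \<epsilon>" using n by simp
      qed
      ultimately show ?thesis by blast
    qed
    then show "\<exists>\<delta>>0. \<forall>\<omega> x y. (\<omega>, x) \<in> K \<longrightarrow> (\<omega>, y) \<in> K \<longrightarrow> co_dist x y < \<delta> \<longrightarrow>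
      (\<exists>a\<in>BB (max 1 (k0 + k)). le x a \<and> le y a \<and> co_dist x a < \<epsilon> \<and> co_dist y a < \<epsilon>)"
      using d1(1) d2(1) by (intro exI[of _ "min d1 d2"]) auto
  qed simp
qed

text \<open>Two nearby points of \<open>K\<close> need not be comparable, but a common upper bound close to both
  is comparable with each of them.\<close>

lemma K_uniformly_stable:
  assumes le: "translation_invariant le"
    and ub: "has_upper_bounds le" and stable: "set_stable_le_bounded le D F \<sigma> K"
  shows "uniformly_stable D F \<sigma> K"
  unfolding uniformly_stable_def
proof (intro conjI K_compact K_pos_invariant allI impI)
  fix \<epsilon> :: real assume "0 < \<epsilon>"
  then have \<epsilon>: "0 < \<epsilon> / 2" by simp
  obtain k where k: "0 < k" "\<And>\<epsilon>. 0 < \<epsilon> \<Longrightarrow> \<exists>\<delta>>0. \<forall>\<omega> x y. (\<omega>, x) \<in> K \<longrightarrow> (\<omega>, y) \<in> K \<longrightarrow> co_dist x y < \<delta> \<longrightarrow>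
      (\<exists>a\<in>BB k. le x a \<and> le y a \<and> co_dist x a < \<epsilon> \<and> co_dist y a < \<epsilon>)"
    by (rule K_upper_bound[OF le ub], rule that) blast+
  have "\<exists>\<delta>>0. \<forall>\<omega> x y. (\<omega>, x) \<in> K \<and> y \<in> BB k \<and> co_dist x y < \<delta> \<and> (le x y \<or> le y x) \<longrightarrow>
          (\<forall>t\<ge>0. sol_exists D F \<sigma> t \<omega> y \<and> co_dist (sol_u D F \<sigma> t \<omega> x) (sol_u D F \<sigma> t \<omega> y) \<le> \<epsilon> / 2)"
    using stable k(1) \<epsilon> unfolding set_stable_le_bounded_def set_stable_le_in_def by blast
  then obtain d where d: "0 < d" "\<And>\<omega> x y t. (\<omega>, x) \<in> K \<Longrightarrow> y \<in> BB k \<Longrightarrow> co_dist x y < d \<Longrightarrow> le x y \<Longrightarrow> 0 \<le> t \<Longrightarrow>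
      sol_exists D F \<sigma> t \<omega> y \<and> co_dist (sol_u D F \<sigma> t \<omega> x) (sol_u D F \<sigma> t \<omega> y) \<le> \<epsilon> / 2"
    by metis
  obtain \<delta> where \<delta>: "0 < \<delta>" "\<And>\<omega> x y. (\<omega>, x) \<in> K \<Longrightarrow> (\<omega>, y) \<in> K \<Longrightarrow> co_dist x y < \<delta> \<Longrightarrow>
      \<exists>a\<in>BB k. le x a \<and> le y a \<and> co_dist x a < d \<and> co_dist y a < d"
    using k(2)[OF d(1)] by metis
  have "co_dist (sol_u D F \<sigma> t \<omega> x) (sol_u D F \<sigma> t \<omega> y) \<le> \<epsilon>"
    if K: "(\<omega>, x) \<in> K" "(\<omega>, y) \<in> K" and xy: "co_dist x y < \<delta>" and t: "0 \<le> t" for \<omega> x y t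
  proof -
    obtain a where a: "a \<in> BB k" "le x a" "le y a" "co_dist x a < d" "co_dist y a < d"
      using \<delta>(2)[OF K xy] by blast
    note xa = d(2)[OF K(1) a(1,4,2) t] and ya = d(2)[OF K(2) a(1,5,3) t]
    have aBU: "a \<in> BU" using a(1) by (simp add: BB_iff)
    have ex: "sol_exists D F \<sigma> t \<omega> x" "sol_exists D F \<sigma> t \<omega> y"
      using K_forward(1) K t by blast+
    have CX: "sol_u D F \<sigma> t \<omega> x \<in> CX" "sol_u D F \<sigma> t \<omega> y \<in> CX" "sol_u D F \<sigma> t \<omega> a \<in> CX"
      using sol_u_in_BU[OF K_BU[OF K(1)] ex(1)] sol_u_in_BU[OF K_BU[OF K(2)] ex(2)] sol_u_in_BU[OF aBU conjunct1[OF xa]]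
      by (auto intro: BU_in_CX)
    show ?thesis
      using co_dist_triangle[OF CX(1,3,2)] xa ya
        co_dist_commute[of "sol_u D F \<sigma> t \<omega> y" "sol_u D F \<sigma> t \<omega> a"] by linarith
  qed
  then show "\<exists>\<delta>>0. \<forall>\<omega> x y. (\<omega>, x) \<in> K \<and> (\<omega>, y) \<in> K \<and> co_dist x y < \<delta> \<longrightarrow>
      (\<forall>t\<ge>0. co_dist (sol_u D F \<sigma> t \<omega> x) (sol_u D F \<sigma> t \<omega> y) \<le> \<epsilon>)"
    using \<delta>(1) by blast
qed

end

theorem proposition4p4:
  fixes \<sigma> :: "real \<Rightarrow> 'w::metric_space \<Rightarrow> 'w"
    and A :: "real^'m^'m::finite"
    and r :: real
    and \<nu> :: "'m \<Rightarrow> 'm \<Rightarrow> real measure"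
    and D :: "'m hist \<Rightarrow> real^'m"
    and F :: "'w \<Rightarrow> 'm hist \<Rightarrow> real^'m"
    and le :: "'m hist \<Rightarrow> 'm hist \<Rightarrow> bool"
    and \<omega>0 :: 'w and x0 :: "'m hist"
  assumes "compact (UNIV :: 'w set)"
    and "minimal_flow \<sigma>"
    and "quasipositive A"
    and "0 < r"
    and "case_I A r \<nu> D F le \<or> case_II A \<nu> D F le \<or> case_III A \<nu> D F le"
    and "x0 \<in> BU"
    and "\<forall>t\<ge>0. sol_exists D F \<sigma> t \<omega>0 x0"
    and "relatively_compact (forward_orbit D F \<sigma> \<omega>0 x0)"
    and "orbit_stable_le_bounded le D F \<sigma> \<omega>0 x0"
  shows "set_stable_le_bounded le D F \<sigma> (omega_limit D F \<sigma> \<omega>0 x0)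
       \<and> uniformly_stable D F \<sigma> (omega_limit D F \<sigma> \<omega>0 x0)"
proof -
  have off: "offdiag_nonneg A" by (rule quasipositive_offdiag[OF assms(3)])
  have D: "cond_D3_D5 \<nu> D" and F: "cond_F1 F" "cond_F2 F" "cond_F3 F"
    using assms(5) by (auto simp: case_I_def case_II_def case_III_def)
  have "le = le_fin A r \<or> le = le_inf A \<and> eigenvalues_neg A"
    using assms(5) by (auto simp: case_I_def case_II_def case_III_def)
  then have le: "translation_invariant le" "has_upper_bounds le"
    using has_upper_bounds_le_fin[OF off assms(4)] has_upper_bounds_le_inf[OF off]
      translation_invariant_le_fin[of A r] translation_invariant_le_inf[of A] by auto
  \<comment> \<open>In the two cases with zero measures all masses vanish, so constant weights and
    the factor 0 fit the framework of the neutral equation.\<close>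
  have "zero_nu \<nu> \<or> cond_D4 D" using assms(5) by (auto simp: case_I_def case_II_def case_III_def)
  then obtain w q where w: "\<And>i. 0 < w $ i" and q: "0 \<le> q" "q < 1"
    and mass: "\<And>i. (\<Sum>j\<in>UNIV. measure (\<nu> i j) (space (\<nu> i j)) * w $ j) \<le> q * w $ i"
  proof
    assume "zero_nu \<nu>"
    then show thesis using that[of 1 0] by (simp add: D_weights_zero_nu[OF D])
  next
    assume "cond_D4 D"
    then show thesis by (rule D_weights_D4[OF D]) (rule that)
  qed
  interpret delay_orbit \<nu> D w q \<sigma> F \<omega>0 x0
    using D w q mass assms(1,2,6,7,8) F by unfold_locales (auto simp: minimal_flow_def)
  have "set_stable_le_bounded le D F \<sigma> (omega_limit D F \<sigma> \<omega>0 x0)"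
    by (rule K_set_stable[OF le(1) assms(9)])
  then show ?thesis using K_uniformly_stable[OF le] by blast
qed

end
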